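(* Let $\sigma>0$ and let $f:\mathbb{R}\to\mathbb{R}$ be a nonnegative convex function such that $\int^\infty \frac{1}{f(s)}\,ds<\infty$. Then, for every nonnegative initial datum $u_0\in C_0([0,1])$, $u_0\ge 0$, the solution $u$ of the stochastic partial differential equation $$u_t=u_{xx}+f(u)+\sigma\,\dot W(x,t),\quad x\in(0,1),\ t>0,\qquad u(0,t)=u(1,t)=0,\qquad u(x,0)=u_0(x),$$ blows up in finite (random) time $T$, with $$\mathbb{P}^{u_0}(T<\infty)=1,$$ where $T$ is the maximal existence (explosion) time of $u$ and $\mathbb{P}^{u_0}$ denotes probability when the initial datum is $u_0$.
   Context: Notation. $C_0([0,1])$ is the space of continuous functions on $[0,1]$ vanishing at $0$ and $1$. The condition $\int^\infty 1/f<\infty$ means that there is $a\in\mathbb{R}$ with $f>0$ on $[a,\infty)$ and $\int_a^\infty \frac{ds}{f(s)}<\infty$. A (finite) convex function on $\mathbb{R}$ is locally Lipschitz. Setting. $(\Omega,\mathcal{F},(\mathcal{F}_t)_{t\ge0},\mathbb{P})$ is a filtered probability space with right-continuous filtration such that $\mathcal{F}_0$ contains all $\mathbb{P}$-null sets, carrying a space-time white noise $\dot W$ on $\mathbb{R}_+\times[0,1]$ ($W$ is the associated Brownian sheet). Solution for globally Lipschitz $g$. For $g$ globally Lipschitz, the solution of $u_t=u_{xx}+g(u)+\sigma\dot W$ with homogeneous Dirichlet boundary conditions and initial datum $u_0\in C_0([0,1])$ is the unique $(\mathcal{F}_t)$-adapted process, continuous in time, with values in $C_0([0,1])$ such that,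 for every $\varphi\in C^\infty([0,1])$ with $\varphi(0)=\varphi(1)=0$ and all $t\ge0$, almost surely $$\int_0^1 u(x,t)\varphi(x)\,dx-\int_0^1u_0\varphi\,dx=\int_0^t\!\int_0^1u(x,s)\varphi_{xx}(x)\,dx\,ds+\int_0^t\!\int_0^1 g(u(x,s))\varphi(x)\,dx\,ds+\sigma\int_0^t\!\int_0^1\varphi(x)\,dW(x,s).$$ Existence and uniqueness of this global solution are known. This weak formulation is known to be equivalent to the integral (mild) formulation $$u(x,t)=\int_0^1G_t(x,y)u_0(y)\,dy+\int_0^t\!\int_0^1G_{t-s}(x,y)g(u(y,s))\,dy\,ds+\sigma\int_0^t\!\int_0^1G_{t-s}(x,y)\,dW(y,s),$$ with $G$ the Dirichlet heat kernel on $(0,1)$. Solution and explosion time for locally Lipschitz $f$. For $m\in\mathbb{N}$ let $f_m(s)=f(-m)$ for $s\le -m$, $f_m(s)=f(s)$ for $-m<s<m$, $f_m(s)=f(m)$ for $s\ge m$. Let $u^{(m)}$ be the solution with nonlinearity $f_m$ and let $T_m$ be the first time at which $\|u^{(m)}(\cdot,t)\|_\infty$ reaches the value $m$. The stopping times $T_m$ increase with $m$, and $u^{(m+1)}=u^{(m)}$ for $t<T_m$ a.s. The maximal existence (explosion) time is $T:=\lim_{m}T_m\in(0,\infty]$, and the solution is $u(x,t):=\lim_m u^{(m)}(x,t)$ for $t<T$. On $\{T<\infty\}$ one has $\lim_{t\nearrow T}\|u(\cdot,t)\|_\infty=\infty$. *)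

theory Defs
  imports "HOL-Probability.Probability"
begin

section \<open>Filtered probability spaces and space-time white noise\<close>

text \<open>
  Time is a real number; only the \<open>\<sigma>\<close>-algebras \<open>F t\<close> with \<open>t \<ge> 0\<close> are constrained or used.
\<close>

locale filtered_prob_space = prob_space M for M :: "'w measure" +
  fixes F :: "real \<Rightarrow> 'w measure"
  assumes subalgebra_F: "0 \<le> t \<Longrightarrow> subalgebra M (F t)"
    and F_mono: "0 \<le> s \<Longrightarrow> s \<le> t \<Longrightarrow> sets (F s) \<subseteq> sets (F t)"
    and F_right_continuous: "0 \<le> t \<Longrightarrow> sets (F t) = (\<Inter>s\<in>{t<..}. sets (F s))"
    and null_sets_F_0: "null_sets M \<subseteq> sets (F 0)"

text \<open>The random variable \<open>X\<close> has law \<open>N(0, v)\<close>; for \<open>v = 0\<close> this is the Dirac measure at \<open>0\<close>.\<close>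

definition centered_gaussian :: "'w measure \<Rightarrow> ('w \<Rightarrow> real) \<Rightarrow> real \<Rightarrow> bool" where
  "centered_gaussian M X v \<longleftrightarrow>
     X \<in> borel_measurable M \<and>
     distr M borel X =
       (if v = 0 then return borel 0
        else density lborel (\<lambda>x. ennreal (normal_density 0 (sqrt v) x)))"

text \<open>Points of the space-time strip are pairs \<open>(x, t)\<close>, space first.\<close>

definition noise_sets :: "real set \<Rightarrow> (real \<times> real) set set" where
  "noise_sets J = {A \<in> sets borel. A \<subseteq> {0..1} \<times> J \<and> emeasure lborel A < \<infinity>}"

text \<open>
  \<open>W A\<close> is the noise mass of \<open>A\<close>, so \<open>W ({0..x} \<times> {0..t})\<close> is the associated Brownian sheet.
  The first assumption says that \<open>W\<close> is a centred Gaussian process with covariance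
  \<open>E (W A * W B) = \<bar>A \<inter> B\<bar>\<close>; the other two are the usual compatibility with the filtration
  (adaptedness, and independence of the noise after time \<open>t\<close> from \<open>F t\<close>).
\<close>

locale space_time_white_noise = filtered_prob_space M F
  for M :: "'w measure" and F :: "real \<Rightarrow> 'w measure" +
  fixes W :: "(real \<times> real) set \<Rightarrow> 'w \<Rightarrow> real"
  assumes W_gaussian: "finite \<A> \<Longrightarrow> \<A> \<subseteq> noise_sets {0..} \<Longrightarrow>
      centered_gaussian M (\<lambda>\<omega>. \<Sum>A\<in>\<A>. c A * W A \<omega>)
        (\<Sum>A\<in>\<A>. \<Sum>B\<in>\<A>. c A * c B * measure lborel (A \<inter> B))"
    and W_adapted: "0 \<le> t \<Longrightarrow> A \<in> noise_sets {0..t} \<Longrightarrow> W A \<in> borel_measurable (F t)"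
    and W_indep: "0 \<le> t \<Longrightarrow> indep_set (sets (F t))
      (sigma_sets (space M)
        (\<Union>A\<in>noise_sets {t<..}. {W A -` B \<inter> space M | B. B \<in> sets borel}))"

text \<open>
  \<open>I\<close> is a version of the stochastic (Wiener) integral of the deterministic square-integrable
  \<open>h\<close> against \<open>W\<close>: the \<open>L\<^sup>2\<close>-limit of the integrals of step functions converging to \<open>h\<close>
  in \<open>L\<^sup>2\<close>.  It is unique up to almost sure equality.
\<close>

definition has_wiener_integral ::
  "'w measure \<Rightarrow> ((real \<times> real) set \<Rightarrow> 'w \<Rightarrow> real) \<Rightarrow> (real \<times> real \<Rightarrow> real) \<Rightarrow> ('w \<Rightarrow> real) \<Rightarrow> bool"
where
  "has_wiener_integral M W h I \<longleftrightarrow>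
     h \<in> borel_measurable borel \<and> I \<in> borel_measurable M \<and>
     (\<exists>\<A> c. (\<forall>n::nat. finite (\<A> n) \<and> \<A> n \<subseteq> noise_sets {0..}) \<and>
        (\<lambda>n. \<integral>\<^sup>+z. ennreal ((h z - (\<Sum>A\<in>\<A> n. c n A * indicator A z))\<^sup>2) \<partial>lborel) \<longlonglongrightarrow> 0 \<and>
        (\<lambda>n. \<integral>\<^sup>+\<omega>. ennreal ((I \<omega> - (\<Sum>A\<in>\<A> n. c n A * W A \<omega>))\<^sup>2) \<partial>M) \<longlonglongrightarrow> 0)"

section \<open>Solutions for globally Lipschitz nonlinearities\<close>

definition C0 :: "(real \<Rightarrow> real) set" where
  "C0 = {v. continuous_on {0..1} v \<and> v 0 = 0 \<and> v 1 = 0}"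

definition sup_norm :: "(real \<Rightarrow> real) \<Rightarrow> real" where
  "sup_norm v = (SUP x\<in>{0..1}. \<bar>v x\<bar>)"

text \<open>
  \<open>D 0\<close> is a function in \<open>C\<^sup>\<infinity>([0,1])\<close> vanishing at both end points, and \<open>D k\<close> is its
  \<open>k\<close>-th derivative (one-sided at the end points).
\<close>

definition test_function :: "(nat \<Rightarrow> real \<Rightarrow> real) \<Rightarrow> bool" where
  "test_function D \<longleftrightarrow>
     (\<forall>k. \<forall>x\<in>{0..1}. (D k has_real_derivative D (Suc k) x) (at x within {0..1})) \<and>
     D 0 0 = 0 \<and> D 0 1 = 0"

text \<open>
  The process is \<open>u \<omega> t x\<close>.  Since the Borel \<open>\<sigma>\<close>-algebra of \<open>C\<^sub>0([0,1])\<close> is generated by the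
  point evaluations, adaptedness of the \<open>C\<^sub>0([0,1])\<close>-valued process is stated pointwise in \<open>x\<close>.
  The initial condition is contained in the equation at \<open>t = 0\<close>.
\<close>

definition spde_solution ::
  "'w measure \<Rightarrow> (real \<Rightarrow> 'w measure) \<Rightarrow> ((real \<times> real) set \<Rightarrow> 'w \<Rightarrow> real) \<Rightarrow> real \<Rightarrow>
   (real \<Rightarrow> real) \<Rightarrow> (real \<Rightarrow> real) \<Rightarrow> ('w \<Rightarrow> real \<Rightarrow> real \<Rightarrow> real) \<Rightarrow> bool"
where
  "spde_solution M F W \<sigma> g u0 u \<longleftrightarrow>
     (\<forall>\<omega>\<in>space M. \<forall>t\<ge>0. u \<omega> t \<in> C0) \<and>
     (\<forall>\<omega>\<in>space M. \<forall>t\<ge>0.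
        ((\<lambda>s. sup_norm (\<lambda>x. u \<omega> s x - u \<omega> t x)) \<longlongrightarrow> 0) (at t within {0..})) \<and>
     (\<forall>t\<ge>0. \<forall>x\<in>{0..1}. (\<lambda>\<omega>. u \<omega> t x) \<in> borel_measurable (F t)) \<and>
     (\<forall>D. test_function D \<longrightarrow> (\<forall>t\<ge>0. \<exists>I.
        has_wiener_integral M W (\<lambda>(x, s). indicator ({0..1} \<times> {0..t}) (x, s) * D 0 x) I \<and>
        (AE \<omega> in M.
           (LBINT x:{0..1}. u \<omega> t x * D 0 x) - (LBINT x:{0..1}. u0 x * D 0 x) =
             (LBINT s:{0..t}. (LBINT x:{0..1}. u \<omega> s x * D 2 x))
           + (LBINT s:{0..t}. (LBINT x:{0..1}. g (u \<omega> s x) * D 0 x))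
           + \<sigma> * I \<omega>)))"

section \<open>Maximal solutions for locally Lipschitz nonlinearities\<close>

definition truncation :: "(real \<Rightarrow> real) \<Rightarrow> nat \<Rightarrow> real \<Rightarrow> real" where
  "truncation f m s =
     (if s \<le> - real m then f (- real m) else if s < real m then f s else f (real m))"

text \<open>
  The first time at which the norm of the path \<open>v\<close> reaches the level \<open>m\<close>, and \<open>\<infinity>\<close> if there is none.
  With \<open>\<ge>\<close>, levels below the norm of the initial datum are reached at time \<open>0\<close>, which makes these
  times increase with \<open>m\<close>; for the other levels, continuity makes it the same as \<open>=\<close>.
\<close>

definition reach_time :: "nat \<Rightarrow> (real \<Rightarrow> real \<Rightarrow> real) \<Rightarrow> ereal" where
  "reach_time m v = Inf (ereal ` {t. 0 \<le> t \<and> real m \<le> sup_norm (v t)})"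

definition maximal_solution ::
  "'w measure \<Rightarrow> (real \<Rightarrow> 'w measure) \<Rightarrow> ((real \<times> real) set \<Rightarrow> 'w \<Rightarrow> real) \<Rightarrow> real \<Rightarrow>
   (real \<Rightarrow> real) \<Rightarrow> (real \<Rightarrow> real) \<Rightarrow> ('w \<Rightarrow> real \<Rightarrow> real \<Rightarrow> real) \<Rightarrow> ('w \<Rightarrow> ereal) \<Rightarrow> bool"
where
  "maximal_solution M F W \<sigma> f u0 u T \<longleftrightarrow>
     (\<exists>U. (\<forall>m. spde_solution M F W \<sigma> (truncation f m) u0 (U m)) \<and>
        (\<forall>\<omega>\<in>space M. T \<omega> = lim (\<lambda>m. reach_time m (U m \<omega>))) \<and>
        (AE \<omega> in M. \<forall>t x. 0 \<le> t \<and> ereal t < T \<omega> \<and> x \<in> {0..1} \<longrightarrow>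
            (\<lambda>m. U m \<omega> t x) \<longlonglongrightarrow> u \<omega> t x))"

text \<open>The condition \<open>\<integral>\<^sup>\<infinity> 1/f < \<infinity>\<close>.\<close>

definition reciprocal_integrable_at_top :: "(real \<Rightarrow> real) \<Rightarrow> bool" where
  "reciprocal_integrable_at_top f \<longleftrightarrow>
     (\<exists>a. (\<forall>s\<ge>a. 0 < f s) \<and> set_integrable lborel {a..} (\<lambda>s. 1 / f s))"

end

theory Submission
  imports Defs
begin

text \<open>
  Testing the equation against \<open>\<phi>(x) = \<pi>/2 * sin (\<pi> x)\<close> and using Jensen's inequality, the mass
  \<open>Z t = \<integral> u(x,t) \<phi>(x) dx\<close> satisfies \<open>dZ \<ge> (f Z - \<pi>\<^sup>2 Z) dt + dY\<close>, where \<open>Y\<close> is a multiple of a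
  Brownian motion, as long as the solution exists.  No stochastic calculus is needed: \<open>Y\<close> is a
  continuous residual of the weak equation, and only its increments enter, through their
  independence of the past and crude bounds on their laws.

  Since the drift is at least \<open>- \<pi>\<^sup>2 Z\<close>, the value \<open>Z n\<close> dominates a process with bounded
  first moments, so \<open>Z n \<ge> - R\<close> with probability at least \<open>1 - \<epsilon>\<close>, uniformly in \<open>n\<close>.  From such a
  state, a large increment of \<open>Y\<close> on \<open>[n, n + 1/2]\<close> that is mostly kept on \<open>[n + 1/2, n + 1]\<close>
  forces blow-up before \<open>n + 1\<close>, because \<open>\<integral> 1/f\<close> converges; this happens with a conditional
  probability bounded below.  Hence survival up to time \<open>n\<close> for all \<open>n\<close> has probability at
  most \<open>\<epsilon>\<close>.

  The times at which the truncated solutions reach their levels increase because two solutions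
  with the same noise differ by a weak solution of a heat equation, to which an energy estimate
  in the sine basis applies.
\<close>

section \<open>Sine series on the unit interval\<close>

text \<open>Independence from the past is given only for noise sets lying after the present time,
  while a Wiener integral is an L2 limit of step integrals whose sets may straddle it. Increments
  are therefore compared with step integrals over the later strip, which are exactly Gaussian and
  independent; the error is made arbitrarily small.

  Apart from a Gaussian lower tail, the laws enter only through second moments at fixed times. In
  place of a maximal inequality, Fubini and Markov control the Lebesgue measure of the times at
  which the noise is low. This is why a jump is kept "mostly": a fixed fraction of the last half
  unit is enough to exhaust the small tail of the integral of \<open>1/f\<close>.

  Jensen's inequality is applied to \<open>f\<close> itself, because the truncations need not be
  convex; hence it is available only before the level is reached. The linear lower bound needs only
  a nonnegative reaction and holds for all times.

  The weight is the first Dirichlet eigenfunction, normalised to integral 1: the eigenvalue produces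
  the linear drift, the normalisation makes Jensen applicable. The required jump depends on
  \<open>R\<close>, hence on \<open>\<epsilon>\<close>, but not on \<open>n\<close>.\<close>

abbreviation sine_mode :: "nat \<Rightarrow> real \<Rightarrow> real" where
  "sine_mode k x \<equiv> sin (real (Suc k) * pi * x)"

lemma integral_cos_int_pi:
  fixes n :: int
  shows "integral {0..1} (\<lambda>x. cos (of_int n * pi * x)) = (if n = 0 then 1 else 0)"
proof (cases "n = 0")
  case False
  have "((\<lambda>x. cos (of_int n * pi * x)) has_integral
      sin (of_int n * pi * 1) / (of_int n * pi) - sin (of_int n * pi * 0) / (of_int n * pi)) {0..1}"
    using False
    by (intro fundamental_theorem_of_calculus)
       (auto intro!: derivative_eq_intros simp flip: has_real_derivative_iff_has_vector_derivative)
  moreover have "sin (of_int n * pi) = 0"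
    by (simp add: sin_zero_iff_int2)
  ultimately show ?thesis
    using False by (simp add: integral_unique)
qed simp

lemma sine_mode_orthogonal:
  "integral {0..1} (\<lambda>x. sine_mode j x * sine_mode k x) = (if j = k then 1/2 else 0)"
proof -
  have "(\<lambda>x. sine_mode j x * sine_mode k x) =
     (\<lambda>x. 1/2 * (cos (of_int (int j - int k) * pi * x) - cos (of_int (int j + int k + 2) * pi * x)))"
    by (rule ext) (simp add: sin_times_sin algebra_simps diff_divide_distrib)
  then have "integral {0..1} (\<lambda>x. sine_mode j x * sine_mode k x) = integral {0..1} (\<lambda>x.
      1/2 * (cos (of_int (int j - int k) * pi * x) - cos (of_int (int j + int k + 2) * pi * x)))"
    by (rule arg_cong)
  also have "\<dots> = 1/2 * (integral {0..1} (\<lambda>x. cos (of_int (int j - int k) * pi * x))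
      - integral {0..1} (\<lambda>x. cos (of_int (int j + int k + 2) * pi * x)))"
    by (subst integral_mult_right, subst integral_diff)
       (auto intro!: integrable_continuous_real continuous_intros)
  finally show ?thesis
    unfolding integral_cos_int_pi by auto
qed

lemma integral_sum_continuous:
  fixes f :: "nat \<Rightarrow> real \<Rightarrow> real"
  assumes "\<And>k. k < K \<Longrightarrow> continuous_on {a..b} (f k)"
  shows "integral {a..b} (\<lambda>x. \<Sum>k<K. f k x) = (\<Sum>k<K. integral {a..b} (f k))"
  by (rule integral_sum) (auto intro!: integrable_continuous_real assms)

lemma integral_square_sine_sum:
  "integral {0..1} (\<lambda>x. (\<Sum>k<K. c k * sine_mode k x)\<^sup>2) = (\<Sum>k<K. (c k)\<^sup>2) / 2"
proof -
  have "(\<lambda>x. (\<Sum>k<K. c k * sine_mode k x)\<^sup>2) =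
     (\<lambda>x. \<Sum>j<K. \<Sum>k<K. c j * c k * (sine_mode j x * sine_mode k x))"
    by (rule ext) (simp add: power2_eq_square sum_product algebra_simps)
  then have "integral {0..1} (\<lambda>x. (\<Sum>k<K. c k * sine_mode k x)\<^sup>2) =
      (\<Sum>j<K. \<Sum>k<K. integral {0..1} (\<lambda>x. c j * c k * (sine_mode j x * sine_mode k x)))"
    by (simp only:) (subst integral_sum_continuous, intro continuous_intros,
        intro sum.cong refl integral_sum_continuous continuous_intros)
  also have "\<dots> = (\<Sum>j<K. \<Sum>k<K. c j * c k * (if j = k then 1/2 else 0))"
    by (simp only: integral_mult_right sine_mode_orthogonal)
  also have "\<dots> = (\<Sum>j<K. (c j)\<^sup>2 / 2)"
    by (intro sum.cong refl) (simp add: if_distrib power2_eq_square cong: if_cong)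
  finally show ?thesis
    by (simp add: sum_divide_distrib)
qed

text \<open>The coefficients are left free because two choices are needed: the Fourier coefficients
  for Bessel's inequality, and those of a uniform approximation for completeness.\<close>

lemma sine_sum_distance:
  assumes "continuous_on {0..1} h"
  shows "integral {0..1} (\<lambda>x. (h x - (\<Sum>k<K. c k * sine_mode k x))\<^sup>2) =
    integral {0..1} (\<lambda>x. (h x)\<^sup>2) - 2 * (\<Sum>k<K. c k * integral {0..1} (\<lambda>x. h x * sine_mode k x))
      + (\<Sum>k<K. (c k)\<^sup>2) / 2"
proof -
  have "(\<lambda>x. (h x - (\<Sum>k<K. c k * sine_mode k x))\<^sup>2) =
    (\<lambda>x. ((h x)\<^sup>2 - 2 * (\<Sum>k<K. c k * (h x * sine_mode k x))) + (\<Sum>k<K. c k * sine_mode k x)\<^sup>2)"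
    by (rule ext) (simp add: power2_diff sum_distrib_left algebra_simps)
  then have "integral {0..1} (\<lambda>x. (h x - (\<Sum>k<K. c k * sine_mode k x))\<^sup>2) = integral {0..1} (\<lambda>x. (h x)\<^sup>2)
      - 2 * integral {0..1} (\<lambda>x. \<Sum>k<K. c k * (h x * sine_mode k x))
      + integral {0..1} (\<lambda>x. (\<Sum>k<K. c k * sine_mode k x)\<^sup>2)"
    using assms
    by (simp only:) (subst integral_add, (auto intro!: integrable_continuous_real continuous_intros)[2],
        subst integral_diff, (auto intro!: integrable_continuous_real continuous_intros)[2],
        subst integral_mult_right, simp)
  also have "integral {0..1} (\<lambda>x. \<Sum>k<K. c k * (h x * sine_mode k x)) =
      (\<Sum>k<K. c k * integral {0..1} (\<lambda>x. h x * sine_mode k x))"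
    using assms
    by (subst integral_sum_continuous) (auto intro!: continuous_intros simp only: integral_mult_right)
  finally show ?thesis
    by (simp only: integral_square_sine_sum)
qed

lemma sine_bessel:
  assumes "continuous_on {0..1} h"
  shows "2 * (\<Sum>k<K. (integral {0..1} (\<lambda>x. h x * sine_mode k x))\<^sup>2) \<le> integral {0..1} (\<lambda>x. (h x)\<^sup>2)"
proof -
  let ?d = "\<lambda>k. integral {0..1} (\<lambda>x. h x * sine_mode k x)"
  \<comment> \<open>The modes have squared norm 1/2, so the best coefficients are
    \<open>2 * ?d k\<close>; the same normalisation is the origin of the factor 2 in the
    inequality.\<close>
  have "0 \<le> integral {0..1} (\<lambda>x. (h x - (\<Sum>k<K. (2 * ?d k) * sine_mode k x))\<^sup>2)"
    by (rule integral_nonneg) (auto intro!: integrable_continuous_real continuous_intros assms)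
  also have "\<dots> = integral {0..1} (\<lambda>x. (h x)\<^sup>2) - 2 * (\<Sum>k<K. (2 * ?d k) * ?d k) + (\<Sum>k<K. (2 * ?d k)\<^sup>2) / 2"
    by (rule sine_sum_distance[OF assms])
  also have "\<dots> = integral {0..1} (\<lambda>x. (h x)\<^sup>2) - 2 * (\<Sum>k<K. (?d k)\<^sup>2)"
    by (simp add: power2_eq_square sum_distrib_left sum_negf mult.assoc flip: sum_divide_distrib)
  finally show ?thesis by simp
qed

section \<open>Uniform density of sine polynomials and completeness\<close>

definition sine_polynomial :: "(real \<Rightarrow> real) \<Rightarrow> bool" where
  "sine_polynomial g \<longleftrightarrow> (\<exists>K c. g = (\<lambda>x. \<Sum>k<K. c k * sine_mode k x))"

lemma sine_polynomial_add:
  assumes "sine_polynomial g" "sine_polynomial h"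
  shows "sine_polynomial (\<lambda>x. g x + h x)"
proof -
  obtain K c L d where g: "g = (\<lambda>x. \<Sum>k<K. c k * sine_mode k x)"
    and h: "h = (\<lambda>x. \<Sum>k<L. d k * sine_mode k x)"
    using assms unfolding sine_polynomial_def by blast
  let ?N = "max K L"
  have pad: "(\<Sum>k<m. e k * sine_mode k x) = (\<Sum>k<?N. (if k < m then e k else 0) * sine_mode k x)"
    if "m \<le> ?N" for m e x
    by (rule sum.mono_neutral_cong_left) (use that in auto)
  have "g x + h x = (\<Sum>k<?N. ((if k < K then c k else 0) + (if k < L then d k else 0)) * sine_mode k x)" for x
    unfolding g h by (subst (1 2) pad) (simp_all only: distrib_right sum.distrib max.cobounded1 max.cobounded2)
  then show ?thesis
    unfolding sine_polynomial_def by (intro exI ext)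
qed

lemma sine_polynomial_scale: "sine_polynomial g \<Longrightarrow> sine_polynomial (\<lambda>x. a * g x)"
proof -
  assume "sine_polynomial g"
  then obtain K c where "g = (\<lambda>x. \<Sum>k<K. c k * sine_mode k x)"
    unfolding sine_polynomial_def by blast
  then have "(\<lambda>x. a * g x) = (\<lambda>x. \<Sum>k<K. (a * c k) * sine_mode k x)"
    by (simp add: sum_distrib_left mult.assoc)
  then show ?thesis unfolding sine_polynomial_def by (intro exI[of _ K] exI[of _ "\<lambda>k. a * c k"])
qed

lemma sine_polynomial_mode: "sine_polynomial (sine_mode k)"
proof -
  have "sine_mode k = (\<lambda>x. \<Sum>j<Suc k. (if j = k then 1 else 0) * sine_mode j x)"
    by (rule ext) (simp add: sum.If_cases if_distrib[of "\<lambda>z. z * _"] cong: if_cong)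
  then show ?thesis unfolding sine_polynomial_def
    by (intro exI[of _ "Suc k"] exI[of _ "\<lambda>j. if j = k then 1 else 0"])
qed

lemma sine_polynomial_zero: "sine_polynomial (\<lambda>x. 0)"
  using sine_polynomial_scale[OF sine_polynomial_mode[of 0], of 0] by simp

lemma sine_polynomial_sum: "(\<And>k. sine_polynomial (g k)) \<Longrightarrow> sine_polynomial (\<lambda>x. \<Sum>k<(n::nat). g k x)"
  by (induction n) (auto intro: sine_polynomial_zero sine_polynomial_add)

text \<open>By the product formula, \<open>cos (pi * x)\<close> moves mode \<open>k\<close> to the
  two neighbouring modes. Mode 0 has frequency 1, so its lower neighbour is \<open>sin 0\<close> and
  disappears; hence the separate case.\<close>

lemma sine_polynomial_mult_cos:
  assumes "sine_polynomial g" shows "sine_polynomial (\<lambda>x. g x * cos (pi * x))"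
proof -
  have mode: "sine_polynomial (\<lambda>x. sine_mode k x * cos (pi * x))" for k
  proof (cases k)
    case 0
    have "(\<lambda>x. sine_mode k x * cos (pi * x)) = (\<lambda>x. 1/2 * sin (2 * (pi * x)))"
      unfolding 0 by (rule ext) (simp add: sin_double)
    then show ?thesis using sine_polynomial_scale[OF sine_polynomial_mode[of 1], of "1/2"] by (simp add: mult.assoc)
  next
    case (Suc j)
    have "(\<lambda>x. sine_mode k x * cos (pi * x)) = (\<lambda>x. 1/2 * sine_mode (Suc k) x + 1/2 * sine_mode j x)"
    proof
      fix x
      have "real (Suc k) * pi * x + pi * x = real (Suc (Suc k)) * pi * x"
        "real (Suc k) * pi * x - pi * x = real (Suc j) * pi * x"
        unfolding Suc by (simp_all add: algebra_simps)
      then show "sine_mode k x * cos (pi * x) = 1/2 * sine_mode (Suc k) x + 1/2 * sine_mode j x"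
        by (simp only: sin_times_cos) simp
    qed
    then show ?thesis
      using sine_polynomial_add[OF sine_polynomial_scale[OF sine_polynomial_mode]
          sine_polynomial_scale[OF sine_polynomial_mode]] by (simp only:)
  qed
  obtain K c where g: "g = (\<lambda>x. \<Sum>k<K. c k * sine_mode k x)"
    using assms unfolding sine_polynomial_def by blast
  have "(\<lambda>x. g x * cos (pi * x)) = (\<lambda>x. \<Sum>k<K. c k * (sine_mode k x * cos (pi * x)))"
    unfolding g by (simp add: sum_distrib_right mult.assoc)
  then show ?thesis
    using sine_polynomial_sum[OF sine_polynomial_scale[OF mode]] by simp
qed

text \<open>
  The multipliers preserving sine polynomials form an algebra containing \<open>cos (\<pi> x)\<close>, so the
  Stone--Weierstrass theorem applies to \<open>h / sin (\<pi> x)\<close> as soon as \<open>h\<close> vanishes near the end points.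
\<close>

lemma sine_polynomial_dense:
  assumes cont: "continuous_on {0..1} h" and h0: "h 0 = 0" and h1: "h 1 = 0" and e: "0 < e"
  shows "\<exists>g. sine_polynomial g \<and> (\<forall>x\<in>{0..1}. \<bar>h x - g x\<bar> < e)"
proof -
  \<comment> \<open>Soft thresholding: values are moved towards 0 by \<open>e/2\<close>, so
    \<open>h'\<close> stays within \<open>e/2\<close> of \<open>h\<close> and vanishes wherever
    \<open>h\<close> is small, in particular near both end points.\<close>
  define h' where "h' x = sgn (h x) * max 0 (\<bar>h x\<bar> - e/2)" for x
  have h'_eq: "h' x = max 0 (h x - e/2) - max 0 (- h x - e/2)" for x
    using e unfolding h'_def by (auto simp: sgn_if max_def)
  have cont': "continuous_on {0..1} h'"
    unfolding h'_eq by (intro continuous_intros cont)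
  have close: "\<bar>h x - h' x\<bar> \<le> e/2" for x
    using e unfolding h'_eq by (auto simp: max_def)
  \<comment> \<open>At the end points this reads 0/0 = 0, which agrees with the value 0 that
    \<open>q\<close> has nearby.\<close>
  define q where "q x = h' x / sin (pi * x)" for x
  have "continuous_on {0..1} q"
    unfolding continuous_on_eq_continuous_within
  proof
    fix x :: real assume x: "x \<in> {0..1}"
    show "continuous (at x within {0..1}) q"
    proof (cases "\<bar>h x\<bar> < e/2")
      case True
      have "((\<lambda>y. \<bar>h y\<bar>) \<longlongrightarrow> \<bar>h x\<bar>) (at x within {0..1})"
        using cont x by (intro tendsto_intros) (auto simp: continuous_on_def)
      then have "eventually (\<lambda>y. \<bar>h y\<bar> < e/2) (at x within {0..1})"
        using True by (rule order_tendstoD)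
      then have "eventually (\<lambda>y. q y = 0) (at x within {0..1})"
        by eventually_elim (simp add: q_def h'_def)
      moreover have "q x = 0" using True by (simp add: q_def h'_def)
      ultimately show ?thesis
        unfolding continuous_within by (simp add: tendsto_eventually)
    next
      case False
      then have "x \<noteq> 0" "x \<noteq> 1" using e h0 h1 by auto
      with x have "sin (pi * x) \<noteq> 0"
        by (intro less_imp_neq[symmetric] sin_gt_zero) auto
      then show ?thesis
        unfolding q_def continuous_within using cont' x
        by (intro tendsto_divide) (auto simp: continuous_on_def intro!: tendsto_intros)
    qed
  qed
  have "\<exists>p. (continuous_on {0..1} p \<and> (\<forall>g. sine_polynomial g \<longrightarrow> sine_polynomial (\<lambda>x. g x * p x))) \<and>
      (\<forall>x\<in>{0..1}. \<bar>q x - p x\<bar> < e/2)"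
  proof (rule Stone_Weierstrass_HOL)
    show "\<exists>p. (continuous_on {0..1} p \<and> (\<forall>g. sine_polynomial g \<longrightarrow> sine_polynomial (\<lambda>x. g x * p x))) \<and> p x \<noteq> p y"
      if "x \<in> {0..1} \<and> y \<in> {0..1} \<and> x \<noteq> y" for x y :: real
    proof (intro exI[of _ "\<lambda>x. cos (pi * x)"] conjI allI impI)
      show "cos (pi * x) \<noteq> cos (pi * y)"
        using that cos_inj_pi[of "pi * x" "pi * y"] by auto
    qed (auto intro!: continuous_intros sine_polynomial_mult_cos)
  next
    fix f g assume "(continuous_on {0..1} f \<and> (\<forall>h. sine_polynomial h \<longrightarrow> sine_polynomial (\<lambda>x. h x * f x))) \<and>
      (continuous_on {0..1} g \<and> (\<forall>h. sine_polynomial h \<longrightarrow> sine_polynomial (\<lambda>x. h x * g x)))"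
    then show "continuous_on {0..1} (\<lambda>x. f x * g x) \<and>
        (\<forall>h. sine_polynomial h \<longrightarrow> sine_polynomial (\<lambda>x. h x * (f x * g x)))"
      by (auto intro!: continuous_intros simp flip: mult.assoc)
  qed (use \<open>continuous_on {0..1} q\<close> e in
      \<open>auto intro!: continuous_intros sine_polynomial_add
        simp: distrib_left sine_polynomial_scale mult.commute[of _ "_::real"]\<close>)
  then obtain p where p: "\<And>g. sine_polynomial g \<Longrightarrow> sine_polynomial (\<lambda>x. g x * p x)"
    "\<And>x. x \<in> {0..1} \<Longrightarrow> \<bar>q x - p x\<bar> < e/2"
    by blast
  have "\<bar>h x - sine_mode 0 x * p x\<bar> < e" if "x \<in> {0..1}" for x
  proof -
    have "h' x = sin (pi * x) * q x"
    proof (cases "sin (pi * x) = 0")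
      case True
      then have "\<not> (0 < x \<and> x < 1)" using sin_gt_zero[of "pi * x"] by auto
      then have "x = 0 \<or> x = 1" using that by auto
      then show ?thesis using True h0 h1 e by (auto simp: h'_def)
    qed (simp add: q_def)
    then have "\<bar>h' x - sin (pi * x) * p x\<bar> = \<bar>sin (pi * x)\<bar> * \<bar>q x - p x\<bar>"
      by (simp add: abs_mult right_diff_distrib flip: abs_mult)
    also have "\<dots> \<le> 1 * \<bar>q x - p x\<bar>" by (intro mult_right_mono) auto
    also have "\<dots> < e/2" using p(2)[OF that] by simp
    finally show ?thesis using close[of x] by (simp; linarith)
  qed
  then show ?thesis using p(1)[OF sine_polynomial_mode] by blast
qed

text \<open>A uniform approximation within \<open>sqrt e\<close> has squared L2 distance at most
  \<open>e\<close>. Its coefficients may then be traded for the Fourier coefficients, which do at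
  least as well.\<close>

lemma sine_completeness:
  assumes cont: "continuous_on {0..1} h" and "h 0 = 0" "h 1 = 0" and e: "0 < e"
  shows "\<exists>K. integral {0..1} (\<lambda>x. (h x)\<^sup>2) \<le> 2 * (\<Sum>k<K. (integral {0..1} (\<lambda>x. h x * sine_mode k x))\<^sup>2) + e"
proof -
  let ?d = "\<lambda>k. integral {0..1} (\<lambda>x. h x * sine_mode k x)"
  obtain g where "sine_polynomial g" and g: "\<forall>x\<in>{0..1}. \<bar>h x - g x\<bar> < sqrt e"
    using sine_polynomial_dense[OF assms(1-3), of "sqrt e"] e by auto
  then obtain K c where gc: "g = (\<lambda>x. \<Sum>k<K. c k * sine_mode k x)"
    unfolding sine_polynomial_def by blast
  have "integral {0..1} (\<lambda>x. (h x)\<^sup>2) - 2 * (\<Sum>k<K. c k * ?d k) + (\<Sum>k<K. (c k)\<^sup>2) / 2 =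
      integral {0..1} (\<lambda>x. (h x - (\<Sum>k<K. c k * sine_mode k x))\<^sup>2)"
    by (rule sine_sum_distance[OF cont, symmetric])
  also have "\<dots> \<le> integral {0..1} (\<lambda>x::real. e)"
  proof (rule integral_le)
    fix x :: real assume "x \<in> {0..1}"
    then have "\<bar>h x - g x\<bar>\<^sup>2 \<le> (sqrt e)\<^sup>2" using g by (intro power_mono) (auto intro: less_imp_le)
    then show "(h x - (\<Sum>k<K. c k * sine_mode k x))\<^sup>2 \<le> e" using e by (simp add: gc)
  qed (auto intro!: integrable_continuous_real continuous_intros cont)
  finally have "integral {0..1} (\<lambda>x. (h x)\<^sup>2) \<le> (\<Sum>k<K. 2 * (c k * ?d k) - (c k)\<^sup>2 / 2) + e"
    by (simp add: sum_subtractf sum_distrib_left sum_divide_distrib)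
  \<comment> \<open>Termwise, \<open>2 * c * d - c^2 / 2\<close> is largest at
    \<open>c = 2 * d\<close>, where it equals \<open>2 * d^2\<close>.\<close>
  also have "(\<Sum>k<K. 2 * (c k * ?d k) - (c k)\<^sup>2 / 2) \<le> (\<Sum>k<K. 2 * (?d k)\<^sup>2)"
  proof (rule sum_mono)
    fix k show "2 * (c k * ?d k) - (c k)\<^sup>2 / 2 \<le> 2 * (?d k)\<^sup>2"
      using zero_le_power2[of "c k - 2 * ?d k"] by (simp add: power2_diff power_mult_distrib algebra_simps)
  qed
  finally show ?thesis by (auto simp: sum_distrib_left)
qed

section \<open>Uniqueness for the heat equation\<close>

lemma continuous_on_integral_param:
  fixes F :: "real \<Rightarrow> real \<Rightarrow> real"
  assumes "continuous_on (S \<times> {a..b}) (\<lambda>(t, x). F t x)"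
  shows "continuous_on S (\<lambda>t. integral {a..b} (F t))"
  using integral_continuous_on_param[of S a b F] assms by simp

lemma continuous_on_slice:
  assumes "continuous_on (S \<times> X) (\<lambda>(t, x). F t x)" "t \<in> S"
  shows "continuous_on X (F t)"
proof -
  have "continuous_on X (\<lambda>x. (t, x))" by (intro continuous_intros)
  from continuous_on_compose2[OF assms(1) this] assms(2) show ?thesis by auto
qed

text \<open>The integral of \<open>E\<close> times the factor \<open>exp (- C * s)\<close> starts at
  0 and has nonpositive derivative, so the integral itself is nonpositive, and the hypothesis passes
  this on to \<open>E\<close>.\<close>

lemma gronwall_zero:
  fixes E :: "real \<Rightarrow> real"
  assumes cont: "continuous_on {0..\<tau>} E"
    and le: "\<And>t. t \<in> {0..\<tau>} \<Longrightarrow> E t \<le> C * integral {0..t} E"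
    and C: "0 \<le> C" and t: "t \<in> {0..\<tau>}"
  shows "E t \<le> 0"
proof -
  have sub: "{0..t} \<subseteq> {0..\<tau>}" using t by auto
  let ?G = "\<lambda>s. integral {0..s} E"
  have "((\<lambda>s. exp (- C * s) * (E s - C * ?G s)) has_integral
      exp (- C * t) * ?G t - exp (- C * 0) * ?G 0) {0..t}"
  proof (rule fundamental_theorem_of_calculus)
    fix s assume s: "s \<in> {0..t}"
    have "(?G has_real_derivative E s) (at s within {0..t})"
      using s by (intro integral_has_real_derivative continuous_on_subset[OF cont sub]) auto
    then have "((\<lambda>s. exp (- C * s) * ?G s) has_real_derivative
        exp (- C * s) * (E s - C * ?G s)) (at s within {0..t})"
      by (auto intro!: derivative_eq_intros simp: algebra_simps)
    then show "((\<lambda>s. exp (- C * s) * ?G s) has_vector_derivative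
        exp (- C * s) * (E s - C * ?G s)) (at s within {0..t})"
      by (simp add: has_real_derivative_iff_has_vector_derivative)
  qed (use t in auto)
  then have "((\<lambda>s. exp (- C * s) * (E s - C * ?G s)) has_integral exp (- C * t) * ?G t) {0..t}"
    by simp
  then have "exp (- C * t) * ?G t \<le> 0"
    by (rule has_integral_le[OF _ has_integral_0]) (use le sub in \<open>auto intro!: mult_nonneg_nonpos\<close>)
  then have "?G t \<le> 0" by (simp add: mult_le_0_iff)
  then have "C * ?G t \<le> 0" using C by (simp add: mult_nonneg_nonpos)
  with le[OF t] show ?thesis by simp
qed

text \<open>The weak form only gives equations for the sine coefficients of \<open>D\<close>, but
  each coefficient is continuously differentiable in time. The energy estimate is done on finite
  sums of squared coefficients: Bessel bounds their growth uniformly in the number of modes,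
  completeness turns the sums into the full energy, and Gronwall finishes.\<close>

lemma heat_equation_zero:
  fixes D r :: "real \<Rightarrow> real \<Rightarrow> real"
  assumes D: "continuous_on ({0..\<tau>} \<times> {0..1}) (\<lambda>(t, x). D t x)"
    and r: "continuous_on ({0..\<tau>} \<times> {0..1}) (\<lambda>(t, x). r t x)"
    and bound: "\<And>t x. t \<in> {0..\<tau>} \<Longrightarrow> x \<in> {0..1} \<Longrightarrow> \<bar>r t x\<bar> \<le> L * \<bar>D t x\<bar>"
    and boundary: "\<And>t. t \<in> {0..\<tau>} \<Longrightarrow> D t 0 = 0 \<and> D t 1 = 0"
    and weak: "\<And>k t. t \<in> {0..\<tau>} \<Longrightarrow>
      integral {0..1} (\<lambda>x. D t x * sine_mode k x) =
      integral {0..t} (\<lambda>s. integral {0..1} (\<lambda>x. r s x * sine_mode k x)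
        - (real (Suc k) * pi)\<^sup>2 * integral {0..1} (\<lambda>x. D s x * sine_mode k x))"
    and t: "t \<in> {0..\<tau>}" and x: "x \<in> {0..1}"
  shows "D t x = 0"
proof -
  define d where "d k s = integral {0..1} (\<lambda>x. D s x * sine_mode k x)" for k s
  define e where "e k s = integral {0..1} (\<lambda>x. r s x * sine_mode k x)" for k s
  define \<mu> where "\<mu> k = (real (Suc k) * pi)\<^sup>2" for k
  define E where "E s = integral {0..1} (\<lambda>x. (D s x)\<^sup>2)" for s
  have contD: "continuous_on {0..1} (D s)" and contr: "continuous_on {0..1} (r s)" if "s \<in> {0..\<tau>}" for s
    using continuous_on_slice D r that by blast+
  have cont_d: "continuous_on {0..\<tau>} (d k)" and cont_e: "continuous_on {0..\<tau>} (e k)"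
    and cont_E: "continuous_on {0..\<tau>} E" for k
    unfolding d_def e_def E_def
    by (intro continuous_on_integral_param, use D r in
        \<open>simp add: split_beta continuous_intros\<close>)+
  have weak': "d k s = integral {0..s} (\<lambda>s. e k s - \<mu> k * d k s)" if "s \<in> {0..\<tau>}" for k s
    using weak[OF that, of k] unfolding d_def e_def \<mu>_def by simp
  have sum_le: "2 * (\<Sum>k<K. (d k s)\<^sup>2) \<le> (1 + L\<^sup>2) * integral {0..s} E" if s: "s \<in> {0..\<tau>}" for K s
  proof -
    have sub: "{0..s} \<subseteq> {0..\<tau>}" using s by auto
    have "((\<lambda>u. 2 * (\<Sum>k<K. 2 * d k u * (e k u - \<mu> k * d k u))) has_integral
        2 * (\<Sum>k<K. (d k s)\<^sup>2) - 2 * (\<Sum>k<K. (d k 0)\<^sup>2)) {0..s}"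
    proof (rule fundamental_theorem_of_calculus)
      fix u assume u: "u \<in> {0..s}"
      have "(d k has_real_derivative e k u - \<mu> k * d k u) (at u within {0..s})" for k
      proof (rule has_field_derivative_transform_within[OF _ zero_less_one])
        show "((\<lambda>s. integral {0..s} (\<lambda>s. e k s - \<mu> k * d k s)) has_real_derivative e k u - \<mu> k * d k u)
            (at u within {0..s})"
          using u by (intro integral_has_real_derivative continuous_intros
              continuous_on_subset[OF cont_d sub] continuous_on_subset[OF cont_e sub]) auto
      qed (use u sub weak' in auto)
      then show "((\<lambda>u. 2 * (\<Sum>k<K. (d k u)\<^sup>2)) has_vector_derivative
          2 * (\<Sum>k<K. 2 * d k u * (e k u - \<mu> k * d k u))) (at u within {0..s})"
        unfolding has_real_derivative_iff_has_vector_derivative[symmetric]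
        by (auto intro!: derivative_eq_intros sum.cong)
    qed (use s in auto)
    moreover have "d k 0 = 0" for k using weak'[of 0 k] s by auto
    ultimately have int: "((\<lambda>u. 2 * (\<Sum>k<K. 2 * d k u * (e k u - \<mu> k * d k u))) has_integral
        2 * (\<Sum>k<K. (d k s)\<^sup>2)) {0..s}" by simp
    have "(E has_integral integral {0..s} E) {0..s}"
      using continuous_on_subset[OF cont_E sub] by (intro integrable_integral integrable_continuous_real)
    then have int': "((\<lambda>u. (1 + L\<^sup>2) * E u) has_integral (1 + L\<^sup>2) * integral {0..s} E) {0..s}"
      by (rule has_integral_mult_right)
    show ?thesis
    proof (rule has_integral_le[OF int int'])
      fix u assume "u \<in> {0..s}"
      then have u: "u \<in> {0..\<tau>}" using sub by auto
      \<comment> \<open>The diffusion contributes \<open>- 2 * \<mu> k * (d k u)^2\<close>, which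
        has the good sign and is dropped; the rest is \<open>2 * d * e <= d^2 + e^2\<close>.\<close>
      have "2 * (\<Sum>k<K. 2 * d k u * (e k u - \<mu> k * d k u)) \<le> 2 * (\<Sum>k<K. (d k u)\<^sup>2 + (e k u)\<^sup>2)"
      proof (intro mult_left_mono sum_mono)
        fix k
        have "0 \<le> 2 * \<mu> k * (d k u)\<^sup>2" by (simp add: \<mu>_def)
        then show "2 * d k u * (e k u - \<mu> k * d k u) \<le> (d k u)\<^sup>2 + (e k u)\<^sup>2"
          using zero_le_power2[of "d k u - e k u"]
          by (simp add: power2_diff power2_eq_square algebra_simps)
      qed simp
      also have "\<dots> = 2 * (\<Sum>k<K. (d k u)\<^sup>2) + 2 * (\<Sum>k<K. (e k u)\<^sup>2)"
        by (simp add: sum.distrib)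
      also have "\<dots> \<le> E u + integral {0..1} (\<lambda>x. (r u x)\<^sup>2)"
        unfolding d_def e_def E_def
        by (intro add_mono sine_bessel contD contr u)
      also have "integral {0..1} (\<lambda>x. (r u x)\<^sup>2) \<le> integral {0..1} (\<lambda>x. L\<^sup>2 * (D u x)\<^sup>2)"
      proof (rule integral_le)
        fix x :: real assume "x \<in> {0..1}"
        then have "\<bar>r u x\<bar>\<^sup>2 \<le> (L * \<bar>D u x\<bar>)\<^sup>2" using bound u by (intro power_mono) auto
        then show "(r u x)\<^sup>2 \<le> L\<^sup>2 * (D u x)\<^sup>2" by (simp add: power_mult_distrib)
      qed (auto intro!: integrable_continuous_real continuous_intros contD contr u)
      finally show "2 * (\<Sum>k<K. 2 * d k u * (e k u - \<mu> k * d k u)) \<le> (1 + L\<^sup>2) * E u"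
        by (simp add: E_def distrib_right)
    qed
  qed
  have "E s \<le> (1 + L\<^sup>2) * integral {0..s} E" if s: "s \<in> {0..\<tau>}" for s
  proof (rule field_le_epsilon)
    fix \<epsilon> :: real assume "0 < \<epsilon>"
    then obtain K where "E s \<le> 2 * (\<Sum>k<K. (d k s)\<^sup>2) + \<epsilon>"
      using sine_completeness[OF contD[OF s]] boundary[OF s] unfolding E_def d_def by blast
    with sum_le[OF s, of K] show "E s \<le> (1 + L\<^sup>2) * integral {0..s} E + \<epsilon>" by simp
  qed
  then have "E t \<le> 0"
    by (intro gronwall_zero[OF cont_E _ _ t, of "1 + L\<^sup>2"]) auto
  moreover have "0 \<le> E t" unfolding E_def
    by (rule integral_nonneg) (auto intro!: integrable_continuous_real continuous_intros contD t)
  ultimately have "integral {0..1} (\<lambda>x. (D t x)\<^sup>2) = 0" by (simp add: E_def)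
  then have "\<forall>x\<in>{0..1}. (D t x)\<^sup>2 = 0"
    by (subst (asm) integral_eq_0_iff) (auto intro!: continuous_intros contD t)
  with x show ?thesis by simp
qed

section \<open>Scalar comparison and blow-up\<close>

text \<open>Integrate a supporting line of \<open>f\<close> at the weighted mean \<open>z\<close>
  against the weight: since the weight has integral 1, the linear term cancels.\<close>

lemma jensen_weighted_integral:
  fixes f v \<phi> :: "real \<Rightarrow> real"
  assumes f: "convex_on UNIV f" and v: "continuous_on {0..1} v"
    and \<phi>: "continuous_on {0..1} \<phi>" "\<And>x. x \<in> {0..1} \<Longrightarrow> 0 \<le> \<phi> x" "integral {0..1} \<phi> = 1"
  shows "f (integral {0..1} (\<lambda>x. v x * \<phi> x)) \<le> integral {0..1} (\<lambda>x. f (v x) * \<phi> x)"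
proof -
  define z where "z = integral {0..1} (\<lambda>x. v x * \<phi> x)"
  obtain c where c: "\<And>y. f z + c * (y - z) \<le> f y"
    using convex_le_Inf_differential[OF f, of z] by auto
  have contf: "continuous_on {0..1} (\<lambda>x. f (v x))"
    using convex_on_continuous[OF open_UNIV f] v by (rule continuous_on_compose2) auto
  have "f z = integral {0..1} (\<lambda>x. (f z - c * z) * \<phi> x + c * (v x * \<phi> x))"
  proof (subst integral_add)
    show "f z = integral {0..1} (\<lambda>x. (f z - c * z) * \<phi> x) + integral {0..1} (\<lambda>x. c * (v x * \<phi> x))"
      using \<phi>(3) by (simp only: integral_mult_right z_def[symmetric]) (simp add: algebra_simps)
  qed (auto intro!: integrable_continuous_real continuous_intros v \<phi>(1))
  also have "\<dots> = integral {0..1} (\<lambda>x. (f z + c * (v x - z)) * \<phi> x)"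
    by (simp add: algebra_simps)
  also have "\<dots> \<le> integral {0..1} (\<lambda>x. f (v x) * \<phi> x)"
    using v \<phi> contf c
    by (intro integral_le integrable_continuous_real continuous_intros mult_right_mono) auto
  finally show ?thesis by (simp add: z_def)
qed

lemma continuous_on_truncation:
  assumes "convex_on UNIV f"
  shows "continuous_on UNIV (truncation f m)"
proof -
  have "truncation f m = (\<lambda>s. f (max (- real m) (min (real m) s)))"
    by (rule ext) (auto simp: truncation_def max_def min_def)
  moreover have "continuous_on UNIV (\<lambda>s. f (max (- real m) (min (real m) s)))"
    by (rule continuous_on_compose2[OF convex_on_continuous[OF open_UNIV assms]])
       (auto intro!: continuous_intros)
  ultimately show ?thesis by simp
qed

lemma truncation_eq: "\<bar>s\<bar> < real m \<Longrightarrow> truncation f m s = f s"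
  by (auto simp: truncation_def)

text \<open>Slopes of a convex function increase, so every slope inside \<open>{-c..c}\<close> lies
  between the slope \<open>p\<close> over the unit interval to the left and the slope
  \<open>q\<close> over the one to the right.\<close>

lemma convex_on_lipschitz_interval:
  fixes f :: "real \<Rightarrow> real"
  assumes f: "convex_on UNIV f"
  shows "\<exists>L. \<forall>x\<in>{-c..c}. \<forall>y\<in>{-c..c}. \<bar>f x - f y\<bar> \<le> L * \<bar>x - y\<bar>"
proof -
  define p where "p = f (- c) - f (- c - 1)"
  define q where "q = f (c + 1) - f c"
  have slope: "p * (y - x) \<le> f y - f x \<and> f y - f x \<le> q * (y - x)"
    if "x \<in> {-c..c}" "y \<in> {-c..c}" "x < y" for x y
  proof
    have lower: "f (- c) - f (- c - 1) \<le> (f x - f y) / (x - y)"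
    proof -
      have "f (- c) - f (- c - 1) \<le> (f (- c - 1) - f y) / (- c - 1 - y)"
        using convex_on_slope_le(1)[OF f, of "- c - 1" y "- c"] that by auto
      also have "\<dots> \<le> (f x - f y) / (x - y)"
        using convex_on_slope_le(2)[OF f, of "- c - 1" y x] that by auto
      finally show ?thesis .
    qed
    show "p * (y - x) \<le> f y - f x"
      using lower that(3) by (simp add: p_def field_simps)
    have upper: "(f x - f y) / (x - y) \<le> f (c + 1) - f c"
    proof -
      have "(f x - f y) / (x - y) \<le> (f x - f (c + 1)) / (x - (c + 1))"
        using convex_on_slope_le(1)[OF f, of x "c + 1" y] that by auto
      also have "\<dots> \<le> (f c - f (c + 1)) / (c - (c + 1))"
        using convex_on_slope_le(2)[OF f, of x "c + 1" c] that by auto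
      finally show ?thesis by simp
    qed
    show "f y - f x \<le> q * (y - x)"
      using upper that(3) by (simp add: q_def field_simps)
  qed
  have ordered: "\<bar>f x - f y\<bar> \<le> (\<bar>p\<bar> + \<bar>q\<bar>) * \<bar>x - y\<bar>" if "x \<in> {-c..c}" "y \<in> {-c..c}" "x < y" for x y
  proof -
    have "- (\<bar>p\<bar> * (y - x)) \<le> p * (y - x)" "q * (y - x) \<le> \<bar>q\<bar> * (y - x)"
      using that(3) mult_right_mono[of "- \<bar>p\<bar>" p "y - x"] mult_right_mono[of q "\<bar>q\<bar>" "y - x"] by auto
    moreover have "0 \<le> \<bar>p\<bar> * (y - x)" "0 \<le> \<bar>q\<bar> * (y - x)" using that(3) by auto
    moreover have "\<bar>x - y\<bar> = y - x" using that(3) by simp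
    ultimately show ?thesis using slope[OF that] by (simp only: distrib_right) linarith
  qed
  show ?thesis
  proof (intro exI ballI)
    fix x y assume "x \<in> {-c..c}" "y \<in> {-c..c}"
    then show "\<bar>f x - f y\<bar> \<le> (\<bar>p\<bar> + \<bar>q\<bar>) * \<bar>x - y\<bar>"
      using ordered[of x y] ordered[of y x] by (cases x y rule: linorder_cases) (auto simp: abs_minus_commute)
  qed
qed

lemma truncation_lipschitz:
  assumes f: "convex_on UNIV f"
  shows "\<exists>L. \<forall>x y. \<bar>truncation f m x - truncation f m y\<bar> \<le> L * \<bar>x - y\<bar>"
proof -
  let ?c = "\<lambda>s. max (- real m) (min (real m) s)"
  have tr: "truncation f m s = f (?c s)" for s
    by (auto simp: truncation_def max_def min_def)
  obtain L where L: "\<forall>x\<in>{-real m..real m}. \<forall>y\<in>{-real m..real m}. \<bar>f x - f y\<bar> \<le> L * \<bar>x - y\<bar>"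
    using convex_on_lipschitz_interval[OF f] by blast
  have "\<bar>truncation f m x - truncation f m y\<bar> \<le> \<bar>L\<bar> * \<bar>x - y\<bar>" for x y
  proof -
    have "\<bar>f (?c x) - f (?c y)\<bar> \<le> L * \<bar>?c x - ?c y\<bar>" using L by auto
    \<comment> \<open>The constant obtained above may be negative: for \<open>m = 0\<close> the
      interval is a single point and any \<open>L\<close> qualifies. The absolute value allows the
      1-Lipschitz clamp \<open>?c\<close> to be removed.\<close>
    also have "\<dots> \<le> \<bar>L\<bar> * \<bar>?c x - ?c y\<bar>" by (intro mult_right_mono) auto
    also have "\<dots> \<le> \<bar>L\<bar> * \<bar>x - y\<bar>" by (intro mult_left_mono) auto
    finally show ?thesis by (simp add: tr)
  qed
  then show ?thesis by blast
qed

text \<open>If \<open>f\<close> stayed below a line to the right of \<open>a\<close>, the integral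
  of \<open>1/f\<close> would diverge logarithmically. So some chord from \<open>a\<close> is
  steeper than any prescribed \<open>C\<close>, and convexity keeps all later chords steeper too.
  Superlinear domination of the linear drift and monotonicity follow; the last property is smallness
  of the tail of a convergent integral.\<close>

lemma convex_reciprocal_integrable_growth:
  fixes f :: "real \<Rightarrow> real"
  assumes f: "convex_on UNIV f" and nonneg: "\<And>s. 0 \<le> f s"
    and int: "reciprocal_integrable_at_top f" and \<nu>: "0 < \<nu>" and \<epsilon>: "0 < \<epsilon>"
  obtains K w where "0 \<le> K" "\<And>s. - K \<le> f s - \<nu> * s"
    "\<And>s. w \<le> s \<Longrightarrow> 0 < f s" "\<And>s. w \<le> s \<Longrightarrow> f s / 2 \<le> f s - \<nu> * s"
    "\<And>s t. w \<le> s \<Longrightarrow> s \<le> t \<Longrightarrow> f s \<le> f t"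
    "\<And>t. w \<le> t \<Longrightarrow> integral {w..t} (\<lambda>s. 1 / f s) < \<epsilon>"
proof -
  obtain a where pos: "\<And>s. a \<le> s \<Longrightarrow> 0 < f s" and inta: "set_integrable lborel {a..} (\<lambda>s. 1 / f s)"
    using int unfolding reciprocal_integrable_at_top_def by blast
  define I where "I = (LBINT s:{a..}. 1 / f s)"
  have contf: "continuous_on S f" for S
    using convex_on_continuous[OF open_UNIV f] by (rule continuous_on_subset) simp
  have contr: "continuous_on {b..c} (\<lambda>s. 1 / f s)" if "a \<le> b" for b c
  proof (intro continuous_intros contf ballI)
    fix s assume "s \<in> {b..c}"
    then show "f s \<noteq> 0" using pos[of s] that by simp
  qed
  have bounded: "integral {b..c} (\<lambda>s. 1 / f s) \<le> I" if "a \<le> b" for b c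
  proof -
    have set: "set_integrable lborel {b..c} (\<lambda>s. 1 / f s)"
      by (rule borel_integrable_atLeastAtMost'[OF contr[OF that]])
    have "(LBINT s:{b..c}. 1 / f s) \<le> I"
      unfolding I_def set_lebesgue_integral_def
      by (rule integral_mono)
         (use set inta that nonneg in \<open>auto simp: set_integrable_def indicator_def\<close>)
    then show ?thesis using set_borel_integral_eq_integral(2)[OF set] by simp
  qed
  \<comment> \<open>The aim is \<open>2 * \<nu> * s <= f s\<close>. The additional slope 1 absorbs
    the offset \<open>C * a\<close> as soon as \<open>s\<close> exceeds it, which explains the
    second entry of \<open>z\<close> below.\<close>
  define C where "C = 2 * \<nu> + 1"
  have "\<exists>s>a. C * (s - a) < f s - f a"
  proof (rule ccontr)
    assume none: "\<not> ?thesis"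
    have le: "f s \<le> f a + C * (s - a)" if "a \<le> s" for s
    proof (cases "s = a")
      case False
      then have "\<not> C * (s - a) < f s - f a" using none that by force
      then show ?thesis by simp
    qed simp
    have fa: "0 < f a" and C: "0 < C" using pos \<nu> by (auto simp: C_def)
    \<comment> \<open>Chosen so that the reciprocal of the bounding line has integral exactly
      \<open>\<bar>I\<bar> + 1\<close> over \<open>{a..c}\<close>, more than \<open>1/f\<close> can
      have.\<close>
    define c where "c = a + f a * (exp (C * (\<bar>I\<bar> + 1)) - 1) / C"
    have ac: "a \<le> c" using fa C by (simp add: c_def)
    have "((\<lambda>s. 1 / (f a + C * (s - a))) has_integral
        ln (f a + C * (c - a)) / C - ln (f a + C * (a - a)) / C) {a..c}"
    proof (rule fundamental_theorem_of_calculus[OF ac])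
      fix s assume "s \<in> {a..c}"
      then have "0 < f a + C * (s - a)" using fa C by (intro add_pos_nonneg) auto
      then have "((\<lambda>s. ln (f a + C * (s - a)) / C) has_real_derivative
          C / (f a + C * (s - a)) / C) (at s within {a..c})"
        by (intro DERIV_cdivide) (auto intro!: derivative_eq_intros)
      also have "C / (f a + C * (s - a)) / C = 1 / (f a + C * (s - a))" using C by simp
      finally have "((\<lambda>s. ln (f a + C * (s - a)) / C) has_real_derivative
          1 / (f a + C * (s - a))) (at s within {a..c})" .
      then show "((\<lambda>s. ln (f a + C * (s - a)) / C) has_vector_derivative 1 / (f a + C * (s - a))) (at s within {a..c})"
        by (simp add: has_real_derivative_iff_has_vector_derivative)
    qed
    moreover have "C * (c - a) = f a * (exp (C * (\<bar>I\<bar> + 1)) - 1)"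
      using C by (simp add: c_def)
    then have "f a + C * (c - a) = f a * exp (C * (\<bar>I\<bar> + 1))"
      by (simp add: right_diff_distrib)
    then have "ln (f a + C * (c - a)) / C - ln (f a + C * (a - a)) / C = \<bar>I\<bar> + 1"
      using fa C by (simp add: ln_mult field_simps)
    ultimately have "((\<lambda>s. 1 / (f a + C * (s - a))) has_integral \<bar>I\<bar> + 1) {a..c}" by simp
    moreover have "((\<lambda>s. 1 / f s) has_integral integral {a..c} (\<lambda>s. 1 / f s)) {a..c}"
      by (intro integrable_integral integrable_continuous_real contr) simp
    ultimately have "\<bar>I\<bar> + 1 \<le> integral {a..c} (\<lambda>s. 1 / f s)"
      by (rule has_integral_le) (use le pos in \<open>auto intro!: divide_left_mono mult_pos_pos le
          intro: less_le_trans\<close>)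
    with bounded[of a c] show False by simp
  qed
  then obtain s1 where s1: "a < s1" "C * (s1 - a) < f s1 - f a" by blast
  have growth: "C * (s - a) < f s - f a" if "s1 \<le> s" for s
  proof (cases "s = s1")
    case False
    have "C < (f a - f s1) / (a - s1)" using s1 by (simp add: field_simps)
    also have "\<dots> \<le> (f a - f s) / (a - s)"
      using convex_on_slope_le(1)[OF f, of a s s1] s1 that False by auto
    finally show ?thesis using s1 that by (simp add: field_simps)
  qed (use s1 in simp)
  have mono: "f s \<le> f t" if "s1 \<le> s" "s \<le> t" for s t
  proof (cases "s = t")
    case False
    have "0 \<le> C * (s - a)" using that s1 \<nu> by (simp add: C_def)
    then have "0 \<le> (f a - f s) / (a - s)"
      using growth[OF that(1)] that s1 by (intro divide_nonpos_neg) auto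
    also have "\<dots> \<le> (f a - f t) / (a - t)"
      using convex_on_slope_le(1)[OF f, of a t s] s1 that False by auto
    also have "\<dots> \<le> (f s - f t) / (s - t)"
      using convex_on_slope_le(2)[OF f, of a t s] s1 that False by auto
    finally show ?thesis using that False by (simp add: zero_le_divide_iff)
  qed simp
  define z where "z = max s1 (C * a)"
  have half: "f s / 2 \<le> f s - \<nu> * s" if "z \<le> s" for s
  proof -
    have "s1 \<le> s" "C * a \<le> s" using that by (auto simp: z_def)
    then have "2 * \<nu> * s \<le> f s"
      using growth[of s] pos[of a] by (simp add: C_def algebra_simps)
    then show ?thesis by simp
  qed
  have az: "a < z" using s1 by (auto simp: z_def)
  have lower: "- (\<nu> * \<bar>z\<bar>) \<le> f s - \<nu> * s" for s
  proof (cases "z \<le> s")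
    case True
    then have "0 \<le> f s - \<nu> * s" using half[of s] nonneg[of s] by simp
    moreover have "0 \<le> \<nu> * \<bar>z\<bar>" using \<nu> by simp
    ultimately show ?thesis by linarith
  next
    case False
    then have "\<nu> * s \<le> \<nu> * \<bar>z\<bar>" using \<nu> by (intro mult_left_mono) auto
    then show ?thesis using nonneg[of s] by simp
  qed
  define A where "A = (\<lambda>t. integral {z..t} (\<lambda>s. 1 / f s)) ` {z..}"
  have A: "bdd_above A" "A \<noteq> {}"
    using az bounded by (auto simp: A_def intro!: bdd_aboveI[of _ I])
  obtain w where w: "z \<le> w" "Sup A - \<epsilon> < integral {z..w} (\<lambda>s. 1 / f s)"
    using less_cSupD[OF A(2), of "Sup A - \<epsilon>"] \<epsilon> by (auto simp: A_def)
  show ?thesis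
  proof (rule that[of "\<nu> * \<bar>z\<bar>" w])
    show "integral {w..t} (\<lambda>s. 1 / f s) < \<epsilon>" if "w \<le> t" for t
    proof -
      have "integral {z..w} (\<lambda>s. 1 / f s) + integral {w..t} (\<lambda>s. 1 / f s) = integral {z..t} (\<lambda>s. 1 / f s)"
        using w that az by (intro Henstock_Kurzweil_Integration.integral_combine integrable_continuous_real contr) auto
      moreover have "integral {z..t} (\<lambda>s. 1 / f s) \<le> Sup A"
        using w that A by (intro cSup_upper) (auto simp: A_def)
      ultimately show ?thesis using w by linarith
    qed
    show "f s \<le> f t" if "w \<le> s" "s \<le> t" for s t
      using that w(1) by (intro mono) (auto simp: z_def)
    show "0 \<le> \<nu> * \<bar>z\<bar>" using \<nu> by simp
  qed (use lower half pos w(1) az in auto)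
qed

section \<open>Pathwise integral inequalities driven by a continuous function\<close>

lemma linear_drift_comparison:
  fixes Z N k :: "real \<Rightarrow> real"
  assumes Z: "continuous_on {a..a+1} Z" and k: "continuous_on {a..a+1} k" and N: "continuous_on {a..a+1} N"
    and k_nonneg: "\<And>s. s \<in> {a..a+1} \<Longrightarrow> 0 \<le> k s" and \<nu>: "0 \<le> \<nu>"
    and eq: "\<And>t. t \<in> {a..a+1} \<Longrightarrow> Z t = Z a + integral {a..t} (\<lambda>s. k s - \<nu> * Z s) + N t"
  shows "exp (- \<nu>) * Z a - (\<bar>N (a+1)\<bar> + \<nu> * integral {a..a+1} (\<lambda>s. \<bar>N s\<bar>)) \<le> Z (a+1)"
proof -
  \<comment> \<open>\<open>N\<close> is merely continuous. Subtracting it leaves a differentiable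
    function, to which the integrating factor \<open>exp (\<nu> * (t - a))\<close> applies; the
    price is that the linear drift also acts on \<open>N\<close>, whence the integral of
    \<open>\<bar>N s\<bar>\<close> in the bound.\<close>
  define y where "y t = Z t - N t" for t
  have int1: "((\<lambda>t. exp (\<nu> * (t - a)) * (k t - \<nu> * N t)) has_integral
      exp (\<nu> * ((a+1) - a)) * y (a+1) - exp (\<nu> * (a - a)) * y a) {a..a+1}"
  proof (rule fundamental_theorem_of_calculus)
    fix t assume t: "t \<in> {a..a+1}"
    have "((\<lambda>t. Z a + integral {a..t} (\<lambda>s. k s - \<nu> * Z s)) has_real_derivative k t - \<nu> * Z t) (at t within {a..a+1})"
      using t by (auto intro!: derivative_eq_intros integral_has_real_derivative continuous_intros k Z)
    then have "(y has_real_derivative k t - \<nu> * Z t) (at t within {a..a+1})"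
      by (rule has_field_derivative_transform_within[OF _ zero_less_one t])
         (simp only: y_def, subst eq, auto)
    then have "((\<lambda>t. exp (\<nu> * (t - a)) * y t) has_real_derivative
        exp (\<nu> * (t - a)) * \<nu> * y t + (k t - \<nu> * Z t) * exp (\<nu> * (t - a))) (at t within {a..a+1})"
      by (intro DERIV_mult) (auto intro!: derivative_eq_intros)
    also have "exp (\<nu> * (t - a)) * \<nu> * y t + (k t - \<nu> * Z t) * exp (\<nu> * (t - a)) =
        exp (\<nu> * (t - a)) * (k t - \<nu> * N t)"
      by (simp add: y_def algebra_simps)
    finally show "((\<lambda>t. exp (\<nu> * (t - a)) * y t) has_vector_derivative
        exp (\<nu> * (t - a)) * (k t - \<nu> * N t)) (at t within {a..a+1})"
      by (simp add: has_real_derivative_iff_has_vector_derivative)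
  qed simp
  have int2: "((\<lambda>t. - (exp \<nu> * \<nu>) * \<bar>N t\<bar>) has_integral - (exp \<nu> * \<nu>) * integral {a..a+1} (\<lambda>s. \<bar>N s\<bar>)) {a..a+1}"
    by (intro has_integral_mult_right integrable_integral integrable_continuous_real continuous_intros N)
  have "- (exp \<nu> * \<nu>) * integral {a..a+1} (\<lambda>s. \<bar>N s\<bar>) \<le>
      exp (\<nu> * ((a+1) - a)) * y (a+1) - exp (\<nu> * (a - a)) * y a"
  proof (rule has_integral_le[OF int2 int1])
    fix t assume t: "t \<in> {a..a+1}"
    have "exp (\<nu> * (t - a)) * (\<nu> * N t) \<le> exp (\<nu> * (t - a)) * (\<nu> * \<bar>N t\<bar>)"
      using \<nu> by (intro mult_left_mono) auto
    also have "\<dots> \<le> exp \<nu> * (\<nu> * \<bar>N t\<bar>)"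
      using \<nu> t by (intro mult_right_mono) (auto intro: mult_left_le)
    finally have "exp (\<nu> * (t - a)) * (\<nu> * N t) \<le> exp \<nu> * (\<nu> * \<bar>N t\<bar>)" .
    moreover have "0 \<le> exp (\<nu> * (t - a)) * k t" using k_nonneg[OF t] by simp
    ultimately show "- (exp \<nu> * \<nu>) * \<bar>N t\<bar> \<le> exp (\<nu> * (t - a)) * (k t - \<nu> * N t)"
      by (simp add: right_diff_distrib)
  qed
  then have "y a \<le> exp \<nu> * (y (a+1) + \<nu> * integral {a..a+1} (\<lambda>s. \<bar>N s\<bar>))"
    by (simp add: algebra_simps)
  then have "exp (- \<nu>) * y a \<le> exp (- \<nu>) * (exp \<nu> * (y (a+1) + \<nu> * integral {a..a+1} (\<lambda>s. \<bar>N s\<bar>)))"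
    by (intro mult_left_mono) auto
  also have "\<dots> = y (a+1) + \<nu> * integral {a..a+1} (\<lambda>s. \<bar>N s\<bar>)"
    by (simp add: mult.assoc[symmetric] flip: exp_add)
  finally have "exp (- \<nu>) * y a \<le> y (a+1) + \<nu> * integral {a..a+1} (\<lambda>s. \<bar>N s\<bar>)" .
  moreover have "y a = Z a" using eq[of a] by (simp add: y_def)
  ultimately show ?thesis by (simp add: y_def)
qed

lemma strict_sublevel_fmeasurable:
  fixes g :: "real \<Rightarrow> real"
  assumes "continuous_on {a..b} g"
  shows "{t \<in> {a..b}. g t < c} \<in> fmeasurable lborel"
proof -
  have "closed {t \<in> {a..b}. c \<le> g t}"
    using continuous_closed_preimage[OF assms closed_real_atLeastAtMost, of "{c..}"]
    by (simp add: vimage_def Int_def Collect_conj_eq[symmetric] conj_commute)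
  then have "{a..b} - {t \<in> {a..b}. c \<le> g t} \<in> fmeasurable lborel"
    by (intro fmeasurable_Diff fmeasurable_compact) (auto intro: borel_closed)
  moreover have "{a..b} - {t \<in> {a..b}. c \<le> g t} = {t \<in> {a..b}. g t < c}" by auto
  ultimately show ?thesis by simp
qed

text \<open>
  With \<open>w t = Z t - N t + K (t - a) + h - K\<close> the quantity \<open>\<integral> 1/f\<close> over \<open>{w0..w t}\<close> is nondecreasing
  and grows at rate at least \<open>1/2\<close> whenever \<open>N t \<ge> h\<close>, but it stays below \<open>1/8\<close>.
\<close>

lemma superlinear_drift_explodes:
  fixes f Z N k :: "real \<Rightarrow> real"
  assumes Z: "continuous_on {a..a+1} Z" and k: "continuous_on {a..a+1} k" and N: "continuous_on {a..a+1} N"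
    and k_ge: "\<And>s. s \<in> {a..a+1} \<Longrightarrow> f (Z s) \<le> k s"
    and eq: "\<And>t. t \<in> {a..a+1} \<Longrightarrow> Z t = Z a + integral {a..t} (\<lambda>s. k s - \<nu> * Z s) + N t"
    and contf: "continuous_on UNIV f"
    and K: "0 \<le> K" "\<And>s. - K \<le> f s - \<nu> * s"
    and pos: "\<And>s. w0 \<le> s \<Longrightarrow> 0 < f s" and half: "\<And>s. w0 \<le> s \<Longrightarrow> f s / 2 \<le> f s - \<nu> * s"
    and mono: "\<And>s t. w0 \<le> s \<Longrightarrow> s \<le> t \<Longrightarrow> f s \<le> f t"
    and small: "\<And>t. w0 \<le> t \<Longrightarrow> integral {w0..t} (\<lambda>s. 1 / f s) < 1/8"
    and start: "w0 + K - h \<le> Z a"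
    and bad: "measure lborel {t \<in> {a+1/2..a+1}. N t < h} \<le> 1/4"
  shows False
proof -
  \<comment> \<open>Removing \<open>N\<close> makes \<open>w\<close> differentiable, and
    \<open>K * (t - a)\<close> compensates the worst drift \<open>- K\<close>, so \<open>w\<close>
    never decreases. The shift \<open>h - K\<close> ensures \<open>w t <= Z t\<close> whenever
    \<open>N t >= h\<close>, because the interval has length 1; there monotonicity of
    \<open>f\<close> lets the drift at \<open>Z\<close> control \<open>f (w t)\<close>.\<close>
  define w where "w t = Z t - N t + K * (t - a) + h - K" for t
  define dw where "dw t = k t - \<nu> * Z t + K" for t
  have N0: "N a = 0" using eq[of a] by simp
  have deriv: "(w has_real_derivative dw t) (at t within {a..a+1})" if t: "t \<in> {a..a+1}" for t
  proof -
    have "((\<lambda>t. Z a + integral {a..t} (\<lambda>s. k s - \<nu> * Z s) + K * (t - a) + h - K) has_real_derivative dw t)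
        (at t within {a..a+1})"
      unfolding dw_def
      using t by (auto intro!: derivative_eq_intros integral_has_real_derivative continuous_intros k Z)
    then show ?thesis
      by (rule has_field_derivative_transform_within[OF _ zero_less_one t])
         (simp only: w_def, subst eq, auto)
  qed
  have dw_nonneg: "0 \<le> dw t" if "t \<in> {a..a+1}" for t
    using K(2)[of "Z t"] k_ge[OF that] by (simp add: dw_def)
  have w_mono: "w s \<le> w t" if "s \<in> {a..a+1}" "t \<in> {a..a+1}" "s \<le> t" for s t
  proof -
    have "(dw has_integral w t - w s) {s..t}"
    proof (rule fundamental_theorem_of_calculus[OF that(3)])
      fix x assume "x \<in> {s..t}"
      then show "(w has_vector_derivative dw x) (at x within {s..t})"
        using DERIV_subset[OF deriv, of x "{s..t}"] that
        unfolding has_real_derivative_iff_has_vector_derivative by simp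
    qed
    then have "0 \<le> w t - w s"
      by (rule has_integral_nonneg) (use dw_nonneg that in auto)
    then show ?thesis by simp
  qed
  have w_start: "w0 \<le> w a" using start N0 by (simp add: w_def)
  have w_ge: "w0 \<le> w t" if "t \<in> {a..a+1}" for t
    using w_mono[of a t] w_start that by auto
  define P where "P t = integral {w0..w t} (\<lambda>s. 1 / f s)" for t
  have cont_rec: "continuous_on {w0..w (a+1)} (\<lambda>s. 1 / f s)"
    using pos by (intro continuous_intros continuous_on_subset[OF contf]) force+
  have "(P has_real_derivative 1 / f (w t) * dw t) (at t within {a..a+1})" if t: "t \<in> {a..a+1}" for t
  proof -
    have "((\<lambda>z. integral {w0..z} (\<lambda>s. 1 / f s)) has_real_derivative 1 / f (w t)) (at (w t) within {w0..w (a+1)})"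
      using w_ge[OF t] w_mono[of t "a+1"] t by (intro integral_has_real_derivative cont_rec) auto
    then have "((\<lambda>z. integral {w0..z} (\<lambda>s. 1 / f s)) has_real_derivative 1 / f (w t)) (at (w t) within w ` {a..a+1})"
      by (rule has_field_derivative_subset) (use w_ge w_mono in auto)
    from DERIV_image_chain[OF this deriv[OF t]] show ?thesis
      by (simp add: P_def[abs_def] comp_def)
  qed
  note derivP = DERIV_subset[OF this, of _ "{a+1/2..a+1}"]
  have int1: "((\<lambda>t. 1 / f (w t) * dw t) has_integral P (a+1) - P (a+1/2)) {a+1/2..a+1}"
    by (rule fundamental_theorem_of_calculus)
       (use derivP in \<open>simp_all add: has_real_derivative_iff_has_vector_derivative\<close>)
  define good where "good = {t \<in> {a+1/2..a+1}. h \<le> N t}"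
  have N': "continuous_on {a+1/2..a+1} N" using N by (rule continuous_on_subset) auto
  have good: "good = {a+1/2..a+1} - {t \<in> {a+1/2..a+1}. N t < h}" by (auto simp: good_def)
  have box: "{a+1/2..a+1} \<in> fmeasurable lborel" by (intro fmeasurable_compact) simp
  have sub: "{t \<in> {a+1/2..a+1}. N t < h} \<in> fmeasurable lborel" by (rule strict_sublevel_fmeasurable[OF N'])
  have good_fm: "good \<in> fmeasurable lborel"
    unfolding good by (intro fmeasurable_Diff box fmeasurableD sub)
  have "measure lborel good = 1/2 - measure lborel {t \<in> {a+1/2..a+1}. N t < h}"
  proof -
    have "measure lborel good = measure lborel {a+1/2..a+1} - measure lborel {t \<in> {a+1/2..a+1}. N t < h}"
      unfolding good
    proof (rule measure_Diff[OF _ fmeasurableD[OF box] fmeasurableD[OF sub]])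
      show "emeasure lborel {a+1/2..a+1} \<noteq> \<infinity>" using fmeasurableD2[OF box] by simp
    qed blast
    also have "measure lborel {a+1/2..a+1} = 1/2" by simp
    finally show ?thesis .
  qed
  with bad have meas: "1/4 \<le> measure lborel good" by simp
  have "((\<lambda>x. 1) has_integral measure lborel good) good"
    using good_fm by (intro has_integral_measure_lborel) (auto simp: fmeasurable_def)
  then have "((\<lambda>t. if t \<in> good then 1 else 0) has_integral measure lborel good) {a+1/2..a+1}"
    by (subst has_integral_restrict) (auto simp: good_def)
  then have int2: "((\<lambda>t. 1/2 * (if t \<in> good then 1 else 0)) has_integral 1/2 * measure lborel good) {a+1/2..a+1}"
    by (rule has_integral_mult_right)
  \<comment> \<open>Rate 1/2 on a set of good times of measure at least 1/4 forces a gain of 1/8,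
    exactly what the hypothesis on the tail integral forbids.\<close>
  have "1/2 * measure lborel good \<le> P (a+1) - P (a+1/2)"
  proof (rule has_integral_le[OF int2 int1])
    fix t assume "t \<in> {a+1/2..a+1}"
    then have t: "t \<in> {a..a+1}" by auto
    have fpos: "0 < f (w t)" using pos w_ge[OF t] by simp
    show "1/2 * (if t \<in> good then 1 else 0) \<le> 1 / f (w t) * dw t"
    proof (cases "t \<in> good")
      case True
      have "K * (t - a) \<le> K * 1" using K(1) t by (intro mult_left_mono) auto
      then have "w t \<le> Z t" using True by (simp add: w_def good_def)
      then have "f (w t) / 2 \<le> f (Z t) / 2" using mono[OF w_ge[OF t]] by simp
      also have "\<dots> \<le> dw t"
        using half[of "Z t"] \<open>w t \<le> Z t\<close> w_ge[OF t] k_ge[OF t] K(1) by (simp add: dw_def)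
      finally show ?thesis using fpos True by (simp add: field_simps)
    next
      case False
      then show ?thesis using fpos dw_nonneg[OF t] by simp
    qed
  qed
  moreover have "0 \<le> P (a+1/2)"
  proof (unfold P_def, rule integral_nonneg)
    show "(\<lambda>s. 1 / f s) integrable_on {w0..w (a+1/2)}"
      using w_mono[of "a+1/2" "a+1"]
      by (intro integrable_continuous_real continuous_on_subset[OF cont_rec]) auto
  qed (use pos in \<open>force intro: less_imp_le\<close>)
  moreover have "P (a+1) < 1/8" unfolding P_def by (intro small w_ge) auto
  ultimately show False using meas by linarith
qed

section \<open>Solution paths\<close>

lemma sup_norm_upper:
  assumes "continuous_on {0..1} v" "x \<in> {0..1}"
  shows "\<bar>v x\<bar> \<le> sup_norm v"
proof -
  have "bdd_above ((\<lambda>x. \<bar>v x\<bar>) ` {0..1})"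
    using assms(1) by (intro bounded_imp_bdd_above compact_imp_bounded compact_continuous_image continuous_intros) auto
  then show ?thesis unfolding sup_norm_def using assms(2) by (rule cSUP_upper2) auto
qed

lemma sup_norm_least: "(\<And>x. x \<in> {0..1} \<Longrightarrow> \<bar>v x\<bar> \<le> c) \<Longrightarrow> sup_norm v \<le> c"
  unfolding sup_norm_def by (rule cSUP_least) auto

lemma sup_norm_attained:
  assumes "continuous_on {0..1} v"
  obtains x where "x \<in> {0..1}" "sup_norm v = \<bar>v x\<bar>"
proof -
  have "continuous_on {0..1} (\<lambda>x. \<bar>v x\<bar>)" by (intro continuous_intros assms)
  then have "\<exists>x\<in>{0..1}. \<forall>y\<in>{0..1}. \<bar>v y\<bar> \<le> \<bar>v x\<bar>"
    by (intro continuous_attains_sup) auto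
  then obtain x where x: "x \<in> {0..1}" "\<forall>y\<in>{0..1}. \<bar>v y\<bar> \<le> \<bar>v x\<bar>" by blast
  then have "sup_norm v = \<bar>v x\<bar>"
    by (intro antisym sup_norm_least sup_norm_upper assms) auto
  with x show ?thesis by (intro that)
qed

text \<open>The pathwise part of \<open>spde_solution\<close>, isolated so that deterministic
  arguments can be run for one outcome at a time.\<close>

definition C0_path :: "(real \<Rightarrow> real \<Rightarrow> real) \<Rightarrow> bool" where
  "C0_path v \<longleftrightarrow> (\<forall>t\<ge>0. v t \<in> C0) \<and>
     (\<forall>t\<ge>0. ((\<lambda>s. sup_norm (\<lambda>x. v s x - v t x)) \<longlongrightarrow> 0) (at t within {0..}))"

lemma C0_path_slice: "C0_path v \<Longrightarrow> 0 \<le> t \<Longrightarrow> continuous_on {0..1} (v t)"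
  by (simp add: C0_path_def C0_def)

lemma C0_path_close:
  assumes v: "C0_path v" and t: "0 \<le> t" and e: "0 < e"
  obtains d where "0 < d" "\<And>s x. 0 \<le> s \<Longrightarrow> \<bar>s - t\<bar> < d \<Longrightarrow> x \<in> {0..1} \<Longrightarrow> \<bar>v s x - v t x\<bar> < e"
proof -
  have lim: "((\<lambda>s. sup_norm (\<lambda>x. v s x - v t x)) \<longlongrightarrow> 0) (at t within {0..})"
    using v t by (simp add: C0_path_def)
  then obtain d where d: "0 < d"
    "\<And>s. s \<in> {0..} \<Longrightarrow> 0 < dist s t \<Longrightarrow> dist s t < d \<Longrightarrow> dist (sup_norm (\<lambda>x. v s x - v t x)) 0 < e"
    using e unfolding Lim_within by blast
  show ?thesis
  proof (rule that[OF d(1)])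
    fix s x :: real assume s: "0 \<le> s" "\<bar>s - t\<bar> < d" and x: "x \<in> {0..1}"
    show "\<bar>v s x - v t x\<bar> < e"
    proof (cases "s = t")
      case False
      have "\<bar>v s x - v t x\<bar> \<le> sup_norm (\<lambda>x. v s x - v t x)"
        using C0_path_slice[OF v] s t x
        by (intro sup_norm_upper[where v = "\<lambda>x. v s x - v t x"] continuous_on_diff) auto
      also have "\<dots> < e" using d(2)[of s] s False by (simp add: dist_real_def)
      finally show ?thesis .
    qed (simp add: e)
  qed
qed

lemma C0_path_continuous:
  assumes v: "C0_path v"
  shows "continuous_on ({0..} \<times> {0..1}) (\<lambda>(t, x). v t x)"
proof (rule continuous_onI)
  fix z :: "real \<times> real" and e :: real
  assume z: "z \<in> {0..} \<times> {0..1}" and e: "0 < e"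
  obtain t x where tx: "z = (t, x)" "0 \<le> t" "x \<in> {0..1}" using z by auto
  obtain d1 where d1: "0 < d1" "\<And>s y. 0 \<le> s \<Longrightarrow> \<bar>s - t\<bar> < d1 \<Longrightarrow> y \<in> {0..1} \<Longrightarrow> \<bar>v s y - v t y\<bar> < e/2"
    using C0_path_close[OF v tx(2), of "e/2"] e by auto
  obtain d2 where d2: "0 < d2" "\<And>y. y \<in> {0..1} \<Longrightarrow> dist y x < d2 \<Longrightarrow> dist (v t y) (v t x) < e/2"
    using C0_path_slice[OF v tx(2)] tx(3) e unfolding continuous_on_iff by (meson half_gt_zero)
  show "\<exists>d>0. \<forall>z'\<in>{0..} \<times> {0..1}. dist z' z < d \<longrightarrow> dist (case z' of (t, x) \<Rightarrow> v t x) (case z of (t, x) \<Rightarrow> v t x) \<le> e"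
  proof (intro exI[of _ "min d1 d2"] conjI ballI impI)
    fix z' :: "real \<times> real" assume z': "z' \<in> {0..} \<times> {0..1}" "dist z' z < min d1 d2"
    obtain s y where sy: "z' = (s, y)" "0 \<le> s" "y \<in> {0..1}" using z' by auto
    have "dist s t < d1" "dist y x < d2"
      using z'(2) dist_fst_le[of z' z] dist_snd_le[of z' z] by (auto simp: sy tx)
    then have "\<bar>v s y - v t y\<bar> < e/2" "dist (v t y) (v t x) < e/2"
      using d1(2)[of s y] d2(2)[of y] sy by (auto simp: dist_real_def)
    then have "\<bar>v s y - v t x\<bar> < e" unfolding dist_real_def by linarith
    then show "dist (case z' of (t, x) \<Rightarrow> v t x) (case z of (t, x) \<Rightarrow> v t x) \<le> e"
      by (simp add: sy tx dist_real_def)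
  qed (use d1 d2 in auto)
qed

text \<open>By continuity in the sup norm, a strict bound at time \<open>t\<close> persists for a
  short while, so staying below the level on the closed interval already puts the infimum strictly
  beyond \<open>t\<close>. This form serves both to switch off the truncation and to prove
  measurability.\<close>

lemma less_reach_time_iff:
  assumes v: "C0_path v" and t: "0 \<le> t"
  shows "ereal t < reach_time m v \<longleftrightarrow> (\<forall>s\<in>{0..t}. \<forall>x\<in>{0..1}. \<bar>v s x\<bar> < real m)"
proof -
  have bounded: "(sup_norm (v s) < real m) = (\<forall>x\<in>{0..1}. \<bar>v s x\<bar> < real m)" if "0 \<le> s" for s
    using sup_norm_attained[OF C0_path_slice[OF v that]] sup_norm_upper[OF C0_path_slice[OF v that]]
    by (metis le_less_trans)
  show ?thesis
  proof
    assume less: "ereal t < reach_time m v"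
    show "\<forall>s\<in>{0..t}. \<forall>x\<in>{0..1}. \<bar>v s x\<bar> < real m"
    proof
      fix s assume s: "s \<in> {0..t}"
      have "sup_norm (v s) < real m"
      proof (rule ccontr)
        assume "\<not> sup_norm (v s) < real m"
        then have "reach_time m v \<le> ereal s"
          unfolding reach_time_def using s by (intro Inf_lower) auto
        also have "\<dots> \<le> ereal t" using s by simp
        finally show False using less by simp
      qed
      then show "\<forall>x\<in>{0..1}. \<bar>v s x\<bar> < real m" using bounded s by simp
    qed
  next
    assume all: "\<forall>s\<in>{0..t}. \<forall>x\<in>{0..1}. \<bar>v s x\<bar> < real m"
    then have lt: "sup_norm (v t) < real m" using bounded[OF t] t by simp
    then obtain d where d: "0 < d"
      "\<And>s x. 0 \<le> s \<Longrightarrow> \<bar>s - t\<bar> < d \<Longrightarrow> x \<in> {0..1} \<Longrightarrow> \<bar>v s x - v t x\<bar> < real m - sup_norm (v t)"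
      using C0_path_close[OF v t, of "real m - sup_norm (v t)"] by auto
    have "sup_norm (v s) < real m" if s: "0 \<le> s" "s < t + d" for s
    proof (cases "s \<le> t")
      case True
      then show ?thesis using all bounded[OF s(1)] s(1) by simp
    next
      case False
      show ?thesis unfolding bounded[OF s(1)]
      proof
        fix x :: real assume x: "x \<in> {0..1}"
        have "\<bar>v s x - v t x\<bar> < real m - sup_norm (v t)" using d(2)[of s x] s False x by simp
        moreover have "\<bar>v t x\<bar> \<le> sup_norm (v t)" by (rule sup_norm_upper[OF C0_path_slice[OF v t] x])
        ultimately show "\<bar>v s x\<bar> < real m" by linarith
      qed
    qed
    then have "ereal (t + d) \<le> reach_time m v"
      unfolding reach_time_def by (intro Inf_greatest) (force simp: not_less[symmetric])
    moreover have "ereal t < ereal (t + d)" using d by simp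
    ultimately show "ereal t < reach_time m v" by (rule less_le_trans[rotated])
  qed
qed

lemma continuous_on_atLeastI:
  fixes g :: "real \<Rightarrow> real"
  assumes "\<And>a. continuous_on {0..a} g"
  shows "continuous_on {0..} g"
  unfolding continuous_on_eq_continuous_within
proof
  fix t :: real assume t: "t \<in> {0..}"
  have "at t within {0..} = at t within {0..t+1}"
    by (rule at_within_nhd[of t "{..<t+1}"]) auto
  moreover have "continuous (at t within {0..t+1}) g"
    using assms[of "t+1"] t by (simp add: continuous_on_eq_continuous_within)
  ultimately show "continuous (at t within {0..}) g" by simp
qed

lemma continuous_on_indefinite_integral:
  fixes g :: "real \<Rightarrow> real"
  assumes "continuous_on {0..} g"
  shows "continuous_on {0..} (\<lambda>t. integral {0..t} g)"
  by (intro continuous_on_atLeastI indefinite_integral_continuous_1 integrable_continuous_real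
      continuous_on_subset[OF assms]) auto

section \<open>The weak equation along one path and comparison of truncation levels\<close>

definition spatial_integral :: "(real \<Rightarrow> real) \<Rightarrow> (real \<Rightarrow> real) \<Rightarrow> (real \<Rightarrow> real \<Rightarrow> real) \<Rightarrow> real \<Rightarrow> real" where
  "spatial_integral g \<phi> v t = integral {0..1} (\<lambda>x. g (v t x) * \<phi> x)"

lemma continuous_on_nonlinearity:
  assumes v: "C0_path v" and g: "continuous_on UNIV g"
  shows "continuous_on ({0..} \<times> {0..1}) (\<lambda>(t, x). g (v t x))"
proof -
  have "continuous_on ({0..} \<times> {0..1}) (\<lambda>z. g (case z of (t, x) \<Rightarrow> v t x))"
    by (rule continuous_on_compose2[OF g C0_path_continuous[OF v]]) auto
  then show ?thesis by (simp add: split_beta')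
qed

lemma continuous_on_nonlinearity_slice:
  assumes "C0_path v" "continuous_on UNIV g" "0 \<le> t"
  shows "continuous_on {0..1} (\<lambda>x. g (v t x))"
  using continuous_on_slice[OF continuous_on_nonlinearity[OF assms(1,2)]] assms(3) by simp

lemma continuous_on_spatial_integral:
  assumes v: "C0_path v" and g: "continuous_on UNIV g" and \<phi>: "continuous_on {0..1} \<phi>"
  shows "continuous_on {0..} (spatial_integral g \<phi> v)"
proof -
  have "continuous_on ({0..} \<times> {0..1}) (\<lambda>z. \<phi> (snd z))"
    by (rule continuous_on_compose2[OF \<phi> continuous_on_snd[OF continuous_on_id]]) auto
  with continuous_on_nonlinearity[OF v g]
  have "continuous_on ({0..} \<times> {0..1}) (\<lambda>(t, x). g (v t x) * \<phi> x)"
    unfolding split_beta' by (rule continuous_on_mult)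
  from continuous_on_integral_param[OF this] show ?thesis
    by (simp add: spatial_integral_def[abs_def])
qed

text \<open>
  The noise term recovered from a solution path \<open>v\<close>, as the residual of the weak equation tested
  against \<open>\<phi>\<close>, where \<open>\<phi>2\<close> is the second derivative of \<open>\<phi>\<close>.
\<close>

definition weak_residual ::
  "(real \<Rightarrow> real) \<Rightarrow> (real \<Rightarrow> real) \<Rightarrow> (real \<Rightarrow> real) \<Rightarrow> (real \<Rightarrow> real) \<Rightarrow> (real \<Rightarrow> real \<Rightarrow> real) \<Rightarrow> real \<Rightarrow> real"
where
  "weak_residual u0 g \<phi> \<phi>2 v t =
     spatial_integral (\<lambda>z. z) \<phi> v t - integral {0..1} (\<lambda>x. u0 x * \<phi> x)
       - integral {0..t} (spatial_integral (\<lambda>z. z) \<phi>2 v) - integral {0..t} (spatial_integral g \<phi> v)"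

lemma continuous_on_weak_residual:
  assumes "C0_path v" "continuous_on UNIV g" "continuous_on {0..1} \<phi>" "continuous_on {0..1} \<phi>2"
  shows "continuous_on {0..} (weak_residual u0 g \<phi> \<phi>2 v)"
  unfolding weak_residual_def[abs_def]
  by (intro continuous_intros continuous_on_indefinite_integral continuous_on_spatial_integral assms)

lemma set_lebesgue_integral_eq_integral_continuous:
  fixes g :: "real \<Rightarrow> real"
  assumes "continuous_on {a..b} g"
  shows "(LBINT x:{a..b}. g x) = integral {a..b} g"
  by (intro set_borel_integral_eq_integral(2) borel_integrable_atLeastAtMost' assms)

lemma spatial_integral_eq:
  assumes "C0_path v" "continuous_on UNIV g" "continuous_on {0..1} \<phi>" "0 \<le> t"
  shows "(LBINT x:{0..1}. g (v t x) * \<phi> x) = spatial_integral g \<phi> v t"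
  unfolding spatial_integral_def
  by (intro set_lebesgue_integral_eq_integral_continuous continuous_intros
      continuous_on_nonlinearity_slice assms)

lemma time_space_integral_eq:
  assumes "C0_path v" "continuous_on UNIV g" "continuous_on {0..1} \<phi>" "0 \<le> t"
  shows "(LBINT s:{0..t}. (LBINT x:{0..1}. g (v s x) * \<phi> x)) = integral {0..t} (spatial_integral g \<phi> v)"
proof -
  have "(LBINT s:{0..t}. (LBINT x:{0..1}. g (v s x) * \<phi> x)) = (LBINT s:{0..t}. spatial_integral g \<phi> v s)"
    by (rule set_lebesgue_integral_cong) (auto intro!: spatial_integral_eq assms)
  also have "\<dots> = integral {0..t} (spatial_integral g \<phi> v)"
    by (rule set_lebesgue_integral_eq_integral_continuous)
       (auto intro: continuous_on_subset[OF continuous_on_spatial_integral] assms)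
  finally show ?thesis .
qed

lemma spatial_integral_diff:
  assumes "C0_path v" "C0_path v'" "continuous_on UNIV g" "continuous_on {0..1} \<phi>" "0 \<le> t"
  shows "spatial_integral g \<phi> v t - spatial_integral g \<phi> v' t =
    integral {0..1} (\<lambda>x. (g (v t x) - g (v' t x)) * \<phi> x)"
  unfolding spatial_integral_def left_diff_distrib
  by (intro integral_diff[symmetric] integrable_continuous_real continuous_intros
      continuous_on_nonlinearity_slice assms)

text \<open>Equal residuals mean equal noise, so the noise cancels in the difference. As long as
  \<open>v\<close> stays below \<open>m\<close>, the two truncations agree along \<open>v\<close>,
  and both equations may be written with \<open>truncation f (Suc m)\<close>. Its Lipschitz constant
  is global, so nothing about the size of \<open>v'\<close> is needed.\<close>

lemma equal_before_reach_time:
  assumes f: "convex_on UNIV f" and v: "C0_path v" and v': "C0_path v'"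
    and eq: "\<And>k t. 0 \<le> t \<Longrightarrow>
      weak_residual u0 (truncation f m) (sine_mode k) (\<lambda>x. - (real (Suc k) * pi)\<^sup>2 * sine_mode k x) v t =
      weak_residual u0 (truncation f (Suc m)) (sine_mode k) (\<lambda>x. - (real (Suc k) * pi)\<^sup>2 * sine_mode k x) v' t"
    and \<tau>: "0 \<le> \<tau>" "ereal \<tau> < reach_time m v" and t: "t \<in> {0..\<tau>}" and x: "x \<in> {0..1}"
  shows "v t x = v' t x"
proof -
  define g where "g = truncation f (Suc m)"
  have g: "continuous_on UNIV g" unfolding g_def by (rule continuous_on_truncation[OF f])
  obtain L where L: "\<And>y z. \<bar>g y - g z\<bar> \<le> L * \<bar>y - z\<bar>"
    using truncation_lipschitz[OF f] unfolding g_def by blast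
  have small: "\<bar>v s x\<bar> < real m" if "s \<in> {0..\<tau>}" "x \<in> {0..1}" for s x
    using less_reach_time_iff[OF v \<tau>(1), of m] \<tau>(2) that by blast
  have sub: "{0..\<tau>} \<times> {0..1::real} \<subseteq> {0..} \<times> {0..1}" by auto
  have "v t x - v' t x = 0"
  proof (rule heat_equation_zero[where D = "\<lambda>t x. v t x - v' t x" and r = "\<lambda>t x. g (v t x) - g (v' t x)"])
    show "continuous_on ({0..\<tau>} \<times> {0..1}) (\<lambda>(t, x). v t x - v' t x)"
      using continuous_on_diff[OF C0_path_continuous[OF v] C0_path_continuous[OF v'], THEN continuous_on_subset, OF sub]
      by (simp add: split_beta')
    show "continuous_on ({0..\<tau>} \<times> {0..1}) (\<lambda>(t, x). g (v t x) - g (v' t x))"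
      using continuous_on_diff[OF continuous_on_nonlinearity[OF v g] continuous_on_nonlinearity[OF v' g],
          THEN continuous_on_subset, OF sub]
      by (simp add: split_beta')
    show "\<bar>g (v s x) - g (v' s x)\<bar> \<le> L * \<bar>v s x - v' s x\<bar>" for s x by (rule L)
    show "v s 0 - v' s 0 = 0 \<and> v s 1 - v' s 1 = 0" if "s \<in> {0..\<tau>}" for s
      using v v' that by (simp add: C0_path_def C0_def)
    fix k s assume s: "s \<in> {0..\<tau>}"
    define \<mu> where "\<mu> = (real (Suc k) * pi)\<^sup>2"
    have s0: "0 \<le> s" using s by simp
    let ?A = "spatial_integral (\<lambda>z. z) (sine_mode k)" and ?G = "spatial_integral g (sine_mode k)"
    have mode: "continuous_on {0..1} (sine_mode k)" by (intro continuous_intros)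
    have second: "spatial_integral (\<lambda>z. z) (\<lambda>x. - \<mu> * sine_mode k x) w = (\<lambda>t. - \<mu> * ?A w t)" for w
    proof
      fix t
      have "(\<lambda>x. w t x * (- \<mu> * sine_mode k x)) = (\<lambda>x. - \<mu> * (w t x * sine_mode k x))"
        by (simp add: algebra_simps)
      then show "spatial_integral (\<lambda>z. z) (\<lambda>x. - \<mu> * sine_mode k x) w t = - \<mu> * ?A w t"
        unfolding spatial_integral_def by (simp only: integral_mult_right)
    qed
    have trunc: "integral {0..s} (spatial_integral (truncation f m) (sine_mode k) v) =
        integral {0..s} (?G v)"
    proof (rule Henstock_Kurzweil_Integration.integral_cong)
      fix u assume "u \<in> {0..s}"
      then have "\<bar>v u x\<bar> < real m" if "x \<in> {0..1}" for x using small that s by auto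
      then have "truncation f m (v u x) = g (v u x)" if "x \<in> {0..1}" for x
        using that by (fastforce simp: truncation_eq g_def)
      then show "spatial_integral (truncation f m) (sine_mode k) v u = ?G v u"
        unfolding spatial_integral_def by (intro Henstock_Kurzweil_Integration.integral_cong) simp
    qed
    have cont: "continuous_on {0..s} (spatial_integral h (sine_mode k) w)"
      if "C0_path w" "continuous_on UNIV h" for h w
      using continuous_on_spatial_integral[OF that mode] by (rule continuous_on_subset) auto
    note conts = cont[OF v g] cont[OF v' g] cont[OF v continuous_on_id] cont[OF v' continuous_on_id]
    have "integral {0..1} (\<lambda>x. (v s x - v' s x) * sine_mode k x) =
        ?A v s - ?A v' s"
      by (rule spatial_integral_diff[OF v v' continuous_on_id mode s0, symmetric])
    also have "\<dots> = (integral {0..s} (?G v) - integral {0..s} (?G v'))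
        - \<mu> * (integral {0..s} (?A v) - integral {0..s} (?A v'))"
      using eq[OF s0, of k] unfolding weak_residual_def \<mu>_def[symmetric] second g_def[symmetric] trunc integral_mult_right
      by (simp add: algebra_simps)
    also have "\<dots> = integral {0..s} (\<lambda>u. (?G v u - ?G v' u)
        - \<mu> * (?A v u - ?A v' u))"
      by (subst Henstock_Kurzweil_Integration.integral_diff, (intro integrable_continuous_real continuous_intros conts)+,
          subst Henstock_Kurzweil_Integration.integral_diff, (intro integrable_continuous_real continuous_intros conts)+,
          subst integral_mult_right,
          subst Henstock_Kurzweil_Integration.integral_diff, (intro integrable_continuous_real continuous_intros conts)+, rule refl)
    also have "\<dots> = integral {0..s} (\<lambda>u. integral {0..1} (\<lambda>x. (g (v u x) - g (v' u x)) * sine_mode k x)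
        - \<mu> * integral {0..1} (\<lambda>x. (v u x - v' u x) * sine_mode k x))"
      by (intro Henstock_Kurzweil_Integration.integral_cong)
         (simp only: spatial_integral_diff[OF v v' g mode] spatial_integral_diff[OF v v' continuous_on_id mode] atLeastAtMost_iff)
    finally show "integral {0..1} (\<lambda>x. (v s x - v' s x) * sine_mode k x) = integral {0..s} (\<lambda>u.
        integral {0..1} (\<lambda>x. (g (v u x) - g (v' u x)) * sine_mode k x)
        - (real (Suc k) * pi)\<^sup>2 * integral {0..1} (\<lambda>x. (v u x - v' u x) * sine_mode k x))"
      by (simp only: \<mu>_def)
  qed (use t x in auto)
  then show ?thesis by simp
qed

lemma reach_time_nonneg: "0 \<le> reach_time m v"
  unfolding reach_time_def by (intro Inf_greatest) auto

text \<open>At a time strictly between the two hitting times in the wrong order, \<open>v'\<close>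
  would still coincide with \<open>v\<close> and so be below \<open>m\<close>, yet have reached
  \<open>Suc m\<close>.\<close>

lemma reach_time_mono:
  assumes f: "convex_on UNIV f" and v: "C0_path v" and v': "C0_path v'"
    and eq: "\<And>k t. 0 \<le> t \<Longrightarrow>
      weak_residual u0 (truncation f m) (sine_mode k) (\<lambda>x. - (real (Suc k) * pi)\<^sup>2 * sine_mode k x) v t =
      weak_residual u0 (truncation f (Suc m)) (sine_mode k) (\<lambda>x. - (real (Suc k) * pi)\<^sup>2 * sine_mode k x) v' t"
  shows "reach_time m v \<le> reach_time (Suc m) v'"
proof (rule ccontr)
  assume "\<not> ?thesis"
  then obtain t where t: "reach_time (Suc m) v' < ereal t" "ereal t < reach_time m v"
    using ereal_dense2 by (meson not_le)
  have "0 < ereal t" using reach_time_nonneg t(1) by (rule le_less_trans)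
  then have t0: "0 \<le> t" by simp
  have "\<forall>s\<in>{0..t}. \<forall>x\<in>{0..1}. \<bar>v' s x\<bar> < real (Suc m)"
  proof (intro ballI)
    fix s x :: real assume s: "s \<in> {0..t}" and x: "x \<in> {0..1}"
    have "\<bar>v s x\<bar> < real m" using less_reach_time_iff[OF v t0, of m] t(2) s x by blast
    then show "\<bar>v' s x\<bar> < real (Suc m)"
      using equal_before_reach_time[OF f v v' eq t0 t(2) s x] by simp
  qed
  then have "ereal t < reach_time (Suc m) v'" using less_reach_time_iff[OF v' t0] by blast
  with t(1) show False by simp
qed

section \<open>Wiener integrals\<close>

lemma power2_sum3_le: "((a::real) + b + c)\<^sup>2 \<le> 3 * a\<^sup>2 + 3 * b\<^sup>2 + 3 * c\<^sup>2"
  using zero_le_power2[of "a - b"] zero_le_power2[of "b - c"] zero_le_power2[of "a - c"]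
  by (simp add: power2_eq_square algebra_simps)

abbreviation sq_mean :: "'a measure \<Rightarrow> ('a \<Rightarrow> real) \<Rightarrow> ennreal" where
  "sq_mean N X \<equiv> \<integral>\<^sup>+x. ennreal ((X x)\<^sup>2) \<partial>N"

lemma nn_integral_square_sum3_le:
  fixes a b c :: "'a \<Rightarrow> real"
  assumes [measurable]: "a \<in> borel_measurable N" "b \<in> borel_measurable N" "c \<in> borel_measurable N"
  shows "sq_mean N (\<lambda>x. a x + b x + c x) \<le>
    3 * sq_mean N a + 3 * sq_mean N b + 3 * sq_mean N c"
proof -
  have "sq_mean N (\<lambda>x. a x + b x + c x) \<le>
      (\<integral>\<^sup>+x. 3 * ennreal ((a x)\<^sup>2) + 3 * ennreal ((b x)\<^sup>2) + 3 * ennreal ((c x)\<^sup>2) \<partial>N)"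
  proof (rule nn_integral_mono)
    fix x
    have "ennreal ((a x + b x + c x)\<^sup>2) \<le> ennreal (3 * (a x)\<^sup>2 + 3 * (b x)\<^sup>2 + 3 * (c x)\<^sup>2)"
      by (intro ennreal_leI power2_sum3_le)
    then show "ennreal ((a x + b x + c x)\<^sup>2) \<le> 3 * ennreal ((a x)\<^sup>2) + 3 * ennreal ((b x)\<^sup>2) + 3 * ennreal ((c x)\<^sup>2)"
      by (simp add: ennreal_plus ennreal_mult')
  qed
  also have "\<dots> = 3 * sq_mean N a + 3 * sq_mean N b + 3 * sq_mean N c"
    by (simp add: nn_integral_add nn_integral_cmult)
  finally show ?thesis .
qed

lemma nn_integral_abs_le_square:
  fixes X :: "'a \<Rightarrow> real"
  assumes [measurable]: "X \<in> borel_measurable N"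
  shows "(\<integral>\<^sup>+x. ennreal \<bar>X x\<bar> \<partial>N) \<le> emeasure N (space N) + sq_mean N X"
proof -
  have "\<bar>y\<bar> \<le> 1 + y\<^sup>2" for y :: real
    using zero_le_power2[of "\<bar>y\<bar> - 1"] by (simp add: power2_diff)
  then have "ennreal \<bar>X x\<bar> \<le> 1 + ennreal ((X x)\<^sup>2)" for x
    using ennreal_leI[of "\<bar>X x\<bar>" "1 + (X x)\<^sup>2"] by (simp add: ennreal_plus)
  then have "(\<integral>\<^sup>+x. ennreal \<bar>X x\<bar> \<partial>N) \<le> (\<integral>\<^sup>+x. 1 + ennreal ((X x)\<^sup>2) \<partial>N)"
    by (intro nn_integral_mono)
  also have "\<dots> = emeasure N (space N) + sq_mean N X"
    by (simp add: nn_integral_add)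
  finally show ?thesis .
qed

lemma chebyshev_nn_integral:
  fixes X :: "'a \<Rightarrow> real"
  assumes [measurable]: "X \<in> borel_measurable N" and a: "0 < a"
  shows "emeasure N {x \<in> space N. a \<le> \<bar>X x\<bar>} \<le> ennreal (1 / a\<^sup>2) * sq_mean N X"
proof -
  have "{x \<in> space N. a \<le> \<bar>X x\<bar>} = {x \<in> space N. 1 \<le> ennreal (1 / a\<^sup>2) * ennreal ((X x)\<^sup>2)}"
  proof (intro Collect_cong conj_cong refl)
    fix x
    have "a \<le> \<bar>X x\<bar> \<longleftrightarrow> a\<^sup>2 \<le> (X x)\<^sup>2" using a by (simp add: abs_le_square_iff[symmetric])
    also have "\<dots> \<longleftrightarrow> 1 \<le> 1 / a\<^sup>2 * (X x)\<^sup>2" using a by (simp add: field_simps)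
    also have "\<dots> \<longleftrightarrow> 1 \<le> ennreal (1 / a\<^sup>2) * ennreal ((X x)\<^sup>2)"
      by (simp add: ennreal_mult[symmetric] ennreal_1[symmetric] del: ennreal_1)
    finally show "a \<le> \<bar>X x\<bar> \<longleftrightarrow> 1 \<le> ennreal (1 / a\<^sup>2) * ennreal ((X x)\<^sup>2)" .
  qed
  also have "emeasure N \<dots> \<le> ennreal (1 / a\<^sup>2) * (\<integral>\<^sup>+x. ennreal ((X x)\<^sup>2) * indicator (space N) x \<partial>N)"
    by (rule nn_integral_Markov_inequality) auto
  also have "(\<integral>\<^sup>+x. ennreal ((X x)\<^sup>2) * indicator (space N) x \<partial>N) = sq_mean N X"
    by (rule nn_integral_cong) simp
  finally show ?thesis .
qed

lemma centered_gaussian_second_moment: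
  assumes X: "centered_gaussian M X v" and v: "0 \<le> v"
  shows "sq_mean M X = ennreal v"
proof -
  have [measurable]: "X \<in> borel_measurable M" using X by (simp add: centered_gaussian_def)
  have "sq_mean M X = (\<integral>\<^sup>+x. ennreal (x\<^sup>2) \<partial>distr M borel X)"
    by (simp add: nn_integral_distr)
  also have "\<dots> = ennreal v"
  proof (cases "v = 0")
    case True
    then have "distr M borel X = return borel 0" using X by (simp add: centered_gaussian_def)
    then show ?thesis using True by (simp add: nn_integral_return)
  next
    case False
    then have dens: "distr M borel X = density lborel (\<lambda>x. ennreal (normal_density 0 (sqrt v) x))"
      using X by (simp add: centered_gaussian_def)
    have "has_bochner_integral lborel (\<lambda>x. normal_density 0 (sqrt v) x * (x - 0) ^ (2 * 1))
        (fact (2 * 1) / ((2 / (sqrt v)\<^sup>2) ^ 1 * fact 1))"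
      using v False by (intro normal_moment_even) simp
    then have "has_bochner_integral lborel (\<lambda>x. normal_density 0 (sqrt v) x * x\<^sup>2) v"
      using v by simp
    then have "(\<integral>\<^sup>+x. ennreal (normal_density 0 (sqrt v) x * x\<^sup>2) \<partial>lborel) = ennreal v"
      by (intro nn_integral_eq_integral[THEN trans]) (auto simp: has_bochner_integral_iff)
    then show ?thesis
      unfolding dens by (simp add: nn_integral_density ennreal_mult')
  qed
  finally show ?thesis .
qed

context space_time_white_noise
begin

lemma noise_sets_finite_measure:
  assumes "A \<in> noise_sets J" "B \<in> noise_sets J"
  shows "emeasure lborel (A \<inter> B) < \<infinity>" "A \<inter> B \<in> sets borel"
proof -
  have "emeasure lborel (A \<inter> B) \<le> emeasure lborel A"
    using assms by (intro emeasure_mono) (auto simp: noise_sets_def)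
  also have "\<dots> < \<infinity>" using assms by (simp add: noise_sets_def)
  finally show "emeasure lborel (A \<inter> B) < \<infinity>" .
  show "A \<inter> B \<in> sets borel" using assms by (auto simp: noise_sets_def)
qed

lemma W_borel_measurable: "A \<in> noise_sets {0..} \<Longrightarrow> W A \<in> borel_measurable M"
  using W_gaussian[of "{A}" "\<lambda>_. 1"] by (simp add: centered_gaussian_def)

text \<open>\<open>W_gaussian\<close> speaks of a set of noise sets, each occurring once. Combining
  several step functions, or intersecting their sets with a strip, can produce the same set under
  different indices; collecting the coefficients of equal sets reduces to the assumption.\<close>

lemma indexed_step_gaussian:
  assumes I: "finite I" and A: "\<And>i. i \<in> I \<Longrightarrow> A i \<in> noise_sets {0..}"
  shows "centered_gaussian M (\<lambda>\<omega>. \<Sum>i\<in>I. c i * W (A i) \<omega>)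
    (\<Sum>i\<in>I. \<Sum>j\<in>I. c i * c j * measure lborel (A i \<inter> A j))"
proof -
  define d where "d B = (\<Sum>i\<in>{i \<in> I. A i = B}. c i)" for B
  have group: "(\<Sum>i\<in>I. c i * h (A i)) = (\<Sum>B\<in>A ` I. d B * h B)" for h :: "(real \<times> real) set \<Rightarrow> real"
    unfolding sum.image_gen[OF I, of "\<lambda>i. c i * h (A i)" A] d_def sum_distrib_right
    by (intro sum.cong refl) auto
  have "(\<Sum>i\<in>I. \<Sum>j\<in>I. c i * c j * measure lborel (A i \<inter> A j)) =
      (\<Sum>i\<in>I. c i * (\<Sum>j\<in>I. c j * measure lborel (A i \<inter> A j)))"
    by (simp add: sum_distrib_left mult.assoc)
  also have "\<dots> = (\<Sum>i\<in>I. c i * (\<Sum>B\<in>A ` I. d B * measure lborel (A i \<inter> B)))"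
    by (simp only: group[of "\<lambda>B. measure lborel (_ \<inter> B)"])
  also have "\<dots> = (\<Sum>C\<in>A ` I. d C * (\<Sum>B\<in>A ` I. d B * measure lborel (C \<inter> B)))"
    by (rule group[of "\<lambda>C. \<Sum>B\<in>A ` I. d B * measure lborel (C \<inter> B)"])
  also have "\<dots> = (\<Sum>C\<in>A ` I. \<Sum>B\<in>A ` I. d C * d B * measure lborel (C \<inter> B))"
    by (simp add: sum_distrib_left mult.assoc)
  finally have var: "(\<Sum>i\<in>I. \<Sum>j\<in>I. c i * c j * measure lborel (A i \<inter> A j)) =
    (\<Sum>C\<in>A ` I. \<Sum>B\<in>A ` I. d C * d B * measure lborel (C \<inter> B))" .
  have "(\<lambda>\<omega>. \<Sum>i\<in>I. c i * W (A i) \<omega>) = (\<lambda>\<omega>. \<Sum>B\<in>A ` I. d B * W B \<omega>)"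
    by (rule ext) (rule group[of "\<lambda>B. W B _"])
  then show ?thesis
    unfolding var using W_gaussian[of "A ` I" d] I A by auto
qed

lemma step_variance:
  fixes c :: "'i \<Rightarrow> real"
  assumes I: "finite I" and A: "\<And>i. i \<in> I \<Longrightarrow> A i \<in> noise_sets {0..}"
  defines "v \<equiv> (\<Sum>i\<in>I. \<Sum>j\<in>I. c i * c j * measure lborel (A i \<inter> A j))"
  shows "sq_mean lborel (\<lambda>z. \<Sum>i\<in>I. c i * indicator (A i) z) = ennreal v" "0 \<le> v"
proof -
  have int: "has_bochner_integral lborel (\<lambda>z. \<Sum>i\<in>I. \<Sum>j\<in>I. c i * c j * indicator (A i \<inter> A j) z) v"
    unfolding v_def
    by (intro has_bochner_integral_sum has_bochner_integral_mult_right has_bochner_integral_real_indicator)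
       (use noise_sets_finite_measure[OF A A] in auto)
  have eq: "(\<Sum>i\<in>I. c i * indicator (A i) z)\<^sup>2 = (\<Sum>i\<in>I. \<Sum>j\<in>I. c i * c j * indicator (A i \<inter> A j) z)"
    for z :: "real \<times> real"
    by (simp add: power2_eq_square sum_product indicator_inter_arith algebra_simps)
  have int': "has_bochner_integral lborel (\<lambda>z. (\<Sum>i\<in>I. c i * indicator (A i) z)\<^sup>2) v"
    using int by (simp only: eq)
  then show "sq_mean lborel (\<lambda>z. \<Sum>i\<in>I. c i * indicator (A i) z) = ennreal v"
    by (intro nn_integral_eq_integral[THEN trans]) (auto simp: has_bochner_integral_iff)
  show "0 \<le> v"
    using int' by (auto simp: has_bochner_integral_iff intro!: integral_nonneg_AE)
qed

text \<open>The isometry for step functions: the variance of the Gaussian and the integral of the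
  squared step function are the same double sum.\<close>

lemma step_second_moment:
  assumes "finite I" "\<And>i. i \<in> I \<Longrightarrow> A i \<in> noise_sets {0..}"
  shows "sq_mean M (\<lambda>\<omega>. \<Sum>i\<in>I. c i * W (A i) \<omega>) =
    sq_mean lborel (\<lambda>z. \<Sum>i\<in>I. c i * indicator (A i) z)"
  by (rule trans[OF centered_gaussian_second_moment step_variance(1)[symmetric]])
     (intro indexed_step_gaussian step_variance(2) assms; assumption)+

lemma step_measurable:
  assumes "\<And>i. i \<in> I \<Longrightarrow> A i \<in> noise_sets {0..}"
  shows "(\<lambda>\<omega>. \<Sum>i\<in>I. c i * W (A i) \<omega>) \<in> borel_measurable M"
    "(\<lambda>z. \<Sum>i\<in>I. c i * indicator (A i) z :: real) \<in> borel_measurable lborel"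
proof -
  show "(\<lambda>\<omega>. \<Sum>i\<in>I. c i * W (A i) \<omega>) \<in> borel_measurable M"
    by (intro borel_measurable_sum borel_measurable_times borel_measurable_const W_borel_measurable assms)
  have "A i \<in> sets borel" if "i \<in> I" for i using assms[OF that] by (simp add: noise_sets_def)
  then show "(\<lambda>z. \<Sum>i\<in>I. c i * indicator (A i) z :: real) \<in> borel_measurable lborel"
    by (intro borel_measurable_sum borel_measurable_times borel_measurable_const borel_measurable_indicator) auto
qed

text \<open>
  The constant 9 (the sharp one is 1) comes from splitting a square into three terms twice; it is
  harmless because only the order of magnitude of second moments matters.
\<close>

lemma wiener_integral_second_moment_le:
  assumes X: "has_wiener_integral M W h X" and Y: "has_wiener_integral M W k Y"
    and I: "finite I" and A: "\<And>i. i \<in> I \<Longrightarrow> A i \<in> noise_sets {0..}"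
  shows "sq_mean M (\<lambda>\<omega>. X \<omega> - Y \<omega> - (\<Sum>i\<in>I. c i * W (A i) \<omega>)) \<le>
    9 * sq_mean lborel (\<lambda>z. h z - k z - (\<Sum>i\<in>I. c i * indicator (A i) z))" (is "?L \<le> 9 * ?R")
proof -
  obtain \<A> a where A': "\<forall>n::nat. finite (\<A> n) \<and> \<A> n \<subseteq> noise_sets {0..}"
    and h_lim: "(\<lambda>n. \<integral>\<^sup>+z. ennreal ((h z - (\<Sum>A\<in>\<A> n. a n A * indicator A z))\<^sup>2) \<partial>lborel) \<longlonglongrightarrow> 0"
    and X_lim: "(\<lambda>n. \<integral>\<^sup>+\<omega>. ennreal ((X \<omega> - (\<Sum>A\<in>\<A> n. a n A * W A \<omega>))\<^sup>2) \<partial>M) \<longlonglongrightarrow> 0"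
    using X unfolding has_wiener_integral_def by blast
  then have \<A>: "\<And>n. finite (\<A> n)" "\<And>n. \<A> n \<subseteq> noise_sets {0..}" by blast+
  obtain \<B> b where B': "\<forall>n::nat. finite (\<B> n) \<and> \<B> n \<subseteq> noise_sets {0..}"
    and k_lim: "(\<lambda>n. \<integral>\<^sup>+z. ennreal ((k z - (\<Sum>A\<in>\<B> n. b n A * indicator A z))\<^sup>2) \<partial>lborel) \<longlonglongrightarrow> 0"
    and Y_lim: "(\<lambda>n. \<integral>\<^sup>+\<omega>. ennreal ((Y \<omega> - (\<Sum>A\<in>\<B> n. b n A * W A \<omega>))\<^sup>2) \<partial>M) \<longlonglongrightarrow> 0"
    using Y unfolding has_wiener_integral_def by blast
  then have \<B>: "\<And>n. finite (\<B> n)" "\<And>n. \<B> n \<subseteq> noise_sets {0..}" by blast+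
  have [measurable]: "X \<in> borel_measurable M" "Y \<in> borel_measurable M"
    "h \<in> borel_measurable borel" "k \<in> borel_measurable borel"
    using X Y by (auto simp: has_wiener_integral_def)
  let ?S = "\<lambda>n \<omega>. \<Sum>A\<in>\<A> n. a n A * W A \<omega>" and ?s = "\<lambda>n z. \<Sum>A\<in>\<A> n. a n A * indicator A z :: real"
  let ?T = "\<lambda>n \<omega>. \<Sum>A\<in>\<B> n. b n A * W A \<omega>" and ?t = "\<lambda>n z. \<Sum>A\<in>\<B> n. b n A * indicator A z :: real"
  let ?J = "\<lambda>\<omega>. \<Sum>i\<in>I. c i * W (A i) \<omega>" and ?j = "\<lambda>z. \<Sum>i\<in>I. c i * indicator (A i) z :: real"
  let ?nM = "\<lambda>X. \<integral>\<^sup>+\<omega>. ennreal ((X \<omega>)\<^sup>2) \<partial>M" and ?nL = "\<lambda>h. \<integral>\<^sup>+z. ennreal ((h z)\<^sup>2) \<partial>lborel"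
  have meas: "?S n \<in> borel_measurable M" "?T n \<in> borel_measurable M" "?J \<in> borel_measurable M"
    "?s n \<in> borel_measurable lborel" "?t n \<in> borel_measurable lborel" "?j \<in> borel_measurable lborel" for n
    by (intro step_measurable; use \<A> \<B> A in blast)+
  note [measurable] = meas
  have iso: "?nM (\<lambda>\<omega>. ?S n \<omega> - ?T n \<omega> - ?J \<omega>) = ?nL (\<lambda>z. ?s n z - ?t n z - ?j z)" for n
  proof -
    \<comment> \<open>A disjoint union of the three index sets turns the difference of three step
      integrals into a single one, so that the isometry can be used exactly.\<close>
    define K where "K = \<A> n <+> \<B> n <+> I"
    define e where "e = case_sum (a n) (case_sum (\<lambda>B. - b n B) (\<lambda>i. - c i))"
    define E where "E = case_sum id (case_sum id A)"
    have fin: "finite K" using \<A> \<B> I by (simp add: K_def)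
    have E: "E i \<in> noise_sets {0..}" if "i \<in> K" for i
      using that \<A>(2)[of n] \<B>(2)[of n] A by (auto simp: K_def E_def)
    have split: "(\<Sum>i\<in>K. e i * f (E i)) = (\<Sum>A\<in>\<A> n. a n A * f A) - (\<Sum>A\<in>\<B> n. b n A * f A) - (\<Sum>i\<in>I. c i * f (A i))"
      for f :: "(real \<times> real) set \<Rightarrow> real"
      unfolding K_def e_def E_def
      using \<A>(1) \<B>(1) I by (simp add: sum.Plus sum_negf comp_def)
    have "?nM (\<lambda>\<omega>. \<Sum>i\<in>K. e i * W (E i) \<omega>) = ?nL (\<lambda>z. \<Sum>i\<in>K. e i * indicator (E i) z)"
      by (rule step_second_moment[OF fin E])
    then show ?thesis
      by (simp only: split[of "\<lambda>A. W A \<omega>" for \<omega>] split[of "\<lambda>A. indicator A z" for z])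
  qed
  have bound: "?L \<le> 3 * ?nM (\<lambda>\<omega>. X \<omega> - ?S n \<omega>) + 3 * ?nM (\<lambda>\<omega>. Y \<omega> - ?T n \<omega>) +
      3 * (3 * ?nL (\<lambda>z. h z - ?s n z) + 3 * ?nL (\<lambda>z. k z - ?t n z) + 3 * ?R)" for n
  proof -
    have "?L = ?nM (\<lambda>\<omega>. (X \<omega> - ?S n \<omega>) + (?T n \<omega> - Y \<omega>) + (?S n \<omega> - ?T n \<omega> - ?J \<omega>))"
      by (simp add: algebra_simps)
    also have "\<dots> \<le> 3 * ?nM (\<lambda>\<omega>. X \<omega> - ?S n \<omega>) + 3 * ?nM (\<lambda>\<omega>. ?T n \<omega> - Y \<omega>) + 3 * ?nM (\<lambda>\<omega>. ?S n \<omega> - ?T n \<omega> - ?J \<omega>)"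
      by (rule nn_integral_square_sum3_le) measurable
    also have "?nM (\<lambda>\<omega>. ?T n \<omega> - Y \<omega>) = ?nM (\<lambda>\<omega>. Y \<omega> - ?T n \<omega>)"
      by (simp add: power2_commute)
    also have "?nM (\<lambda>\<omega>. ?S n \<omega> - ?T n \<omega> - ?J \<omega>) =
        ?nL (\<lambda>z. (?s n z - h z) + (k z - ?t n z) + (h z - k z - ?j z))"
      unfolding iso by (simp add: algebra_simps)
    also have "\<dots> \<le> 3 * ?nL (\<lambda>z. ?s n z - h z) + 3 * ?nL (\<lambda>z. k z - ?t n z) + 3 * ?R"
      by (rule nn_integral_square_sum3_le) measurable
    also have "?nL (\<lambda>z. ?s n z - h z) = ?nL (\<lambda>z. h z - ?s n z)"
      by (simp add: power2_commute)
    finally show ?thesis by (simp add: mult_left_mono add_mono)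
  qed
  have "(\<lambda>n. 3 * ?nM (\<lambda>\<omega>. X \<omega> - ?S n \<omega>) + 3 * ?nM (\<lambda>\<omega>. Y \<omega> - ?T n \<omega>) +
      3 * (3 * ?nL (\<lambda>z. h z - ?s n z) + 3 * ?nL (\<lambda>z. k z - ?t n z) + 3 * ?R))
      \<longlonglongrightarrow> 3 * 0 + 3 * 0 + 3 * (3 * 0 + 3 * 0 + 3 * ?R)"
    by (intro tendsto_add tendsto_const ennreal_tendsto_cmult X_lim Y_lim h_lim k_lim) auto
  then have "?L \<le> 3 * 0 + 3 * 0 + 3 * (3 * 0 + 3 * 0 + 3 * ?R)"
    by (rule LIMSEQ_le_const) (use bound in blast)
  also have "\<dots> = 9 * ?R" by (simp add: mult.assoc[symmetric])
  finally show ?thesis .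
qed

lemma wiener_integral_AE_unique:
  assumes X: "has_wiener_integral M W h X" and Y: "has_wiener_integral M W k Y"
    and hk: "AE z in lborel. h z = k z"
  shows "AE \<omega> in M. X \<omega> = Y \<omega>"
proof -
  have [measurable]: "X \<in> borel_measurable M" "Y \<in> borel_measurable M"
    using X Y by (auto simp: has_wiener_integral_def)
  have "sq_mean M (\<lambda>\<omega>. X \<omega> - Y \<omega>) \<le> 9 * sq_mean lborel (\<lambda>z. h z - k z)"
    using wiener_integral_second_moment_le[OF X Y, of "{} :: nat set"] by simp
  also have "sq_mean lborel (\<lambda>z. h z - k z) = (\<integral>\<^sup>+z. 0 \<partial>(lborel :: (real \<times> real) measure))"
    by (rule nn_integral_cong_AE) (use hk in auto)
  finally have "sq_mean M (\<lambda>\<omega>. X \<omega> - Y \<omega>) = 0" by simp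
  then have "AE \<omega> in M. ennreal ((X \<omega> - Y \<omega>)\<^sup>2) = 0"
    by (subst (asm) nn_integral_0_iff_AE) auto
  then show ?thesis by eventually_elim (simp add: ennreal_eq_0_iff)
qed

lemma wiener_integral_zero: "has_wiener_integral M W (\<lambda>_. 0) (\<lambda>_. 0)"
  unfolding has_wiener_integral_def
  by (auto intro!: exI[of _ "\<lambda>_. {}"])

end

text \<open>The density is bounded below on \<open>{c..c+1}\<close>, an interval of length 1. Only a
  range for the variance is assumed, since the variance of an approximating step integral is not
  known exactly.\<close>

lemma centered_gaussian_tail_lower:
  assumes X: "centered_gaussian M X v" and v: "0 < v0" "v0 \<le> v" "v \<le> v1" and c: "0 \<le> c"
  shows "ennreal (exp (- (c + 1)\<^sup>2 / (2 * v0)) / sqrt (2 * pi * v1)) \<le> emeasure M {\<omega> \<in> space M. c \<le> X \<omega>}"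
proof -
  define q where "q = exp (- (c + 1)\<^sup>2 / (2 * v0)) / sqrt (2 * pi * v1)"
  have [measurable]: "X \<in> borel_measurable M" using X by (simp add: centered_gaussian_def)
  have density: "q \<le> normal_density 0 (sqrt v) x" if "x \<in> {c..c+1}" for x
  proof -
    have "x\<^sup>2 \<le> (c + 1)\<^sup>2" using that c by (intro power_mono) auto
    then have "x\<^sup>2 / (2 * v) \<le> (c + 1)\<^sup>2 / (2 * v0)" using v by (intro frac_le) auto
    then have "exp (- (c + 1)\<^sup>2 / (2 * v0)) \<le> exp (- x\<^sup>2 / (2 * v))" by simp
    moreover have "sqrt (2 * pi * v) \<le> sqrt (2 * pi * v1)" using v by simp
    moreover have "0 < sqrt (2 * pi * v)" using v by simp
    ultimately have "q \<le> exp (- x\<^sup>2 / (2 * v)) / sqrt (2 * pi * v)"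
      unfolding q_def by (intro frac_le) auto
    then show ?thesis using v by (simp add: normal_density_def)
  qed
  have "ennreal q = (\<integral>\<^sup>+x. ennreal q * indicator {c..c+1} x \<partial>lborel)"
    by (simp add: nn_integral_cmult_indicator)
  also have "\<dots> \<le> (\<integral>\<^sup>+x. ennreal (normal_density 0 (sqrt v) x) * indicator {c..} x \<partial>lborel)"
    using density by (intro nn_integral_mono) (auto simp: indicator_def intro!: ennreal_leI)
  also have "\<dots> = emeasure (distr M borel X) {c..}"
    using X v by (simp add: centered_gaussian_def emeasure_density)
  also have "\<dots> = emeasure M {\<omega> \<in> space M. c \<le> X \<omega>}"
    by (simp add: emeasure_distr vimage_def Int_def conj_commute)
  finally show ?thesis by (simp add: q_def)
qed

abbreviation noise_kernel :: "(real \<Rightarrow> real) \<Rightarrow> real \<Rightarrow> real \<times> real \<Rightarrow> real" where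
  "noise_kernel \<phi> t \<equiv> (\<lambda>(x, s). indicator ({0..1} \<times> {0..t}) (x, s) * \<phi> x)"

lemma noise_kernel_diff:
  assumes "0 \<le> s" "s \<le> t"
  shows "noise_kernel \<phi> t z - noise_kernel \<phi> s z = indicator ({0..1} \<times> {s<..t}) z * \<phi> (fst z)"
  using assms by (cases z) (auto simp: indicator_def)

lemma rectangle_borel: "{a..b} \<times> {s<..t} \<in> sets (borel :: (real \<times> real) measure)"
proof -
  have "{a..b} \<times> {s<..t} \<in> sets (borel \<Otimes>\<^sub>M borel :: (real \<times> real) measure)"
    by (intro pair_measureI) auto
  then show ?thesis by (simp only: borel_prod)
qed

lemma rectangle_emeasure:
  assumes "a \<le> b" "s \<le> t"
  shows "emeasure lborel ({a..b} \<times> {s<..t}) = ennreal ((b - a) * (t - s))"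
proof -
  have "emeasure (lborel :: (real \<times> real) measure) ({a..b} \<times> {s<..t}) = emeasure (lborel \<Otimes>\<^sub>M lborel) ({a..b} \<times> {s<..t})"
    by (simp add: lborel_prod)
  also have "\<dots> = emeasure lborel {a..b} * emeasure lborel {s<..t}"
    by (intro lborel.emeasure_pair_measure_Times) auto
  finally show ?thesis using assms by (simp add: ennreal_mult)
qed

text \<open>Crude bounds replace the exact norm: 4 is the square of the bound 2, and 1/12 is the
  square of 1/2 times the width 1/3 of \<open>{1/6..1/2}\<close>.\<close>

lemma noise_kernel_diff_norm:
  assumes st: "0 \<le> s" "s \<le> t"
    and upper: "\<And>x. x \<in> {0..1} \<Longrightarrow> \<bar>\<phi> x\<bar> \<le> 2" and lower: "\<And>x. x \<in> {1/6..1/2} \<Longrightarrow> 1/2 \<le> \<phi> x"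
  shows "sq_mean lborel (\<lambda>z. noise_kernel \<phi> t z - noise_kernel \<phi> s z) \<le> ennreal (4 * (t - s))"
    "ennreal ((t - s) / 12) \<le> sq_mean lborel (\<lambda>z. noise_kernel \<phi> t z - noise_kernel \<phi> s z)"
proof -
  have sq: "(noise_kernel \<phi> t z - noise_kernel \<phi> s z)\<^sup>2 = indicator ({0..1} \<times> {s<..t}) z * (\<phi> (fst z))\<^sup>2" for z
    unfolding noise_kernel_diff[OF st] by (simp add: indicator_def)
  have "sq_mean lborel (\<lambda>z. noise_kernel \<phi> t z - noise_kernel \<phi> s z) \<le>
      (\<integral>\<^sup>+z. 4 * indicator ({0..1} \<times> {s<..t}) z \<partial>(lborel :: (real \<times> real) measure))"
  proof (rule nn_integral_mono)
    fix z :: "real \<times> real"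
    have "(\<phi> (fst z))\<^sup>2 \<le> 4" if "fst z \<in> {0..1}"
      using power_mono[OF upper[OF that] abs_ge_zero, of 2] by simp
    then show "ennreal ((noise_kernel \<phi> t z - noise_kernel \<phi> s z)\<^sup>2) \<le> 4 * indicator ({0..1} \<times> {s<..t}) z"
      unfolding sq by (auto simp: indicator_def mem_Times_iff intro!: ennreal_leI[of _ 4, simplified])
  qed
  also have "\<dots> = 4 * ennreal (t - s)"
    using st by (subst nn_integral_cmult_indicator) (auto simp: rectangle_borel rectangle_emeasure)
  also have "\<dots> = ennreal (4 * (t - s))"
    using st by (subst ennreal_mult) auto
  finally show "sq_mean lborel (\<lambda>z. noise_kernel \<phi> t z - noise_kernel \<phi> s z) \<le> ennreal (4 * (t - s))" .
  have "ennreal ((t - s) / 12) = ennreal (1/4) * ennreal ((1/2 - 1/6) * (t - s))"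
    using st by (subst ennreal_mult[symmetric]) auto
  also have "\<dots> = (\<integral>\<^sup>+z. ennreal (1/4) * indicator ({1/6..1/2} \<times> {s<..t}) z \<partial>(lborel :: (real \<times> real) measure))"
    using st by (subst nn_integral_cmult_indicator) (auto simp: rectangle_borel rectangle_emeasure)
  also have "\<dots> \<le> sq_mean lborel (\<lambda>z. noise_kernel \<phi> t z - noise_kernel \<phi> s z)"
  proof (rule nn_integral_mono)
    fix z :: "real \<times> real"
    have "1/4 \<le> (\<phi> (fst z))\<^sup>2" if "fst z \<in> {1/6..1/2}"
      using power_mono[OF lower[OF that], of 2] by (simp add: power_divide)
    then show "ennreal (1/4) * indicator ({1/6..1/2} \<times> {s<..t}) z \<le> ennreal ((noise_kernel \<phi> t z - noise_kernel \<phi> s z)\<^sup>2)"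
      unfolding sq by (auto simp: indicator_def mem_Times_iff intro!: ennreal_leI)
  qed
  finally show "ennreal ((t - s) / 12) \<le> sq_mean lborel (\<lambda>z. noise_kernel \<phi> t z - noise_kernel \<phi> s z)" .
qed

section \<open>Laws of increments, conditionally on the past\<close>

context space_time_white_noise
begin

lemma future_step_independent:
  assumes s: "0 \<le> s" and A: "\<And>i. i \<in> I \<Longrightarrow> A i \<in> noise_sets {s<..}"
    and D: "D \<in> sets (F s)" and B: "B \<in> sets borel"
  shows "prob (D \<inter> {\<omega> \<in> space M. (\<Sum>i\<in>I. c i * W (A i) \<omega>) \<in> B}) =
    prob D * prob {\<omega> \<in> space M. (\<Sum>i\<in>I. c i * W (A i) \<omega>) \<in> B}"
proof -
  let ?G = "\<Union>A\<in>noise_sets {s<..}. {W A -` B \<inter> space M | B. B \<in> sets borel}"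
  have G: "?G \<subseteq> Pow (space M)" by auto
  have "W (A i) \<in> borel_measurable (sigma (space M) ?G)" if "i \<in> I" for i
  proof (rule measurableI)
    fix B :: "real set" assume "B \<in> sets borel"
    then show "W (A i) -` B \<inter> space (sigma (space M) ?G) \<in> sets (sigma (space M) ?G)"
      using A[OF that] G by (auto simp: sets_measure_of space_measure_of)
  qed simp
  then have "(\<lambda>\<omega>. \<Sum>i\<in>I. c i * W (A i) \<omega>) \<in> borel_measurable (sigma (space M) ?G)"
    by (intro borel_measurable_sum borel_measurable_times borel_measurable_const)
  from measurable_sets[OF this B]
  have "{\<omega> \<in> space M. (\<Sum>i\<in>I. c i * W (A i) \<omega>) \<in> B} \<in> sigma_sets (space M) ?G"
    using G by (simp add: sets_measure_of space_measure_of vimage_def Int_def conj_commute)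
  then show ?thesis using indep_setD[OF W_indep[OF s] D] by blast
qed

text \<open>Multiply a step approximation of the kernel at time \<open>t\<close> by the indicator of
  the strip \<open>S\<close> after time \<open>s\<close>. The kernel becomes that of the increment,
  and the step integral \<open>J\<close> uses only later noise. Thus \<open>J\<close> has an exact
  Gaussian law and exact independence, while all inaccuracy sits in the second moment of
  \<open>Y - X - J\<close>.\<close>

lemma increment_approximation:
  assumes st: "0 \<le> s" "s \<le> t" and \<delta>: "0 < \<delta>"
    and X: "has_wiener_integral M W (noise_kernel \<phi> s) X"
    and Y: "has_wiener_integral M W (noise_kernel \<phi> t) Y"
    and upper: "\<And>x. x \<in> {0..1} \<Longrightarrow> \<bar>\<phi> x\<bar> \<le> 2" and lower: "\<And>x. x \<in> {1/6..1/2} \<Longrightarrow> 1/2 \<le> \<phi> x"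
  obtains J v where "centered_gaussian M J v" "(t - s) / 12 \<le> 3 * \<delta> + 3 * v" "v \<le> 3 * \<delta> + 12 * (t - s)"
    "0 \<le> v"
    "sq_mean M (\<lambda>\<omega>. Y \<omega> - X \<omega> - J \<omega>) \<le> ennreal (9 * \<delta>)"
    "\<And>D B. D \<in> sets (F s) \<Longrightarrow> B \<in> sets borel \<Longrightarrow>
      prob (D \<inter> {\<omega> \<in> space M. J \<omega> \<in> B}) = prob D * prob {\<omega> \<in> space M. J \<omega> \<in> B}"
proof -
  have [measurable]: "noise_kernel \<phi> s \<in> borel_measurable borel" "noise_kernel \<phi> t \<in> borel_measurable borel"
    using X Y by (auto simp: has_wiener_integral_def)
  obtain \<A> c where \<A>: "\<forall>n::nat. finite (\<A> n) \<and> \<A> n \<subseteq> noise_sets {0..}"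
    and lim: "(\<lambda>n. \<integral>\<^sup>+z. ennreal ((noise_kernel \<phi> t z - (\<Sum>A\<in>\<A> n. c n A * indicator A z))\<^sup>2) \<partial>lborel) \<longlonglongrightarrow> 0"
    using Y unfolding has_wiener_integral_def by blast
  have "eventually (\<lambda>n. sq_mean lborel (\<lambda>z. noise_kernel \<phi> t z - (\<Sum>A\<in>\<A> n. c n A * indicator A z)) < ennreal \<delta>) sequentially"
    using lim by (rule order_tendstoD) (use \<delta> in simp)
  then obtain n where n: "sq_mean lborel (\<lambda>z. noise_kernel \<phi> t z - (\<Sum>A\<in>\<A> n. c n A * indicator A z)) < ennreal \<delta>"
    by (auto simp: eventually_sequentially)
  define S where "S = {0..1::real} \<times> {s<..t}"
  define I where "I = \<A> n"
  have I: "finite I" "\<And>A. A \<in> I \<Longrightarrow> A \<in> noise_sets {0..}" using \<A> by (auto simp: I_def)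
  have future: "A \<inter> S \<in> noise_sets {s<..}" if "A \<in> I" for A
  proof -
    have "emeasure lborel (A \<inter> S) \<le> emeasure lborel A"
      using I(2)[OF that] by (intro emeasure_mono) (auto simp: noise_sets_def)
    then show ?thesis
      using I(2)[OF that] rectangle_borel[of 0 1 s t] by (auto simp: noise_sets_def S_def)
  qed
  have noise: "A \<inter> S \<in> noise_sets {0..}" if "A \<in> I" for A
    using future[OF that] st by (auto simp: noise_sets_def)
  define J where "J \<omega> = (\<Sum>A\<in>I. c n A * W (A \<inter> S) \<omega>)" for \<omega>
  define j where "j z = (\<Sum>A\<in>I. c n A * indicator (A \<inter> S) z)" for z :: "real \<times> real"
  define v where "v = (\<Sum>A\<in>I. \<Sum>B\<in>I. c n A * c n B * measure lborel (A \<inter> S \<inter> (B \<inter> S)))"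
  define h where "h z = noise_kernel \<phi> t z - noise_kernel \<phi> s z" for z
  have [measurable]: "j \<in> borel_measurable lborel" "h \<in> borel_measurable lborel"
    unfolding j_def[abs_def] h_def[abs_def] by (intro step_measurable noise) measurable
  have jv: "sq_mean lborel j = ennreal v" and v0: "0 \<le> v"
    unfolding j_def v_def by (rule step_variance; use I noise in blast)+
  \<comment> \<open>Restriction to \<open>S\<close> cannot increase the error: inside
    \<open>S\<close> it is unchanged, outside both functions vanish.\<close>
  have "sq_mean lborel (\<lambda>z. h z - j z) \<le>
      sq_mean lborel (\<lambda>z. noise_kernel \<phi> t z - (\<Sum>A\<in>I. c n A * indicator A z))"
  proof (rule nn_integral_mono)
    fix z
    have "j z = indicator S z * (\<Sum>A\<in>I. c n A * indicator A z)"
      unfolding j_def sum_distrib_left by (intro sum.cong refl) (auto simp: indicator_def)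
    moreover have "h z = indicator S z * noise_kernel \<phi> t z"
      unfolding h_def noise_kernel_diff[OF st] S_def using st by (cases z) (auto simp: indicator_def)
    ultimately show "ennreal ((h z - j z)\<^sup>2) \<le>
        ennreal ((noise_kernel \<phi> t z - (\<Sum>A\<in>I. c n A * indicator A z))\<^sup>2)"
      by (simp add: indicator_def)
  qed
  also have "\<dots> \<le> ennreal \<delta>" using n by (simp add: I_def)
  finally have hj: "sq_mean lborel (\<lambda>z. h z - j z) \<le> ennreal \<delta>" .
  then have jh: "sq_mean lborel (\<lambda>z. j z - h z) \<le> ennreal \<delta>" by (simp add: power2_commute)
  have h_bounds: "sq_mean lborel h \<le> ennreal (4 * (t - s))"
    "ennreal ((t - s) / 12) \<le> sq_mean lborel h"
    unfolding h_def by (rule noise_kernel_diff_norm; use st upper lower in blast)+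
  show ?thesis
  proof (rule that)
    show "centered_gaussian M J v"
      unfolding J_def[abs_def] v_def by (intro indexed_step_gaussian I noise)
    have "ennreal ((t - s) / 12) \<le> sq_mean lborel (\<lambda>z. (h z - j z) + j z + 0)"
      using h_bounds(2) by simp
    also have "\<dots> \<le> 3 * sq_mean lborel (\<lambda>z. h z - j z) + 3 * sq_mean lborel j
        + 3 * (\<integral>\<^sup>+z. ennreal (0\<^sup>2) \<partial>(lborel :: (real \<times> real) measure))"
      by (rule nn_integral_square_sum3_le) measurable
    also have "\<dots> \<le> 3 * ennreal \<delta> + 3 * ennreal v"
      using hj by (simp add: jv add_mono mult_left_mono)
    also have "\<dots> = ennreal (3 * \<delta> + 3 * v)"
      using \<delta> v0 by (simp add: ennreal_mult)
    finally show "(t - s) / 12 \<le> 3 * \<delta> + 3 * v"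
      using \<delta> v0 by (subst (asm) ennreal_le_iff) auto
    have "ennreal v = sq_mean lborel (\<lambda>z. (j z - h z) + h z + 0)"
      by (simp add: jv)
    also have "\<dots> \<le> 3 * sq_mean lborel (\<lambda>z. j z - h z) + 3 * sq_mean lborel h
        + 3 * (\<integral>\<^sup>+z. ennreal (0\<^sup>2) \<partial>(lborel :: (real \<times> real) measure))"
      by (rule nn_integral_square_sum3_le) measurable
    also have "\<dots> \<le> 3 * ennreal \<delta> + 3 * ennreal (4 * (t - s))"
      using jh h_bounds(1) by (simp add: add_mono mult_left_mono)
    also have "\<dots> = ennreal (3 * \<delta> + 12 * (t - s))"
      using \<delta> st ennreal_mult[of 3 \<delta>] ennreal_mult[of 3 "4 * (t - s)"]
        ennreal_plus[of "3 * \<delta>" "3 * (4 * (t - s))"] by simp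
    finally show "v \<le> 3 * \<delta> + 12 * (t - s)"
      using \<delta> st by (subst (asm) ennreal_le_iff) auto
    show "0 \<le> v" by (rule v0)
    have "sq_mean M (\<lambda>\<omega>. Y \<omega> - X \<omega> - J \<omega>) \<le> 9 * sq_mean lborel (\<lambda>z. h z - j z)"
      unfolding J_def h_def j_def by (rule wiener_integral_second_moment_le[OF Y X I(1) noise])
    also have "\<dots> \<le> 9 * ennreal \<delta>" using hj by (intro mult_left_mono) auto
    also have "\<dots> = ennreal (9 * \<delta>)" using \<delta> by (simp add: ennreal_mult)
    finally show "sq_mean M (\<lambda>\<omega>. Y \<omega> - X \<omega> - J \<omega>) \<le> ennreal (9 * \<delta>)" .
    show "prob (D \<inter> {\<omega> \<in> space M. J \<omega> \<in> B}) = prob D * prob {\<omega> \<in> space M. J \<omega> \<in> B}"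
      if "D \<in> sets (F s)" "B \<in> sets borel" for D B
      unfolding J_def using st(1) future that by (rule future_step_independent)
  qed
qed

lemma F_events: "0 \<le> t \<Longrightarrow> D \<in> sets (F t) \<Longrightarrow> D \<in> events"
  using subalgebra_F[of t] by (auto simp: subalgebra_def)

lemma prob_far_le:
  assumes [measurable]: "Z \<in> borel_measurable M" and a: "0 < a" and b: "0 \<le> b"
    and moment: "sq_mean M Z \<le> ennreal b"
  shows "prob {\<omega> \<in> space M. a \<le> \<bar>Z \<omega>\<bar>} \<le> b / a\<^sup>2"
proof -
  have "ennreal (prob {\<omega> \<in> space M. a \<le> \<bar>Z \<omega>\<bar>}) \<le> ennreal (1 / a\<^sup>2) * sq_mean M Z"
    unfolding emeasure_eq_measure[symmetric] using a by (intro chebyshev_nn_integral) auto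
  also have "\<dots> \<le> ennreal (1 / a\<^sup>2) * ennreal b" by (intro mult_left_mono moment) auto
  also have "\<dots> = ennreal (b / a\<^sup>2)" using b by (simp add: ennreal_mult[symmetric])
  finally show ?thesis using b by (subst (asm) ennreal_le_iff) auto
qed

text \<open>The lower tail bound at level \<open>a + 1\<close> with variance between 1/144 and 7:
  \<open>1 / (2 * (1/144))\<close> is 72, and \<open>2 * pi * 7\<close> is
  \<open>14 * pi\<close>.\<close>

abbreviation jump_weight :: "real \<Rightarrow> real" where
  "jump_weight a \<equiv> exp (- (a + 2)\<^sup>2 * 72) / sqrt (14 * pi)"

text \<open>If the approximation satisfies \<open>J >= a + 1\<close> and errs by less than 1, the
  increment is at least \<open>a\<close>. Independence is exact for \<open>J\<close>, and the
  probability of a larger error is at most the arbitrary \<open>e\<close>, so no approximation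
  remains in the conclusion.\<close>

lemma increment_large_prob:
  assumes s: "0 \<le> s" and a: "0 \<le> a" and D: "D \<in> sets (F s)"
    and X: "has_wiener_integral M W (noise_kernel \<phi> s) X"
    and Y: "has_wiener_integral M W (noise_kernel \<phi> (s + 1/2)) Y"
    and upper: "\<And>x. x \<in> {0..1} \<Longrightarrow> \<bar>\<phi> x\<bar> \<le> 2" and lower: "\<And>x. x \<in> {1/6..1/2} \<Longrightarrow> 1/2 \<le> \<phi> x"
  shows "jump_weight a * prob D \<le> prob (D \<inter> {\<omega> \<in> space M. a \<le> Y \<omega> - X \<omega>})"
proof (rule field_le_epsilon)
  fix e :: real assume e: "0 < e"
  \<comment> \<open>For a time step 1/2, \<open>1/24 <= 3 * \<delta> + 3 * v\<close> with
    \<open>\<delta> <= 1/144\<close> gives \<open>v >= 1/144\<close>, and the other estimate gives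
    \<open>v <= 7\<close>. The second entry makes the Chebyshev bound for the error at most
    \<open>e\<close>.\<close>
  define \<delta> where "\<delta> = min (1/144) (e / 9)"
  have \<delta>: "0 < \<delta>" "\<delta> \<le> 1/144" "9 * \<delta> \<le> e" using e by (auto simp: \<delta>_def)
  have [measurable]: "X \<in> borel_measurable M" "Y \<in> borel_measurable M"
    using X Y by (auto simp: has_wiener_integral_def)
  have [measurable]: "D \<in> events" using F_events[OF s D] .
  obtain J v where J: "centered_gaussian M J v" and v: "(s + 1/2 - s) / 12 \<le> 3 * \<delta> + 3 * v"
    "v \<le> 3 * \<delta> + 12 * (s + 1/2 - s)" "0 \<le> v"
    and close: "sq_mean M (\<lambda>\<omega>. Y \<omega> - X \<omega> - J \<omega>) \<le> ennreal (9 * \<delta>)"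
    and indep: "\<And>D B. D \<in> sets (F s) \<Longrightarrow> B \<in> sets borel \<Longrightarrow>
      prob (D \<inter> {\<omega> \<in> space M. J \<omega> \<in> B}) = prob D * prob {\<omega> \<in> space M. J \<omega> \<in> B}"
    by (rule increment_approximation[OF s _ \<delta>(1) X Y upper lower]) (simp | assumption | rule that)+
  have [measurable]: "J \<in> borel_measurable M" using J by (simp add: centered_gaussian_def)
  have "ennreal (exp (- (a + 1 + 1)\<^sup>2 / (2 * (1/144))) / sqrt (2 * pi * 7)) \<le> emeasure M {\<omega> \<in> space M. a + 1 \<le> J \<omega>}"
    by (rule centered_gaussian_tail_lower[OF J]) (use v \<delta> a in auto)
  also have "exp (- (a + 1 + 1)\<^sup>2 / (2 * (1/144))) / sqrt (2 * pi * 7) = jump_weight a"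
    by (simp add: algebra_simps)
  finally have tail: "jump_weight a \<le> prob {\<omega> \<in> space M. a + 1 \<le> J \<omega>}"
    by (subst (asm) emeasure_eq_measure) simp
  have far: "prob {\<omega> \<in> space M. 1 \<le> \<bar>Y \<omega> - X \<omega> - J \<omega>\<bar>} \<le> 9 * \<delta>"
    using prob_far_le[OF _ _ _ close, of 1] \<delta> by simp
  have "jump_weight a * prob D \<le> prob {\<omega> \<in> space M. a + 1 \<le> J \<omega>} * prob D"
    by (intro mult_right_mono tail) auto
  also have "\<dots> = prob (D \<inter> {\<omega> \<in> space M. J \<omega> \<in> {a + 1..}})"
    using indep[OF D, of "{a + 1..}"] by (simp add: mult.commute)
  also have "\<dots> \<le> prob ((D \<inter> {\<omega> \<in> space M. a \<le> Y \<omega> - X \<omega>}) \<union> {\<omega> \<in> space M. 1 \<le> \<bar>Y \<omega> - X \<omega> - J \<omega>\<bar>})"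
    by (intro finite_measure_mono) auto
  also have "\<dots> \<le> prob (D \<inter> {\<omega> \<in> space M. a \<le> Y \<omega> - X \<omega>}) + prob {\<omega> \<in> space M. 1 \<le> \<bar>Y \<omega> - X \<omega> - J \<omega>\<bar>}"
    by (intro measure_Un_le) auto
  also have "\<dots> \<le> prob (D \<inter> {\<omega> \<in> space M. a \<le> Y \<omega> - X \<omega>}) + e" using far \<delta> by simp
  finally show "jump_weight a * prob D \<le> prob (D \<inter> {\<omega> \<in> space M. a \<le> Y \<omega> - X \<omega>}) + e" .
qed

lemma increment_negative_prob:
  assumes s: "0 \<le> s" "s \<le> t" "t \<le> s + 1" and a: "0 < a" and D: "D \<in> sets (F s)"
    and X: "has_wiener_integral M W (noise_kernel \<phi> s) X"
    and Y: "has_wiener_integral M W (noise_kernel \<phi> t) Y"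
    and upper: "\<And>x. x \<in> {0..1} \<Longrightarrow> \<bar>\<phi> x\<bar> \<le> 2" and lower: "\<And>x. x \<in> {1/6..1/2} \<Longrightarrow> 1/2 \<le> \<phi> x"
  shows "prob (D \<inter> {\<omega> \<in> space M. Y \<omega> - X \<omega> < - a}) \<le> 52 / a\<^sup>2 * prob D"
proof (rule field_le_epsilon)
  fix e :: real assume e: "0 < e"
  \<comment> \<open>The allowance \<open>a\<close> is split in halves between \<open>J\<close> and
    the error. With \<open>\<delta> <= 1/3\<close> the variance of \<open>J\<close> is at most 1 +
    12 = 13, and Chebyshev at \<open>a/2\<close> yields 4 * 13 = 52.\<close>
  define \<delta> where "\<delta> = min (1/3) (e * a\<^sup>2 / 36)"
  have \<delta>: "0 < \<delta>" "\<delta> \<le> 1/3" "9 * \<delta> / (a/2)\<^sup>2 \<le> e"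
    using e a by (auto simp: \<delta>_def min_def field_simps)
  have [measurable]: "X \<in> borel_measurable M" "Y \<in> borel_measurable M"
    using X Y by (auto simp: has_wiener_integral_def)
  have [measurable]: "D \<in> events" using F_events[OF s(1) D] .
  obtain J v where J: "centered_gaussian M J v" and v': "(t - s) / 12 \<le> 3 * \<delta> + 3 * v" and v: "v \<le> 3 * \<delta> + 12 * (t - s)" "0 \<le> v"
    and close: "sq_mean M (\<lambda>\<omega>. Y \<omega> - X \<omega> - J \<omega>) \<le> ennreal (9 * \<delta>)"
    and indep: "\<And>D B. D \<in> sets (F s) \<Longrightarrow> B \<in> sets borel \<Longrightarrow>
      prob (D \<inter> {\<omega> \<in> space M. J \<omega> \<in> B}) = prob D * prob {\<omega> \<in> space M. J \<omega> \<in> B}"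
    by (rule increment_approximation[OF s(1,2) \<delta>(1) X Y upper lower]) (assumption | rule that)+
  have [measurable]: "J \<in> borel_measurable M" using J by (simp add: centered_gaussian_def)
  have "prob {\<omega> \<in> space M. a/2 \<le> \<bar>J \<omega>\<bar>} \<le> v / (a/2)\<^sup>2"
    using centered_gaussian_second_moment[OF J v(2)] a v(2) by (intro prob_far_le) auto
  also have "\<dots> \<le> 13 / (a/2)\<^sup>2" using v \<delta> s by (intro divide_right_mono) auto
  also have "\<dots> = 52 / a\<^sup>2" by (simp add: power_divide)
  finally have tail: "prob {\<omega> \<in> space M. a/2 \<le> \<bar>J \<omega>\<bar>} \<le> 52 / a\<^sup>2" .
  have far: "prob {\<omega> \<in> space M. a/2 \<le> \<bar>Y \<omega> - X \<omega> - J \<omega>\<bar>} \<le> 9 * \<delta> / (a/2)\<^sup>2"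
    using \<delta> a by (intro prob_far_le close) auto
  have "D \<inter> {\<omega> \<in> space M. Y \<omega> - X \<omega> < - a} \<subseteq>
      (D \<inter> {\<omega> \<in> space M. J \<omega> \<in> {..- a/2}}) \<union> {\<omega> \<in> space M. a/2 \<le> \<bar>Y \<omega> - X \<omega> - J \<omega>\<bar>}"
    by (auto simp: abs_if split: if_splits)
  then have "prob (D \<inter> {\<omega> \<in> space M. Y \<omega> - X \<omega> < - a}) \<le>
      prob ((D \<inter> {\<omega> \<in> space M. J \<omega> \<in> {..- a/2}}) \<union> {\<omega> \<in> space M. a/2 \<le> \<bar>Y \<omega> - X \<omega> - J \<omega>\<bar>})"
    by (intro finite_measure_mono) auto
  also have "\<dots> \<le> prob (D \<inter> {\<omega> \<in> space M. J \<omega> \<in> {..- a/2}}) + prob {\<omega> \<in> space M. a/2 \<le> \<bar>Y \<omega> - X \<omega> - J \<omega>\<bar>}"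
    by (intro measure_Un_le) auto
  also have "prob (D \<inter> {\<omega> \<in> space M. J \<omega> \<in> {..- a/2}}) = prob D * prob {\<omega> \<in> space M. J \<omega> \<in> {..- a/2}}"
    by (intro indep D) auto
  also have "\<dots> \<le> prob D * prob {\<omega> \<in> space M. a/2 \<le> \<bar>J \<omega>\<bar>}"
    by (intro mult_left_mono finite_measure_mono) auto
  also have "\<dots> \<le> prob D * (52 / a\<^sup>2)" by (intro mult_left_mono tail) auto
  also have "prob {\<omega> \<in> space M. a/2 \<le> \<bar>Y \<omega> - X \<omega> - J \<omega>\<bar>} \<le> e" using far \<delta>(3) by simp
  finally show "prob (D \<inter> {\<omega> \<in> space M. Y \<omega> - X \<omega> < - a}) \<le> 52 / a\<^sup>2 * prob D + e"
    by (simp add: mult.commute)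
qed

lemma increment_mean_abs:
  assumes s: "0 \<le> s" "s \<le> t" "t \<le> s + 1"
    and X: "has_wiener_integral M W (noise_kernel \<phi> s) X"
    and Y: "has_wiener_integral M W (noise_kernel \<phi> t) Y"
    and upper: "\<And>x. x \<in> {0..1} \<Longrightarrow> \<bar>\<phi> x\<bar> \<le> 2" and lower: "\<And>x. x \<in> {1/6..1/2} \<Longrightarrow> 1/2 \<le> \<phi> x"
  shows "(\<integral>\<^sup>+\<omega>. ennreal \<bar>Y \<omega> - X \<omega>\<bar> \<partial>M) \<le> 37"
proof -
  have [measurable]: "X \<in> borel_measurable M" "Y \<in> borel_measurable M"
    using X Y by (auto simp: has_wiener_integral_def)
  \<comment> \<open>From \<open>\<bar>y\<bar> <= 1 + y^2\<close>; the bound 37 is 1 plus 9 (the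
    non-sharp isometry constant) times 4 (the kernel norm over one time unit).\<close>
  have "(\<integral>\<^sup>+\<omega>. ennreal \<bar>Y \<omega> - X \<omega>\<bar> \<partial>M) \<le> 1 + sq_mean M (\<lambda>\<omega>. Y \<omega> - X \<omega>)"
    using nn_integral_abs_le_square[of "\<lambda>\<omega>. Y \<omega> - X \<omega>" M] by (simp add: emeasure_space_1)
  also have "sq_mean M (\<lambda>\<omega>. Y \<omega> - X \<omega>) \<le>
      9 * sq_mean lborel (\<lambda>z. noise_kernel \<phi> t z - noise_kernel \<phi> s z)"
    using wiener_integral_second_moment_le[OF Y X, of "{} :: nat set"] by simp
  also have "\<dots> \<le> 9 * ennreal (4 * (t - s))"
    by (intro mult_left_mono noise_kernel_diff_norm(1) s upper lower) auto
  also have "\<dots> \<le> 9 * ennreal 4" using s by (intro mult_left_mono ennreal_leI) auto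
  finally show ?thesis by (simp add: add_left_mono)
qed

end

section \<open>Measurability\<close>

text \<open>\<open>p\<close> is the limit of the jointly measurable functions \<open>p x (\<lfloor>n s\<rfloor> / n)\<close>.\<close>

lemma borel_measurable_pair_of_continuous:
  fixes p :: "'a \<Rightarrow> real \<Rightarrow> real"
  assumes meas: "\<And>s. (\<lambda>x. p x s) \<in> borel_measurable N"
    and cont: "\<And>x. x \<in> space N \<Longrightarrow> continuous_on UNIV (p x)"
  shows "(\<lambda>(x, s). p x s) \<in> borel_measurable (N \<Otimes>\<^sub>M lborel)"
proof (rule borel_measurable_LIMSEQ_real)
  let ?r = "\<lambda>n s. real_of_int \<lfloor>real (Suc n) * s\<rfloor> / real (Suc n)"
  show "(\<lambda>z. p (fst z) (?r n (snd z))) \<in> borel_measurable (N \<Otimes>\<^sub>M lborel)" for n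
  proof (rule measurable_compose_countable[where f = "\<lambda>i z. p (fst z) (real_of_int i / real (Suc n))"])
    show "(\<lambda>z. p (fst z) (real_of_int i / real (Suc n))) \<in> borel_measurable (N \<Otimes>\<^sub>M lborel)" for i :: int
      by (rule measurable_compose[OF measurable_fst meas])
    have "(\<lambda>s::real. \<lfloor>real (Suc n) * s\<rfloor>) \<in> measurable borel (count_space UNIV)" by measurable
    then show "(\<lambda>z. \<lfloor>real (Suc n) * snd z\<rfloor>) \<in> measurable (N \<Otimes>\<^sub>M lborel) (count_space UNIV)"
      by (intro measurable_compose[OF measurable_snd]) simp
  qed
  fix z :: "'a \<times> real" assume "z \<in> space (N \<Otimes>\<^sub>M lborel)"
  then have "fst z \<in> space N" by (auto simp: space_pair_measure)
  then have "isCont (p (fst z)) (snd z)" using cont by (simp add: continuous_on_eq_continuous_at)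
  moreover have "(\<lambda>n. ?r n (snd z)) \<longlonglongrightarrow> snd z"
  proof (rule tendsto_sandwich)
    have "(\<lambda>n. snd z - 1 / real (Suc n)) \<longlonglongrightarrow> snd z - 0"
      by (intro tendsto_diff tendsto_const LIMSEQ_Suc[OF lim_1_over_n])
    then show "(\<lambda>n. snd z - 1 / real (Suc n)) \<longlonglongrightarrow> snd z" by simp
    show "\<forall>\<^sub>F n in sequentially. snd z - 1 / real (Suc n) \<le> ?r n (snd z)"
    proof (intro always_eventually allI)
      fix n
      have "real (Suc n) * snd z - 1 \<le> real_of_int \<lfloor>real (Suc n) * snd z\<rfloor>" by linarith
      then have "(real (Suc n) * snd z - 1) / real (Suc n) \<le> ?r n (snd z)"
        by (intro divide_right_mono) auto
      then show "snd z - 1 / real (Suc n) \<le> ?r n (snd z)" by (simp add: diff_divide_distrib)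
    qed
    show "\<forall>\<^sub>F n in sequentially. ?r n (snd z) \<le> snd z"
    proof (intro always_eventually allI)
      fix n
      have "?r n (snd z) \<le> (real (Suc n) * snd z) / real (Suc n)"
        by (intro divide_right_mono) auto
      then show "?r n (snd z) \<le> snd z" by simp
    qed
  qed auto
  ultimately have "(\<lambda>n. p (fst z) (?r n (snd z))) \<longlonglongrightarrow> p (fst z) (snd z)"
    by (rule isCont_tendsto_compose)
  then show "(\<lambda>n. p (fst z) (?r n (snd z))) \<longlonglongrightarrow> (case z of (x, s) \<Rightarrow> p x s)"
    by (simp add: split_beta)
qed

text \<open>Clamping the time to \<open>{a..b}\<close> extends the function continuously to the
  whole line while evaluating it only at times in the interval. With \<open>N = F t\<close> this
  preserves adaptedness of time integrals.\<close>

lemma borel_measurable_pair_of_continuous_on: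
  fixes p :: "'a \<Rightarrow> real \<Rightarrow> real"
  assumes ab: "a \<le> b" and meas: "\<And>s. s \<in> {a..b} \<Longrightarrow> (\<lambda>x. p x s) \<in> borel_measurable N"
    and cont: "\<And>x. x \<in> space N \<Longrightarrow> continuous_on {a..b} (p x)"
  shows "(\<lambda>(x, s). p x (max a (min b s))) \<in> borel_measurable (N \<Otimes>\<^sub>M lborel)"
proof (rule borel_measurable_pair_of_continuous)
  show "(\<lambda>x. p x (max a (min b s))) \<in> borel_measurable N" for s
    using ab by (intro meas) auto
  show "continuous_on UNIV (\<lambda>s. p x (max a (min b s)))" if "x \<in> space N" for x
    by (rule continuous_on_compose2[OF cont[OF that]]) (use ab in \<open>auto intro!: continuous_intros\<close>)
qed

lemma borel_measurable_integral_of_continuous: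
  fixes p :: "'a \<Rightarrow> real \<Rightarrow> real"
  assumes ab: "a \<le> b" and meas: "\<And>s. s \<in> {a..b} \<Longrightarrow> (\<lambda>x. p x s) \<in> borel_measurable N"
    and cont: "\<And>x. x \<in> space N \<Longrightarrow> continuous_on {a..b} (p x)"
  shows "(\<lambda>x. integral {a..b} (p x)) \<in> borel_measurable N"
proof -
  note borel_measurable_pair_of_continuous_on[OF ab meas cont, measurable]
  have "(\<lambda>(x, s). indicator {a..b} s *\<^sub>R p x (max a (min b s))) \<in> borel_measurable (N \<Otimes>\<^sub>M lborel)"
    by measurable
  then have "(\<lambda>x. LBINT s:{a..b}. p x (max a (min b s))) \<in> borel_measurable N"
    unfolding set_lebesgue_integral_def by (rule lborel.borel_measurable_lebesgue_integral)
  moreover have "(LBINT s:{a..b}. p x (max a (min b s))) = integral {a..b} (p x)" if "x \<in> space N" for x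
  proof -
    have "(LBINT s:{a..b}. p x (max a (min b s))) = (LBINT s:{a..b}. p x s)"
      by (rule set_lebesgue_integral_cong) auto
    then show ?thesis by (simp add: set_lebesgue_integral_eq_integral_continuous cont[OF that])
  qed
  ultimately show ?thesis by (simp cong: measurable_cong)
qed

context filtered_prob_space
begin

lemma space_F: "0 \<le> t \<Longrightarrow> space (F t) = space M"
  using subalgebra_F by (simp add: subalgebra_def)

lemma measurable_F_mono:
  assumes "0 \<le> s" "s \<le> t" "X \<in> measurable (F s) N"
  shows "X \<in> measurable (F t) N"
proof (rule measurable_from_subalg)
  show "subalgebra (F t) (F s)"
    using assms F_mono by (simp add: subalgebra_def space_F)
qed (rule assms)

lemma measurable_F_M: "0 \<le> t \<Longrightarrow> X \<in> measurable (F t) N \<Longrightarrow> X \<in> measurable M N"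
  by (rule measurable_from_subalg[OF subalgebra_F])

definition adapted_path :: "('w \<Rightarrow> real \<Rightarrow> real \<Rightarrow> real) \<Rightarrow> bool" where
  "adapted_path v \<longleftrightarrow> (\<forall>\<omega>\<in>space M. C0_path (v \<omega>)) \<and>
     (\<forall>t\<ge>0. \<forall>x\<in>{0..1}. (\<lambda>\<omega>. v \<omega> t x) \<in> borel_measurable (F t))"

lemma spatial_integral_measurable:
  assumes v: "adapted_path v" and g: "continuous_on UNIV g" and \<phi>: "continuous_on {0..1} \<phi>"
    and s: "0 \<le> s" "s \<le> t"
  shows "(\<lambda>\<omega>. spatial_integral g \<phi> (v \<omega>) s) \<in> borel_measurable (F t)"
  unfolding spatial_integral_def
proof (rule borel_measurable_integral_of_continuous)
  fix x :: real assume x: "x \<in> {0..1}"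
  have [measurable]: "(\<lambda>\<omega>. v \<omega> s x) \<in> borel_measurable (F t)"
    by (rule measurable_F_mono[OF s]) (use v s x in \<open>simp add: adapted_path_def\<close>)
  have [measurable]: "g \<in> borel_measurable borel" by (rule borel_measurable_continuous_onI[OF g])
  show "(\<lambda>\<omega>. g (v \<omega> s x) * \<phi> x) \<in> borel_measurable (F t)" by measurable
next
  fix \<omega> assume "\<omega> \<in> space (F t)"
  then show "continuous_on {0..1} (\<lambda>x. g (v \<omega> s x) * \<phi> x)"
    using v s by (intro continuous_intros continuous_on_nonlinearity_slice g \<phi>)
      (auto simp: adapted_path_def space_F)
qed simp

lemma weak_residual_measurable:
  assumes v: "adapted_path v" and g: "continuous_on UNIV g"
    and \<phi>: "continuous_on {0..1} \<phi>" and \<phi>2: "continuous_on {0..1} \<phi>2" and t: "0 \<le> s" "s \<le> t"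
  shows "(\<lambda>\<omega>. weak_residual u0 g \<phi> \<phi>2 (v \<omega>) s) \<in> borel_measurable (F t)"
proof -
  have time: "(\<lambda>\<omega>. integral {0..s} (spatial_integral h \<psi> (v \<omega>))) \<in> borel_measurable (F t)"
    if "continuous_on UNIV h" "continuous_on {0..1} \<psi>" for h \<psi>
  proof (rule borel_measurable_integral_of_continuous)
    show "(\<lambda>\<omega>. spatial_integral h \<psi> (v \<omega>) r) \<in> borel_measurable (F t)" if "r \<in> {0..s}" for r
      using that t by (intro spatial_integral_measurable v \<open>continuous_on UNIV h\<close> \<open>continuous_on {0..1} \<psi>\<close>) auto
    show "continuous_on {0..s} (spatial_integral h \<psi> (v \<omega>))" if "\<omega> \<in> space (F t)" for \<omega>
      using continuous_on_spatial_integral[OF _ \<open>continuous_on UNIV h\<close> \<open>continuous_on {0..1} \<psi>\<close>, of "v \<omega>"] v that t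
      by (auto simp: adapted_path_def space_F intro: continuous_on_subset)
  qed (use t in auto)
  show ?thesis
    unfolding weak_residual_def
    by (intro borel_measurable_diff borel_measurable_const time spatial_integral_measurable v g \<phi> \<phi>2 t continuous_on_id)
qed

text \<open>The maximum over the compact set \<open>S\<close> is attained, so a strict bound by
  \<open>m\<close> means a bound by \<open>m - 1 / (k + 1)\<close> for some \<open>k\<close>. Such a
  nonstrict bound can be tested on a countable dense subset of \<open>S\<close>, hence through
  countably many variables known at time \<open>t\<close>.\<close>

lemma less_reach_time_measurable:
  assumes v: "adapted_path v" and t: "0 \<le> t"
  shows "{\<omega> \<in> space M. ereal t < reach_time m (v \<omega>)} \<in> sets (F t)"
proof -
  define S where "S = {0..t} \<times> {0..1::real}"
  obtain C where C: "countable C" "C \<subseteq> S" "S \<subseteq> closure C" using separable[of S] .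
  have sub: "S \<subseteq> {0..} \<times> {0..1}" by (auto simp: S_def)
  have "closed S" unfolding S_def by (intro closed_Times closed_real_atLeastAtMost)
  then have closC: "closure C = S" using C by (simp add: closure_minimal subset_antisym)
  have "{\<omega> \<in> space M. ereal t < reach_time m (v \<omega>)} =
      (\<Union>k. {\<omega> \<in> space M. \<forall>z\<in>C. \<bar>v \<omega> (fst z) (snd z)\<bar> \<le> real m - 1 / real (Suc k)})"
  proof (intro set_eqI iffI)
    fix \<omega> assume "\<omega> \<in> {\<omega> \<in> space M. ereal t < reach_time m (v \<omega>)}"
    then have \<omega>: "\<omega> \<in> space M" and lt: "ereal t < reach_time m (v \<omega>)" by auto
    have path: "C0_path (v \<omega>)" using v \<omega> by (simp add: adapted_path_def)
    have cont: "continuous_on S (\<lambda>z. v \<omega> (fst z) (snd z))"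
      using continuous_on_subset[OF C0_path_continuous[OF path] sub] by (simp add: split_beta')
    have "compact S" "S \<noteq> {}" using t by (auto simp: S_def intro: compact_Times)
    moreover have "continuous_on S (\<lambda>z. \<bar>v \<omega> (fst z) (snd z)\<bar>)"
      by (intro continuous_intros cont)
    ultimately obtain z where z: "z \<in> S" "\<forall>y\<in>S. \<bar>v \<omega> (fst y) (snd y)\<bar> \<le> \<bar>v \<omega> (fst z) (snd z)\<bar>"
      using continuous_attains_sup[of S "\<lambda>z. \<bar>v \<omega> (fst z) (snd z)\<bar>"] by blast
    have "\<bar>v \<omega> (fst z) (snd z)\<bar> < real m"
      using z(1) lt unfolding less_reach_time_iff[OF path t] by (auto simp: S_def)
    then obtain k where "1 / real (Suc k) < real m - \<bar>v \<omega> (fst z) (snd z)\<bar>"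
      using reals_Archimedean[of "real m - \<bar>v \<omega> (fst z) (snd z)\<bar>"] by (auto simp: inverse_eq_divide)
    then have "\<forall>y\<in>C. \<bar>v \<omega> (fst y) (snd y)\<bar> \<le> real m - 1 / real (Suc k)"
      using z(2) C(2) by force
    with \<omega> show "\<omega> \<in> (\<Union>k. {\<omega> \<in> space M. \<forall>z\<in>C. \<bar>v \<omega> (fst z) (snd z)\<bar> \<le> real m - 1 / real (Suc k)})"
      by blast
  next
    fix \<omega> assume "\<omega> \<in> (\<Union>k. {\<omega> \<in> space M. \<forall>z\<in>C. \<bar>v \<omega> (fst z) (snd z)\<bar> \<le> real m - 1 / real (Suc k)})"
    then obtain k where \<omega>: "\<omega> \<in> space M" and le: "\<And>z. z \<in> C \<Longrightarrow> \<bar>v \<omega> (fst z) (snd z)\<bar> \<le> real m - 1 / real (Suc k)"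
      by blast
    have path: "C0_path (v \<omega>)" using v \<omega> by (simp add: adapted_path_def)
    have "continuous_on (closure C) (\<lambda>z. \<bar>v \<omega> (fst z) (snd z)\<bar>)"
      unfolding closC using continuous_on_subset[OF C0_path_continuous[OF path] sub]
      by (intro continuous_intros) (simp add: split_beta')
    then have le': "\<bar>v \<omega> (fst z) (snd z)\<bar> \<le> real m - 1 / real (Suc k)" if "z \<in> S" for z
      using continuous_le_on_closure[of C "\<lambda>z. \<bar>v \<omega> (fst z) (snd z)\<bar>" z] le that by (simp add: closC)
    have "\<bar>v \<omega> s x\<bar> < real m" if "s \<in> {0..t}" "x \<in> {0..1}" for s x
      using le'[of "(s, x)"] that by (simp add: S_def le_less_trans[of _ "real m - 1 / real (Suc k)"])
    then show "\<omega> \<in> {\<omega> \<in> space M. ereal t < reach_time m (v \<omega>)}"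
      using \<omega> less_reach_time_iff[OF path t] by blast
  qed
  also have "\<dots> \<in> sets (F t)"
  proof (intro sets.countable_UN subsetI, safe)
    fix k
    have "(0, 0) \<in> S" using t by (simp add: S_def)
    then have "C \<noteq> {}" using C(3) by auto
    then have "(\<Inter>z\<in>C. {\<omega> \<in> space (F t). \<bar>v \<omega> (fst z) (snd z)\<bar> \<le> real m - 1 / real (Suc k)}) \<in> sets (F t)"
    proof (intro sets.countable_INT' C(1) image_subsetI)
      fix z assume "z \<in> C"
      then have z: "fst z \<in> {0..t}" "snd z \<in> {0..1}" using C(2) by (auto simp: S_def)
      have [measurable]: "(\<lambda>\<omega>. v \<omega> (fst z) (snd z)) \<in> borel_measurable (F t)"
        by (rule measurable_F_mono[of "fst z"]) (use v z in \<open>auto simp: adapted_path_def\<close>)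
      show "{\<omega> \<in> space (F t). \<bar>v \<omega> (fst z) (snd z)\<bar> \<le> real m - 1 / real (Suc k)} \<in> sets (F t)"
        by measurable
    qed
    also have "(\<Inter>z\<in>C. {\<omega> \<in> space (F t). \<bar>v \<omega> (fst z) (snd z)\<bar> \<le> real m - 1 / real (Suc k)}) =
        {\<omega> \<in> space M. \<forall>z\<in>C. \<bar>v \<omega> (fst z) (snd z)\<bar> \<le> real m - 1 / real (Suc k)}"
      using \<open>C \<noteq> {}\<close> t by (auto simp: space_F)
    finally show "{\<omega> \<in> space M. \<forall>z\<in>C. \<bar>v \<omega> (fst z) (snd z)\<bar> \<le> real m - 1 / real (Suc k)} \<in> sets (F t)" .
  qed
  finally show ?thesis .
qed

lemma reach_time_measurable:
  assumes v: "adapted_path v"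
  shows "(\<lambda>\<omega>. reach_time m (v \<omega>)) \<in> borel_measurable M"
  unfolding borel_measurable_ereal_iff_Ioi
proof
  fix a :: ereal
  show "(\<lambda>\<omega>. reach_time m (v \<omega>)) -` {a<..} \<inter> space M \<in> sets M"
  proof (cases a)
    case (real t)
    show ?thesis
    proof (cases "0 \<le> t")
      case True
      then show ?thesis
        using less_reach_time_measurable[OF v True, of m] subalgebra_F[OF True] real
        by (auto simp: subalgebra_def vimage_def Int_def conj_commute)
    next
      case False
      then have "ereal t < reach_time m v" for v
        using reach_time_nonneg[of m v] by (simp add: less_le_trans[of _ 0])
      then show ?thesis by (simp add: real vimage_def)
    qed
  next
    case PInf
    then have "{a<..} = {}" by auto
    then show ?thesis by simp
  next
    case MInf
    have "reach_time m v \<noteq> -\<infinity>" for v using reach_time_nonneg[of m v] by auto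
    then show ?thesis by (simp add: MInf vimage_def)
  qed
qed

end

section \<open>Solutions of the truncated equations\<close>

text \<open>Two scalings are used: \<open>c = 1\<close> with all \<open>k\<close> feeds the
  uniqueness argument, and \<open>c = pi / 2\<close> with \<open>k = 0\<close> is the weight of
  integral 1 that defines the mass.\<close>

definition mode :: "real \<Rightarrow> nat \<Rightarrow> real \<Rightarrow> real" where
  "mode c k x = c * sine_mode k x"

definition mode2 :: "real \<Rightarrow> nat \<Rightarrow> real \<Rightarrow> real" where
  "mode2 c k x = - (real (Suc k) * pi)\<^sup>2 * mode c k x"

lemma continuous_on_mode [continuous_intros]: "continuous_on S (mode c k)" "continuous_on S (mode2 c k)"
  unfolding mode2_def mode_def by (intro continuous_intros)+

lemma test_function_mode: "\<exists>D. test_function D \<and> D 0 = mode c k \<and> D 2 = mode2 c k"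
proof -
  define a where "a = real (Suc k) * pi"
  \<comment> \<open>Each derivative multiplies by \<open>a\<close> and advances the phase by a
    quarter period, which gives all derivatives in one formula.\<close>
  define D where "D j x = c * (a ^ j * sin (a * x + real j * (pi / 2)))" for j x
  have 0: "D 0 = mode c k" by (rule ext) (simp add: D_def mode_def a_def)
  have 2: "D 2 = mode2 c k"
    by (rule ext) (simp add: D_def mode_def mode2_def a_def)
  have "(D j has_real_derivative D (Suc j) x) (at x within {0..1})" for j x
  proof -
    have "a * x + real (Suc j) * (pi / 2) = (a * x + real j * (pi / 2)) + pi / 2"
      by (simp add: algebra_simps add_divide_distrib)
    then have sin_cos: "sin (a * x + real (Suc j) * (pi / 2)) = cos (a * x + real j * (pi / 2))"
      by (simp only: sin_add[of _ "pi / 2"] cos_pi_half sin_pi_half mult_zero_right add_0 mult_1_right)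
    have "D (Suc j) x = c * (a ^ j * (cos (a * x + real j * (pi / 2)) * a))"
      unfolding D_def sin_cos by simp
    moreover have "(D j has_real_derivative c * (a ^ j * (cos (a * x + real j * (pi / 2)) * a))) (at x within {0..1})"
      unfolding D_def[abs_def] by (auto intro!: derivative_eq_intros)
    ultimately show ?thesis by simp
  qed
  moreover have "mode c k 1 = 0"
    using sin_npi[of "Suc k"] by (simp add: mode_def)
  ultimately have "test_function D"
    unfolding test_function_def 0 by (simp add: mode_def)
  with 0 2 show ?thesis by blast
qed

lemma first_mode_bounds:
  defines "\<phi> \<equiv> mode (pi / 2) 0"
  shows "x \<in> {0..1} \<Longrightarrow> 0 \<le> \<phi> x" "\<bar>\<phi> x\<bar> \<le> 2" "x \<in> {1/6..1/2} \<Longrightarrow> 1/2 \<le> \<phi> x"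
    "integral {0..1} \<phi> = 1" "mode2 (pi / 2) 0 = (\<lambda>x. - pi\<^sup>2 * \<phi> x)"
proof -
  show "0 \<le> \<phi> x" if "x \<in> {0..1}"
    using that by (auto simp: \<phi>_def mode_def intro!: mult_nonneg_nonneg sin_ge_zero)
  have "\<bar>\<phi> x\<bar> = pi / 2 * \<bar>sin (pi * x)\<bar>" by (simp add: \<phi>_def mode_def abs_mult)
  also have "\<dots> \<le> 2 * 1" using pi_less_4 by (intro mult_mono) auto
  finally show "\<bar>\<phi> x\<bar> \<le> 2" by simp
  show "1/2 \<le> \<phi> x" if "x \<in> {1/6..1/2}"
  proof -
    have "pi * (1/6) \<le> pi * x" "pi * x \<le> pi * (1/2)" using that by (intro mult_left_mono; simp)+
    then have "sin (pi / 6) \<le> sin (pi * x)"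
      using pi_gt_zero by (intro sin_monotone_2pi_le) auto
    then have "1/2 \<le> sin (pi * x)" by (simp add: sin_30)
    then have "1 * (1/2) \<le> pi / 2 * sin (pi * x)" using pi_ge_two by (intro mult_mono) auto
    then show ?thesis by (simp add: \<phi>_def mode_def)
  qed
  have "(\<phi> has_integral - cos (pi * 1) / 2 - (- cos (pi * 0) / 2)) {0..1}"
    unfolding \<phi>_def mode_def[abs_def]
    by (rule fundamental_theorem_of_calculus)
       (auto intro!: derivative_eq_intros simp flip: has_real_derivative_iff_has_vector_derivative)
  then show "integral {0..1} \<phi> = 1" by (simp add: integral_unique)
  show "mode2 (pi / 2) 0 = (\<lambda>x. - pi\<^sup>2 * \<phi> x)"
    by (rule ext) (simp add: mode2_def \<phi>_def)
qed

locale truncated_solutions = space_time_white_noise M F W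
  for M :: "'w measure" and F :: "real \<Rightarrow> 'w measure" and W :: "(real \<times> real) set \<Rightarrow> 'w \<Rightarrow> real" +
  fixes \<sigma> :: real and f u0 :: "real \<Rightarrow> real" and U :: "nat \<Rightarrow> 'w \<Rightarrow> real \<Rightarrow> real \<Rightarrow> real"
  assumes \<sigma>_pos: "0 < \<sigma>" and f_nonneg: "0 \<le> f s" and f_convex: "convex_on UNIV f"
    and f_reciprocal: "reciprocal_integrable_at_top f"
    and u0_C0: "u0 \<in> C0" and u0_nonneg: "x \<in> {0..1} \<Longrightarrow> 0 \<le> u0 x"
    and solution: "spde_solution M F W \<sigma> (truncation f m) u0 (U m)"
begin

lemma adapted: "adapted_path (U m)"
  using solution[of m] by (simp add: spde_solution_def adapted_path_def C0_path_def)

lemma path: "\<omega> \<in> space M \<Longrightarrow> C0_path (U m \<omega>)"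
  using adapted by (simp add: adapted_path_def)

lemmas truncation_continuous = continuous_on_truncation[OF f_convex]

definition residual :: "real \<Rightarrow> nat \<Rightarrow> nat \<Rightarrow> 'w \<Rightarrow> real \<Rightarrow> real" where
  "residual c k m \<omega> t = weak_residual u0 (truncation f m) (mode c k) (mode2 c k) (U m \<omega>) t"

lemma residual_continuous: "\<omega> \<in> space M \<Longrightarrow> continuous_on {0..} (residual c k m \<omega>)"
  unfolding residual_def[abs_def]
  by (intro continuous_on_weak_residual path truncation_continuous continuous_intros)

lemma residual_measurable: "0 \<le> s \<Longrightarrow> s \<le> t \<Longrightarrow> (\<lambda>\<omega>. residual c k m \<omega> s) \<in> borel_measurable (F t)"
  unfolding residual_def
  by (intro weak_residual_measurable adapted truncation_continuous continuous_intros)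

lemma residual_wiener_integral:
  assumes t: "0 \<le> t"
  shows "\<exists>I. has_wiener_integral M W (noise_kernel (mode c k) t) I \<and> (AE \<omega> in M. residual c k m \<omega> t = \<sigma> * I \<omega>)"
proof -
  obtain D where D: "test_function D" "D 0 = mode c k" "D 2 = mode2 c k"
    using test_function_mode[of c k] by blast
  obtain I where I: "has_wiener_integral M W (noise_kernel (D 0) t) I"
    and AE_eq: "AE \<omega> in M.
           (LBINT x:{0..1}. U m \<omega> t x * D 0 x) - (LBINT x:{0..1}. u0 x * D 0 x) =
             (LBINT s:{0..t}. (LBINT x:{0..1}. U m \<omega> s x * D 2 x))
           + (LBINT s:{0..t}. (LBINT x:{0..1}. truncation f m (U m \<omega> s x) * D 0 x))
           + \<sigma> * I \<omega>"
    using solution[of m] D(1) t unfolding spde_solution_def by blast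
  have "AE \<omega> in M. residual c k m \<omega> t = \<sigma> * I \<omega>"
    using AE_eq AE_space
  proof eventually_elim
    case (elim \<omega>)
    note p = path[OF elim(2), of m]
    have u0: "(LBINT x:{0..1}. u0 x * mode c k x) = integral {0..1} (\<lambda>x. u0 x * mode c k x)"
      using u0_C0 by (intro set_lebesgue_integral_eq_integral_continuous continuous_intros) (simp add: C0_def)
    show ?case
      using elim(1) unfolding D(2,3) u0 residual_def weak_residual_def
        spatial_integral_eq[OF p continuous_on_id continuous_on_mode(1) t]
        spatial_integral_eq[OF p truncation_continuous continuous_on_mode(1) t]
        time_space_integral_eq[OF p continuous_on_id continuous_on_mode(2) t]
        time_space_integral_eq[OF p truncation_continuous continuous_on_mode(1) t]
      by simp
  qed
  with I show ?thesis unfolding D(2) by blast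
qed

text \<open>At a fixed time all levels give \<open>\<sigma>\<close> times versions of the same
  Wiener integral, hence agree almost surely. A countable dense set of times and continuity of the
  residuals produce one null set for all times.\<close>

lemma residual_independent_of_level:
  "AE \<omega> in M. \<forall>t\<ge>0. residual c k m \<omega> t = residual c k 0 \<omega> t"
proof -
  obtain S :: "real set" where S: "countable S" "S \<subseteq> {0..}" "{0..} \<subseteq> closure S"
    using separable[of "{0::real..}"] .
  have "AE \<omega> in M. residual c k m \<omega> t = residual c k 0 \<omega> t" if t: "t \<in> S" for t
  proof -
    have t0: "0 \<le> t" using t S by auto
    obtain I where I: "has_wiener_integral M W (noise_kernel (mode c k) t) I" "AE \<omega> in M. residual c k m \<omega> t = \<sigma> * I \<omega>"
      using residual_wiener_integral[OF t0] by blast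
    obtain J where J: "has_wiener_integral M W (noise_kernel (mode c k) t) J" "AE \<omega> in M. residual c k 0 \<omega> t = \<sigma> * J \<omega>"
      using residual_wiener_integral[OF t0] by blast
    have "AE \<omega> in M. I \<omega> = J \<omega>" by (rule wiener_integral_AE_unique[OF I(1) J(1)]) simp
    with I(2) J(2) show ?thesis by eventually_elim simp
  qed
  then have "AE \<omega> in M. \<forall>t\<in>S. residual c k m \<omega> t = residual c k 0 \<omega> t"
    using S(1) by (simp add: AE_ball_countable)
  then show ?thesis
    using AE_space
  proof eventually_elim
    case (elim \<omega>)
    have "closure S \<subseteq> {0..}" using S(2) by (intro closure_minimal) auto
    then have clos: "closure S = {0..}" using S(3) by auto
    have "continuous_on (closure S) (\<lambda>t. residual c k m \<omega> t - residual c k 0 \<omega> t)"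
      unfolding clos by (intro continuous_intros residual_continuous elim(2))
    from continuous_constant_on_closure[OF this, of 0]
    show ?case using elim(1) by (auto simp: clos)
  qed
qed

text \<open>Level 0 is an arbitrary representative. As a residual of a global solution the noise
  path exists for all times, also after the explosion.\<close>

abbreviation noise_path :: "'w \<Rightarrow> real \<Rightarrow> real" where
  "noise_path \<equiv> residual (pi / 2) 0 0"

abbreviation increment :: "'w \<Rightarrow> real \<Rightarrow> real \<Rightarrow> real" where
  "increment \<omega> s t \<equiv> noise_path \<omega> t - noise_path \<omega> s"

abbreviation first_mode :: "real \<Rightarrow> real" where
  "first_mode \<equiv> mode (pi / 2) 0"

lemma noise_path_0: "AE \<omega> in M. noise_path \<omega> 0 = 0"
proof -
  obtain I where I: "has_wiener_integral M W (noise_kernel first_mode 0) I" "AE \<omega> in M. noise_path \<omega> 0 = \<sigma> * I \<omega>"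
    using residual_wiener_integral[of 0] by blast
  \<comment> \<open>The kernel at time 0 lives on a segment, which has planar measure 0.\<close>
  have "AE z in lborel. noise_kernel first_mode 0 z = 0"
  proof (rule AE_I')
    have "emeasure (lborel \<Otimes>\<^sub>M lborel) ({0..1::real} \<times> {0::real}) = 0"
      by (subst lborel.emeasure_pair_measure_Times) auto
    then show "({0..1} \<times> {0} :: (real \<times> real) set) \<in> null_sets lborel"
      by (simp add: lborel_prod null_sets_def closed_Times borel_closed)
  qed (auto simp: indicator_def split: if_splits)
  then have "AE \<omega> in M. I \<omega> = 0"
    by (rule wiener_integral_AE_unique[OF I(1) wiener_integral_zero])
  with I(2) show ?thesis by eventually_elim simp
qed

text \<open>Collects the almost sure statements about the noise; from here on the comparison
  arguments are deterministic for one \<open>regular\<close> outcome.\<close>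

definition regular :: "'w \<Rightarrow> bool" where
  "regular \<omega> \<longleftrightarrow> \<omega> \<in> space M \<and> (\<forall>m k. \<forall>t\<ge>0. residual 1 k m \<omega> t = residual 1 k 0 \<omega> t) \<and>
     (\<forall>m. \<forall>t\<ge>0. residual (pi / 2) 0 m \<omega> t = noise_path \<omega> t) \<and> noise_path \<omega> 0 = 0"

lemma AE_regular: "AE \<omega> in M. regular \<omega>"
  unfolding regular_def
  using residual_independent_of_level noise_path_0 AE_space
  by (simp add: AE_all_countable)

abbreviation hitting_time :: "nat \<Rightarrow> 'w \<Rightarrow> ereal" where
  "hitting_time m \<omega> \<equiv> reach_time m (U m \<omega>)"

lemma hitting_time_mono: "regular \<omega> \<Longrightarrow> incseq (\<lambda>m. hitting_time m \<omega>)"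
proof (rule incseq_SucI)
  fix m assume \<omega>: "regular \<omega>"
  have mode: "mode 1 k = sine_mode k" "mode2 1 k = (\<lambda>x. - (real (Suc k) * pi)\<^sup>2 * sine_mode k x)" for k
    by (auto simp: mode_def mode2_def)
  have "residual 1 k m \<omega> t = residual 1 k (Suc m) \<omega> t" if "0 \<le> t" for k t
    using \<omega> that unfolding regular_def by metis
  then show "hitting_time m \<omega> \<le> hitting_time (Suc m) \<omega>"
    unfolding residual_def mode
    by (intro reach_time_mono[OF f_convex, where ?u0.0 = u0] path) (use \<omega> in \<open>auto simp: regular_def\<close>)
qed

definition mass :: "nat \<Rightarrow> 'w \<Rightarrow> real \<Rightarrow> real" where
  "mass m \<omega> = spatial_integral (\<lambda>z. z) first_mode (U m \<omega>)"

definition reaction :: "nat \<Rightarrow> 'w \<Rightarrow> real \<Rightarrow> real" where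
  "reaction m \<omega> = spatial_integral (truncation f m) first_mode (U m \<omega>)"

lemma mass_continuous: "\<omega> \<in> space M \<Longrightarrow> continuous_on {0..} (mass m \<omega>)"
  unfolding mass_def by (intro continuous_on_spatial_integral path continuous_on_id continuous_intros)

lemma reaction_continuous: "\<omega> \<in> space M \<Longrightarrow> continuous_on {0..} (reaction m \<omega>)"
  unfolding reaction_def by (intro continuous_on_spatial_integral path truncation_continuous continuous_intros)

lemma mass_equation_0:
  assumes \<omega>: "regular \<omega>" and t: "0 \<le> t"
  shows "mass m \<omega> t = integral {0..1} (\<lambda>x. u0 x * first_mode x)
    + integral {0..t} (\<lambda>s. reaction m \<omega> s - pi\<^sup>2 * mass m \<omega> s) + noise_path \<omega> t"
proof -
  have sp: "\<omega> \<in> space M" using \<omega> by (simp add: regular_def)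
  have second: "spatial_integral (\<lambda>z. z) (mode2 (pi / 2) 0) (U m \<omega>) = (\<lambda>s. - pi\<^sup>2 * mass m \<omega> s)"
  proof
    fix s
    have "(\<lambda>x. U m \<omega> s x * (- pi\<^sup>2 * first_mode x)) = (\<lambda>x. - pi\<^sup>2 * (U m \<omega> s x * first_mode x))"
      by (simp add: algebra_simps)
    then show "spatial_integral (\<lambda>z. z) (mode2 (pi / 2) 0) (U m \<omega>) s = - pi\<^sup>2 * mass m \<omega> s"
      unfolding first_mode_bounds(5) mass_def spatial_integral_def by (simp only: integral_mult_right)
  qed
  have conts: "continuous_on {0..t} (mass m \<omega>)" "continuous_on {0..t} (reaction m \<omega>)"
    by (auto intro: continuous_on_subset[OF mass_continuous[OF sp]] continuous_on_subset[OF reaction_continuous[OF sp]])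
  have "integral {0..t} (\<lambda>s. reaction m \<omega> s - pi\<^sup>2 * mass m \<omega> s) =
      integral {0..t} (reaction m \<omega>) - pi\<^sup>2 * integral {0..t} (mass m \<omega>)"
    using conts by (subst Henstock_Kurzweil_Integration.integral_diff)
      (auto intro!: integrable_continuous_real continuous_intros)
  moreover have "residual (pi / 2) 0 m \<omega> t = mass m \<omega> t - integral {0..1} (\<lambda>x. u0 x * first_mode x)
      - integral {0..t} (\<lambda>s. - pi\<^sup>2 * mass m \<omega> s) - integral {0..t} (reaction m \<omega>)"
    unfolding residual_def weak_residual_def second unfolding mass_def reaction_def by (rule refl)
  moreover have "integral {0..t} (\<lambda>s. - pi\<^sup>2 * mass m \<omega> s) = - pi\<^sup>2 * integral {0..t} (mass m \<omega>)"
    by (rule integral_mult_right)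
  moreover have "residual (pi / 2) 0 m \<omega> t = noise_path \<omega> t"
    using \<omega> t unfolding regular_def by blast
  ultimately show ?thesis by linarith
qed

lemma mass_equation:
  assumes \<omega>: "regular \<omega>" and t: "0 \<le> a" "a \<le> t"
  shows "mass m \<omega> t = mass m \<omega> a
    + integral {a..t} (\<lambda>s. reaction m \<omega> s - pi\<^sup>2 * mass m \<omega> s) + (increment \<omega> a t)"
proof -
  have sp: "\<omega> \<in> space M" using \<omega> by (simp add: regular_def)
  have "continuous_on {0..t} (\<lambda>s. reaction m \<omega> s - pi\<^sup>2 * mass m \<omega> s)"
    by (rule continuous_on_subset[of "{0..}"])
       (auto intro!: continuous_intros mass_continuous[OF sp] reaction_continuous[OF sp])
  then have "integral {0..a} (\<lambda>s. reaction m \<omega> s - pi\<^sup>2 * mass m \<omega> s) + integral {a..t} (\<lambda>s. reaction m \<omega> s - pi\<^sup>2 * mass m \<omega> s)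
      = integral {0..t} (\<lambda>s. reaction m \<omega> s - pi\<^sup>2 * mass m \<omega> s)"
    using t by (intro Henstock_Kurzweil_Integration.integral_combine integrable_continuous_real)
  then show ?thesis
    using mass_equation_0[OF \<omega> t(1), of m] mass_equation_0[OF \<omega> order_trans[OF t], of m] by simp
qed

lemma reaction_nonneg: "\<omega> \<in> space M \<Longrightarrow> 0 \<le> t \<Longrightarrow> 0 \<le> reaction m \<omega> t"
  unfolding reaction_def spatial_integral_def
  using first_mode_bounds(1) f_nonneg
  by (intro integral_nonneg integrable_continuous_real continuous_intros
      continuous_on_nonlinearity_slice path truncation_continuous)
     (auto simp: truncation_def)

text \<open>A truncation of a convex function is in general not convex, so Jensen is used for
  \<open>f\<close>. Before the hitting time the path stays where \<open>f\<close> and its truncation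
  coincide.\<close>

lemma reaction_ge:
  assumes \<omega>: "\<omega> \<in> space M" and t: "0 \<le> t" "t \<le> t'" "ereal t' < hitting_time m \<omega>"
  shows "f (mass m \<omega> t) \<le> reaction m \<omega> t"
proof -
  have "f (mass m \<omega> t) \<le> integral {0..1} (\<lambda>x. f (U m \<omega> t x) * first_mode x)"
    unfolding mass_def spatial_integral_def
    by (intro jensen_weighted_integral f_convex C0_path_slice path \<omega> t first_mode_bounds continuous_intros)
  also have "\<dots> = reaction m \<omega> t"
    unfolding reaction_def spatial_integral_def
  proof (intro Henstock_Kurzweil_Integration.integral_cong)
    fix x :: real assume "x \<in> {0..1}"
    then have "\<bar>U m \<omega> t x\<bar> < real m"
      using less_reach_time_iff[OF path[OF \<omega>], of t' m m] t by auto
    then show "f (U m \<omega> t x) * first_mode x = truncation f m (U m \<omega> t x) * first_mode x"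
      by (simp add: truncation_eq)
  qed
  finally show ?thesis .
qed

end

section \<open>Increments of the first-mode noise\<close>

context truncated_solutions
begin

lemma noise_path_measurable: "0 \<le> s \<Longrightarrow> s \<le> t \<Longrightarrow> (\<lambda>\<omega>. noise_path \<omega> s) \<in> borel_measurable (F t)"
  by (rule residual_measurable)

lemma noise_path_measurable_M: "0 \<le> s \<Longrightarrow> (\<lambda>\<omega>. noise_path \<omega> s) \<in> borel_measurable M"
  by (rule measurable_F_M[OF _ noise_path_measurable]) auto

lemma noise_path_increment_integrals:
  assumes "0 \<le> s" "0 \<le> t"
  obtains X Y where "has_wiener_integral M W (noise_kernel first_mode s) X"
    "has_wiener_integral M W (noise_kernel first_mode t) Y"
    "AE \<omega> in M. increment \<omega> s t = \<sigma> * (Y \<omega> - X \<omega>)"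
proof -
  obtain X where X: "has_wiener_integral M W (noise_kernel first_mode s) X" "AE \<omega> in M. noise_path \<omega> s = \<sigma> * X \<omega>"
    using residual_wiener_integral[OF assms(1)] by blast
  obtain Y where Y: "has_wiener_integral M W (noise_kernel first_mode t) Y" "AE \<omega> in M. noise_path \<omega> t = \<sigma> * Y \<omega>"
    using residual_wiener_integral[OF assms(2)] by blast
  have "AE \<omega> in M. increment \<omega> s t = \<sigma> * (Y \<omega> - X \<omega>)"
    using X(2) Y(2) by eventually_elim (simp add: algebra_simps)
  with X(1) Y(1) show ?thesis by (rule that)
qed

lemma noise_path_large_prob:
  assumes s: "0 \<le> s" and a: "0 \<le> a" and D: "D \<in> sets (F s)"
  shows "jump_weight a * prob D \<le>
    prob (D \<inter> {\<omega> \<in> space M. \<sigma> * a \<le> increment \<omega> s (s + 1/2)})"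
proof -
  have s': "0 \<le> s + 1/2" using s by simp
  obtain X Y where X: "has_wiener_integral M W (noise_kernel first_mode s) X"
    and Y: "has_wiener_integral M W (noise_kernel first_mode (s + 1/2)) Y"
    and eq: "AE \<omega> in M. increment \<omega> s (s + 1/2) = \<sigma> * (Y \<omega> - X \<omega>)"
    by (rule noise_path_increment_integrals[OF s s'])
  have [measurable]: "X \<in> borel_measurable M" "Y \<in> borel_measurable M"
    using X Y by (auto simp: has_wiener_integral_def)
  note [measurable] = noise_path_measurable_M[OF s] noise_path_measurable_M[OF s'] F_events[OF s D]
  have "jump_weight a * prob D \<le> prob (D \<inter> {\<omega> \<in> space M. a \<le> Y \<omega> - X \<omega>})"
    by (rule increment_large_prob[OF s a D X Y]) (use first_mode_bounds(2,3) in auto)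
  also have "\<dots> = prob (D \<inter> {\<omega> \<in> space M. \<sigma> * a \<le> increment \<omega> s (s + 1/2)})"
  proof (rule finite_measure_eq_AE)
    show "AE \<omega> in M. (\<omega> \<in> D \<inter> {\<omega> \<in> space M. a \<le> Y \<omega> - X \<omega>}) =
        (\<omega> \<in> D \<inter> {\<omega> \<in> space M. \<sigma> * a \<le> increment \<omega> s (s + 1/2)})"
      using eq by eventually_elim (use \<sigma>_pos in simp)
  qed measurable
  finally show ?thesis .
qed

lemma noise_path_negative_prob:
  assumes s: "0 \<le> s" "s \<le> t" "t \<le> s + 1" and a: "0 < a" and D: "D \<in> sets (F s)"
  shows "prob (D \<inter> {\<omega> \<in> space M. increment \<omega> s t < - (\<sigma> * a)}) \<le> 52 / a\<^sup>2 * prob D"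
proof -
  have t: "0 \<le> t" using s by simp
  obtain X Y where X: "has_wiener_integral M W (noise_kernel first_mode s) X"
    and Y: "has_wiener_integral M W (noise_kernel first_mode t) Y"
    and eq: "AE \<omega> in M. increment \<omega> s t = \<sigma> * (Y \<omega> - X \<omega>)"
    by (rule noise_path_increment_integrals[OF s(1) t])
  have [measurable]: "X \<in> borel_measurable M" "Y \<in> borel_measurable M"
    using X Y by (auto simp: has_wiener_integral_def)
  note [measurable] = noise_path_measurable_M[OF s(1)] noise_path_measurable_M[OF t] F_events[OF s(1) D]
  have "prob (D \<inter> {\<omega> \<in> space M. increment \<omega> s t < - (\<sigma> * a)}) =
      prob (D \<inter> {\<omega> \<in> space M. Y \<omega> - X \<omega> < - a})"
  proof (rule finite_measure_eq_AE)
    show "AE \<omega> in M. (\<omega> \<in> D \<inter> {\<omega> \<in> space M. increment \<omega> s t < - (\<sigma> * a)}) =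
        (\<omega> \<in> D \<inter> {\<omega> \<in> space M. Y \<omega> - X \<omega> < - a})"
      using eq
    proof eventually_elim
      case (elim \<omega>)
      have "\<sigma> * (Y \<omega> - X \<omega>) < - (\<sigma> * a) \<longleftrightarrow> \<sigma> * (Y \<omega> - X \<omega>) < \<sigma> * (- a)" by simp
      also have "\<dots> \<longleftrightarrow> Y \<omega> - X \<omega> < - a" using \<sigma>_pos by (simp only: mult_less_cancel_left_pos)
      finally show ?case using elim by simp
    qed
  qed measurable
  also have "\<dots> \<le> 52 / a\<^sup>2 * prob D"
    by (rule increment_negative_prob[OF s a D X Y]) (use first_mode_bounds(2,3) in auto)
  finally show ?thesis .
qed

lemma noise_path_mean_abs:
  assumes s: "0 \<le> s" "s \<le> t" "t \<le> s + 1"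
  shows "(\<integral>\<^sup>+\<omega>. ennreal \<bar>increment \<omega> s t\<bar> \<partial>M) \<le> ennreal (37 * \<sigma>)"
proof -
  have t: "0 \<le> t" using s by simp
  obtain X Y where X: "has_wiener_integral M W (noise_kernel first_mode s) X"
    and Y: "has_wiener_integral M W (noise_kernel first_mode t) Y"
    and eq: "AE \<omega> in M. increment \<omega> s t = \<sigma> * (Y \<omega> - X \<omega>)"
    by (rule noise_path_increment_integrals[OF s(1) t])
  have [measurable]: "X \<in> borel_measurable M" "Y \<in> borel_measurable M"
    using X Y by (auto simp: has_wiener_integral_def)
  have "(\<integral>\<^sup>+\<omega>. ennreal \<bar>increment \<omega> s t\<bar> \<partial>M) = (\<integral>\<^sup>+\<omega>. ennreal \<sigma> * ennreal \<bar>Y \<omega> - X \<omega>\<bar> \<partial>M)"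
    by (rule nn_integral_cong_AE)
       (use eq in eventually_elim, use \<sigma>_pos in \<open>simp add: abs_mult ennreal_mult\<close>)
  also have "\<dots> = ennreal \<sigma> * (\<integral>\<^sup>+\<omega>. ennreal \<bar>Y \<omega> - X \<omega>\<bar> \<partial>M)"
    by (rule nn_integral_cmult) measurable
  also have "\<dots> \<le> ennreal \<sigma> * 37"
    by (intro mult_left_mono increment_mean_abs[OF s X Y]) (use first_mode_bounds(2,3) in auto)
  also have "\<dots> = ennreal (37 * \<sigma>)"
    using \<sigma>_pos ennreal_mult[of \<sigma> 37] by (simp add: mult.commute)
  finally show ?thesis .
qed

lemma noise_increment_pair_measurable:
  assumes "0 \<le> s" "s \<le> r"
  shows "(\<lambda>(\<omega>, t). increment \<omega> s (max s (min r t))) \<in> borel_measurable (M \<Otimes>\<^sub>M lborel)"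
proof -
  have [measurable]: "(\<lambda>(\<omega>, t). noise_path \<omega> (max s (min r t))) \<in> borel_measurable (M \<Otimes>\<^sub>M lborel)"
  proof (rule borel_measurable_pair_of_continuous_on[OF assms(2)])
    show "(\<lambda>\<omega>. noise_path \<omega> t) \<in> borel_measurable M" if "t \<in> {s..r}" for t
      using that assms by (intro noise_path_measurable_M) auto
    show "continuous_on {s..r} (noise_path \<omega>)" if "\<omega> \<in> space M" for \<omega>
      using assms by (intro continuous_on_subset[OF residual_continuous[OF that]]) auto
  qed
  note [measurable] = noise_path_measurable_M[OF assms(1)]
  show ?thesis by measurable
qed

text \<open>Each fixed time is bad with conditional probability at most
  \<open>52 / a^2 <= 1/4\<close>; this is where 208 = 4 * 52 comes from. By Fubini the mean measure
  of the bad times on \<open>D\<close> is at most \<open>prob D / 8\<close>, and Markov's inequality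
  at 1/4 leaves at least half of \<open>D\<close>.\<close>

lemma noise_path_mostly_above:
  assumes s: "0 \<le> s" and a: "0 < a" "208 \<le> a\<^sup>2" and D: "D \<in> sets (F s)"
  defines "bad \<equiv> \<lambda>\<omega>. {t \<in> {s..s+1/2}. increment \<omega> s t < - (\<sigma> * a)}"
  shows "{\<omega> \<in> space M. measure lborel (bad \<omega>) \<le> 1/4} \<in> events"
    "prob D / 2 \<le> prob (D \<inter> {\<omega> \<in> space M. measure lborel (bad \<omega>) \<le> 1/4})"
proof -
  interpret P: pair_sigma_finite M lborel ..
  \<comment> \<open>The clamped increment equals the true one on the interval and is jointly
    measurable, as Fubini requires.\<close>
  let ?p = "\<lambda>\<omega> t. noise_path \<omega> (max s (min (s+1/2) t)) - noise_path \<omega> s"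
  let ?b = "\<lambda>\<omega> t. indicator {..< - (\<sigma> * a)} (?p \<omega> t) :: ennreal"
  have [measurable]: "(\<lambda>(\<omega>, t). ?p \<omega> t) \<in> borel_measurable (M \<Otimes>\<^sub>M lborel)"
    using s by (intro noise_increment_pair_measurable) auto
  let ?I = "\<lambda>\<omega>. \<integral>\<^sup>+t. indicator {s..s+1/2} t * (indicator D \<omega> * ?b \<omega> t) \<partial>lborel"
  note [measurable] = F_events[OF s D]
  have bad: "bad \<omega> = {t \<in> space lborel. t \<in> {s..s+1/2} \<and> ?p \<omega> t < - (\<sigma> * a)}" for \<omega>
    unfolding bad_def by (auto simp: max_def min_def)
  have bad_borel: "bad \<omega> \<in> sets lborel" if "\<omega> \<in> space M" for \<omega>
  proof -
    have "(\<lambda>t. ?p \<omega> t) \<in> borel_measurable lborel"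
      using measurable_Pair2[of "\<lambda>(\<omega>, t). ?p \<omega> t" M lborel borel \<omega>] that by simp
    then show ?thesis unfolding bad by measurable
  qed
  have finite_bad: "emeasure lborel (bad \<omega>) = ennreal (measure lborel (bad \<omega>))" for \<omega>
  proof (rule emeasure_eq_ennreal_measure)
    have "emeasure lborel (bad \<omega>) \<le> emeasure lborel {s..s+1/2}"
      by (rule emeasure_mono) (auto simp: bad_def)
    also have "\<dots> < \<top>" using emeasure_compact_finite[of "{s..s+1/2}"] by simp
    finally show "emeasure lborel (bad \<omega>) \<noteq> \<top>" by simp
  qed
  have ind: "(\<integral>\<^sup>+t. indicator {s..s+1/2} t * ?b \<omega> t \<partial>lborel) = emeasure lborel (bad \<omega>)"
    if "\<omega> \<in> space M" for \<omega>
    by (subst nn_integral_indicator[OF bad_borel[OF that], symmetric], rule nn_integral_cong)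
       (auto simp: bad indicator_def)
  have [measurable]: "(\<lambda>\<omega>. emeasure lborel (bad \<omega>)) \<in> borel_measurable M"
  proof (subst measurable_cong[OF ind[symmetric]])
    show "(\<lambda>\<omega>. \<integral>\<^sup>+t. indicator {s..s+1/2} t * ?b \<omega> t \<partial>lborel) \<in> borel_measurable M"
      by (rule lborel.borel_measurable_nn_integral) measurable
  qed
  have meas: "(\<lambda>\<omega>. measure lborel (bad \<omega>)) \<in> borel_measurable M"
    unfolding measure_def by measurable
  then show ev: "{\<omega> \<in> space M. measure lborel (bad \<omega>) \<le> 1/4} \<in> events" by measurable
  note [measurable] = meas
  have fiber: "(\<integral>\<^sup>+\<omega>. indicator D \<omega> * ?b \<omega> t \<partial>M) \<le> ennreal (1/4 * prob D)" for t
  proof -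
    define t' where "t' = max s (min (s+1/2) t)"
    have t': "s \<le> t'" "t' \<le> s + 1" by (auto simp: t'_def)
    note [measurable] = noise_path_measurable_M[OF s] noise_path_measurable_M[OF order_trans[OF s t'(1)]]
    have "(\<integral>\<^sup>+\<omega>. indicator D \<omega> * indicator {..< - (\<sigma> * a)} (increment \<omega> s t') \<partial>M) =
        (\<integral>\<^sup>+\<omega>. indicator (D \<inter> {\<omega> \<in> space M. increment \<omega> s t' < - (\<sigma> * a)}) \<omega> \<partial>M)"
      by (rule nn_integral_cong) (auto simp: indicator_def)
    also have "\<dots> = ennreal (prob (D \<inter> {\<omega> \<in> space M. increment \<omega> s t' < - (\<sigma> * a)}))"
      by (subst nn_integral_indicator) (auto simp: emeasure_eq_measure)
    also have "\<dots> \<le> ennreal (52 / a\<^sup>2 * prob D)"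
      by (intro ennreal_leI noise_path_negative_prob s t' a D)
    also have "\<dots> \<le> ennreal (1/4 * prob D)"
      using a by (intro ennreal_leI mult_right_mono) (auto simp: field_simps)
    finally show ?thesis by (simp add: t'_def)
  qed
  have "ennreal (prob (D \<inter> {\<omega> \<in> space M. 1/4 < measure lborel (bad \<omega>)})) =
      (\<integral>\<^sup>+\<omega>. indicator (D \<inter> {\<omega> \<in> space M. 1/4 < measure lborel (bad \<omega>)}) \<omega> \<partial>M)"
    by (subst nn_integral_indicator) (auto simp: emeasure_eq_measure)
  also have "\<dots> \<le> (\<integral>\<^sup>+\<omega>. 4 * ?I \<omega> \<partial>M)"
  proof (rule nn_integral_mono)
    fix \<omega> assume \<omega>: "\<omega> \<in> space M"
    have "?I \<omega> =
        (if \<omega> \<in> D then emeasure lborel (bad \<omega>) else 0)"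
      using ind[OF \<omega>] by simp
    moreover have "1 \<le> 4 * emeasure lborel (bad \<omega>)" if "1/4 < measure lborel (bad \<omega>)"
    proof -
      have "ennreal 1 \<le> ennreal (4 * measure lborel (bad \<omega>))" using that by (intro ennreal_leI) simp
      then show ?thesis by (simp add: finite_bad ennreal_mult)
    qed
    ultimately show "indicator (D \<inter> {\<omega> \<in> space M. 1/4 < measure lborel (bad \<omega>)}) \<omega> \<le>
      4 * ?I \<omega>"
      by (auto simp: indicator_def)
  qed
  also have "\<dots> = 4 * (\<integral>\<^sup>+\<omega>. ?I \<omega> \<partial>M)"
    by (rule nn_integral_cmult) (rule lborel.borel_measurable_nn_integral, measurable)
  also have "(\<integral>\<^sup>+\<omega>. ?I \<omega> \<partial>M) =
      (\<integral>\<^sup>+t. (\<integral>\<^sup>+\<omega>. indicator {s..s+1/2} t * (indicator D \<omega> * ?b \<omega> t) \<partial>M) \<partial>lborel)"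
    by (rule P.Fubini'[symmetric]) measurable
  also have "\<dots> = (\<integral>\<^sup>+t. indicator {s..s+1/2} t * (\<integral>\<^sup>+\<omega>. indicator D \<omega> * ?b \<omega> t \<partial>M) \<partial>lborel)"
    by (intro nn_integral_cong) (auto simp: indicator_def)
  also have "\<dots> \<le> (\<integral>\<^sup>+t. ennreal (1/4 * prob D) * indicator {s..s+1/2} t \<partial>lborel)"
    by (rule nn_integral_mono) (subst mult.commute, intro mult_right_mono fiber zero_le)
  also have "\<dots> = ennreal (1/4 * prob D) * ennreal (1/2)"
    by (subst nn_integral_cmult_indicator) (auto simp: emeasure_lborel_Icc_eq)
  also have "4 * (ennreal (1/4 * prob D) * ennreal (1/2)) = ennreal (prob D / 2)"
  proof -
    have "ennreal (1/4 * prob D) * ennreal (1/2) = ennreal (prob D / 8)"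
      by (subst ennreal_mult[symmetric]) auto
    moreover have "4 * ennreal (prob D / 8) = ennreal (4 * (prob D / 8))"
      by (subst ennreal_mult) auto
    ultimately show ?thesis by simp
  qed
  finally have bad_le: "prob (D \<inter> {\<omega> \<in> space M. 1/4 < measure lborel (bad \<omega>)}) \<le> prob D / 2"
    by (simp add: mult_left_mono)
  have "prob D = prob (D \<inter> {\<omega> \<in> space M. measure lborel (bad \<omega>) \<le> 1/4}) + prob (D \<inter> {\<omega> \<in> space M. 1/4 < measure lborel (bad \<omega>)})"
    using sets.sets_into_space[OF F_events[OF s D]]
    by (subst finite_measure_Union[symmetric]) (auto intro!: arg_cong[where f = prob])
  with bad_le show "prob D / 2 \<le> prob (D \<inter> {\<omega> \<in> space M. measure lborel (bad \<omega>) \<le> 1/4})" by simp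
qed

section \<open>A lower bound for the mass that does not depend on the level\<close>

definition fluctuation :: "nat \<Rightarrow> 'w \<Rightarrow> real" where
  "fluctuation n \<omega> = \<bar>increment \<omega> (real n) (real n + 1)\<bar>
     + pi\<^sup>2 * integral {real n..real n + 1} (\<lambda>s. \<bar>increment \<omega> (real n) s\<bar>)"

text \<open>Iterates \<open>linear_drift_comparison\<close> over unit intervals with
  \<open>\<nu> = pi^2\<close>; \<open>fluctuation n\<close> is its error term on the
  \<open>n\<close>-th one. The start 0 is below the initial mass because \<open>u0\<close> is
  nonnegative. The process is a function of the noise alone, so it is defined for every
  \<open>n\<close>, whether or not the solution still exists.\<close>

primrec lower_bound :: "nat \<Rightarrow> 'w \<Rightarrow> real" where
  "lower_bound 0 \<omega> = 0"
| "lower_bound (Suc n) \<omega> = exp (- pi\<^sup>2) * lower_bound n \<omega> - fluctuation n \<omega>"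

lemma increment_continuous:
  "\<omega> \<in> space M \<Longrightarrow> 0 \<le> a \<Longrightarrow> continuous_on {a..b} (\<lambda>s. increment \<omega> a s)"
  by (intro continuous_intros continuous_on_subset[OF residual_continuous]) auto

lemma fluctuation_measurable: "fluctuation n \<in> borel_measurable (F (real n + 1))"
proof -
  have int: "(\<lambda>\<omega>. integral {real n..real n + 1} (\<lambda>s. \<bar>increment \<omega> (real n) s\<bar>)) \<in> borel_measurable (F (real n + 1))"
  proof (rule borel_measurable_integral_of_continuous)
    show "(\<lambda>\<omega>. \<bar>increment \<omega> (real n) s\<bar>) \<in> borel_measurable (F (real n + 1))"
      if "s \<in> {real n..real n + 1}" for s
      by (intro borel_measurable_abs borel_measurable_diff noise_path_measurable) (use that in auto)
    show "continuous_on {real n..real n + 1} (\<lambda>s. \<bar>increment \<omega> (real n) s\<bar>)"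
      if "\<omega> \<in> space (F (real n + 1))" for \<omega>
      using that by (intro continuous_on_rabs increment_continuous) (auto simp: space_F)
  qed simp
  show ?thesis
    unfolding fluctuation_def[abs_def]
    by (intro borel_measurable_add borel_measurable_abs borel_measurable_diff borel_measurable_times
        borel_measurable_const noise_path_measurable int) auto
qed

lemma lower_bound_measurable: "lower_bound n \<in> borel_measurable (F (real n))"
proof (induction n)
  case (Suc n)
  have [measurable]: "lower_bound n \<in> borel_measurable (F (real (Suc n)))"
    by (rule measurable_F_mono[OF _ _ Suc]) auto
  have [measurable]: "fluctuation n \<in> borel_measurable (F (real (Suc n)))"
    using fluctuation_measurable[of n] by (simp add: add.commute)
  show ?case unfolding lower_bound.simps(2)[abs_def] by measurable
qed simp

lemma lower_bound_measurable_M [measurable]: "lower_bound n \<in> borel_measurable M"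
  by (rule measurable_F_M[OF _ lower_bound_measurable]) simp

lemma fluctuation_mean: "(\<integral>\<^sup>+\<omega>. ennreal (fluctuation n \<omega>) \<partial>M) \<le> ennreal (37 * \<sigma> * (1 + pi\<^sup>2))"
proof -
  interpret P: pair_sigma_finite M lborel ..
  let ?n = "real n"
  let ?p = "\<lambda>\<omega> t. noise_path \<omega> (max ?n (min (?n + 1) t)) - noise_path \<omega> ?n"
  let ?I = "\<lambda>\<omega>. \<integral>\<^sup>+s. indicator {?n..?n+1} s * ennreal \<bar>?p \<omega> s\<bar> \<partial>lborel"
  have [measurable]: "(\<lambda>(\<omega>, t). ?p \<omega> t) \<in> borel_measurable (M \<Otimes>\<^sub>M lborel)"
    by (intro noise_increment_pair_measurable) auto
  have [measurable]: "(\<lambda>\<omega>. noise_path \<omega> ?n) \<in> borel_measurable M" "(\<lambda>\<omega>. noise_path \<omega> (?n + 1)) \<in> borel_measurable M"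
    by (auto intro: noise_path_measurable_M)
  have inner: "ennreal (integral {?n..?n+1} (\<lambda>s. \<bar>increment \<omega> ?n s\<bar>)) =
      ?I \<omega>" if \<omega>: "\<omega> \<in> space M" for \<omega>
  proof -
    have cont: "continuous_on {?n..?n+1} (\<lambda>s. \<bar>increment \<omega> ?n s\<bar>)"
      using \<omega> by (intro continuous_on_rabs increment_continuous) auto
    have clamp: "ennreal (indicator {?n..?n+1} s *\<^sub>R \<bar>increment \<omega> ?n s\<bar>) =
        indicator {?n..?n+1} s * ennreal \<bar>?p \<omega> s\<bar>" for s :: real
    proof (cases "s \<in> {?n..?n+1}")
      case True
      then have "?n \<le> s" "s \<le> ?n + 1" by (simp_all only: atLeastAtMost_iff)
      then have "max ?n (min (?n + 1) s) = s" by (simp only: min_absorb2 max_absorb2)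
      then show ?thesis using True by (simp only: indicator_simps scaleR_one mult_1_left)
    next
      case False
      then show ?thesis unfolding indicator_simps(2)[OF False] by simp
    qed
    have lebesgue: "integral {?n..?n+1} (\<lambda>s. \<bar>increment \<omega> ?n s\<bar>) =
        (LBINT s:{?n..?n+1}. \<bar>increment \<omega> ?n s\<bar>)"
      by (rule set_lebesgue_integral_eq_integral_continuous[OF cont, symmetric])
    have "ennreal (LBINT s:{?n..?n+1}. \<bar>increment \<omega> ?n s\<bar>) =
        (\<integral>\<^sup>+s. ennreal (indicator {?n..?n+1} s *\<^sub>R \<bar>increment \<omega> ?n s\<bar>) \<partial>lborel)"
      unfolding set_lebesgue_integral_def
      using borel_integrable_atLeastAtMost'[OF cont]
      by (intro nn_integral_eq_integral[symmetric]) (auto simp: set_integrable_def)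
    also have "\<dots> = ?I \<omega>"
      by (simp only: clamp)
    finally show ?thesis by (simp only: lebesgue)
  qed
  have inner_meas: "(\<lambda>\<omega>. \<integral>\<^sup>+s. indicator {?n..?n+1} s * ennreal \<bar>?p \<omega> s\<bar> \<partial>lborel) \<in> borel_measurable M"
    by (rule lborel.borel_measurable_nn_integral) measurable
  note [measurable] = inner_meas
  have "(\<integral>\<^sup>+\<omega>. ?I \<omega> \<partial>M) =
      (\<integral>\<^sup>+s. (\<integral>\<^sup>+\<omega>. indicator {?n..?n+1} s * ennreal \<bar>?p \<omega> s\<bar> \<partial>M) \<partial>lborel)"
    by (rule P.Fubini'[symmetric]) measurable
  also have "\<dots> \<le> (\<integral>\<^sup>+s. ennreal (37 * \<sigma>) * indicator {?n..?n+1} s \<partial>lborel)"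
  proof (rule nn_integral_mono)
    fix s :: real
    show "(\<integral>\<^sup>+\<omega>. indicator {?n..?n+1} s * ennreal \<bar>?p \<omega> s\<bar> \<partial>M) \<le> ennreal (37 * \<sigma>) * indicator {?n..?n+1} s"
      using noise_path_mean_abs[of ?n s] by (auto simp: indicator_def)
  qed
  also have "\<dots> = ennreal (37 * \<sigma>)"
    by (subst nn_integral_cmult_indicator) (auto simp: emeasure_lborel_Icc_eq)
  finally have time: "(\<integral>\<^sup>+\<omega>. ?I \<omega> \<partial>M) \<le> ennreal (37 * \<sigma>)" .
  have "(\<integral>\<^sup>+\<omega>. ennreal (fluctuation n \<omega>) \<partial>M) =
      (\<integral>\<^sup>+\<omega>. ennreal \<bar>increment \<omega> ?n (?n + 1)\<bar>
        + ennreal (pi\<^sup>2) * ?I \<omega> \<partial>M)"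
  proof (rule nn_integral_cong)
    fix \<omega> assume \<omega>: "\<omega> \<in> space M"
    have "0 \<le> integral {?n..?n+1} (\<lambda>s. \<bar>increment \<omega> ?n s\<bar>)"
      using \<omega> by (intro integral_nonneg integrable_continuous_real continuous_on_rabs increment_continuous) auto
    then show "ennreal (fluctuation n \<omega>) = ennreal \<bar>increment \<omega> ?n (?n + 1)\<bar>
        + ennreal (pi\<^sup>2) * ?I \<omega>"
      unfolding fluctuation_def inner[OF \<omega>, symmetric] by (simp add: ennreal_plus ennreal_mult)
  qed
  also have "\<dots> = (\<integral>\<^sup>+\<omega>. ennreal \<bar>increment \<omega> ?n (?n + 1)\<bar> \<partial>M)
      + ennreal (pi\<^sup>2) * (\<integral>\<^sup>+\<omega>. ?I \<omega> \<partial>M)"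
    by (subst nn_integral_add, measurable, subst nn_integral_cmult, measurable)
  also have "\<dots> \<le> ennreal (37 * \<sigma>) + ennreal (pi\<^sup>2) * ennreal (37 * \<sigma>)"
    by (intro add_mono mult_left_mono time noise_path_mean_abs) auto
  also have "\<dots> = ennreal (37 * \<sigma> * (1 + pi\<^sup>2))"
    using \<sigma>_pos by (simp add: ennreal_mult[symmetric] ennreal_plus[symmetric] algebra_simps del: ennreal_plus)
  finally show ?thesis .
qed

lemma fluctuation_nonneg: "\<omega> \<in> space M \<Longrightarrow> 0 \<le> fluctuation n \<omega>"
  unfolding fluctuation_def
  by (intro add_nonneg_nonneg mult_nonneg_nonneg integral_nonneg integrable_continuous_real
      continuous_on_rabs increment_continuous) auto

lemma lower_bound_tight: "\<exists>C\<ge>0. \<forall>n. (\<integral>\<^sup>+\<omega>. ennreal \<bar>lower_bound n \<omega>\<bar> \<partial>M) \<le> ennreal C"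
proof -
  define q where "q = exp (- pi\<^sup>2)"
  define B where "B = 37 * \<sigma> * (1 + pi\<^sup>2)"
  \<comment> \<open>The fixed point of the recursion \<open>C = q * C + B\<close> for the first
    moments, where \<open>B\<close> bounds the mean fluctuation; it is preserved because
    \<open>q < 1\<close>.\<close>
  define C where "C = B / (1 - q)"
  have q: "0 < q" "q < 1" by (auto simp: q_def)
  have B: "0 \<le> B" using \<sigma>_pos by (simp add: B_def)
  have C: "0 \<le> C" "q * C + B = C" using q B by (auto simp: C_def field_simps)
  have "(\<integral>\<^sup>+\<omega>. ennreal \<bar>lower_bound n \<omega>\<bar> \<partial>M) \<le> ennreal C" for n
  proof (induction n)
    case (Suc n)
    have [measurable]: "fluctuation n \<in> borel_measurable M"
      by (rule measurable_F_M[OF _ fluctuation_measurable]) simp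
    have "(\<integral>\<^sup>+\<omega>. ennreal \<bar>lower_bound (Suc n) \<omega>\<bar> \<partial>M) \<le>
        (\<integral>\<^sup>+\<omega>. ennreal q * ennreal \<bar>lower_bound n \<omega>\<bar> + ennreal (fluctuation n \<omega>) \<partial>M)"
    proof (rule nn_integral_mono)
      fix \<omega> assume "\<omega> \<in> space M"
      then have nn: "0 \<le> fluctuation n \<omega>" by (rule fluctuation_nonneg)
      have "\<bar>lower_bound (Suc n) \<omega>\<bar> \<le> \<bar>q * lower_bound n \<omega>\<bar> + \<bar>fluctuation n \<omega>\<bar>"
        unfolding lower_bound.simps q_def[symmetric] by (rule abs_triangle_ineq4)
      also have "\<dots> = q * \<bar>lower_bound n \<omega>\<bar> + fluctuation n \<omega>" using q nn by (simp add: abs_mult)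
      finally have "ennreal \<bar>lower_bound (Suc n) \<omega>\<bar> \<le> ennreal (q * \<bar>lower_bound n \<omega>\<bar> + fluctuation n \<omega>)"
        by (rule ennreal_leI)
      then show "ennreal \<bar>lower_bound (Suc n) \<omega>\<bar> \<le> ennreal q * ennreal \<bar>lower_bound n \<omega>\<bar> + ennreal (fluctuation n \<omega>)"
        using q nn by (simp add: ennreal_plus ennreal_mult del: lower_bound.simps)
    qed
    also have "\<dots> = ennreal q * (\<integral>\<^sup>+\<omega>. ennreal \<bar>lower_bound n \<omega>\<bar> \<partial>M) + (\<integral>\<^sup>+\<omega>. ennreal (fluctuation n \<omega>) \<partial>M)"
      by (subst nn_integral_add, measurable, subst nn_integral_cmult, measurable)
    also have "\<dots> \<le> ennreal q * ennreal C + ennreal B"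
      unfolding B_def by (intro add_mono mult_left_mono Suc fluctuation_mean) auto
    also have "\<dots> = ennreal (q * C + B)" using q B C(1) by (simp only: ennreal_plus ennreal_mult mult_nonneg_nonneg less_imp_le)
    finally show ?case by (simp only: C(2))
  qed simp
  with C show ?thesis by blast
qed

text \<open>The only property of the reaction that enters is its nonnegativity, so the bound holds
  at every level and even beyond its hitting time.\<close>

lemma mass_ge_lower_bound:
  assumes \<omega>: "regular \<omega>"
  shows "lower_bound n \<omega> \<le> mass m \<omega> (real n)"
proof (induction n)
  case 0
  have "0 \<le> integral {0..1} (\<lambda>x. u0 x * first_mode x)"
    using u0_C0 u0_nonneg first_mode_bounds(1)
    by (intro integral_nonneg integrable_continuous_real continuous_intros) (auto simp: C0_def)
  then show ?case using mass_equation_0[OF \<omega>, of 0 m] \<omega> by (simp add: regular_def)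
next
  case (Suc n)
  have sp: "\<omega> \<in> space M" using \<omega> by (simp add: regular_def)
  have "exp (- pi\<^sup>2) * mass m \<omega> (real n) - fluctuation n \<omega> \<le> mass m \<omega> (real n + 1)"
    unfolding fluctuation_def
  proof (rule linear_drift_comparison)
    show "mass m \<omega> t = mass m \<omega> (real n) + integral {real n..t} (\<lambda>s. reaction m \<omega> s - pi\<^sup>2 * mass m \<omega> s)
        + (increment \<omega> (real n) t)" if "t \<in> {real n..real n + 1}" for t
      using that by (intro mass_equation \<omega>) auto
    show "0 \<le> reaction m \<omega> s" if "s \<in> {real n..real n + 1}" for s
      using that by (intro reaction_nonneg sp) auto
  qed (auto intro: continuous_on_subset[OF mass_continuous[OF sp]] continuous_on_subset[OF reaction_continuous[OF sp]]
      increment_continuous[OF sp])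
  moreover have "exp (- pi\<^sup>2) * lower_bound n \<omega> \<le> exp (- pi\<^sup>2) * mass m \<omega> (real n)"
    using Suc by (intro mult_left_mono) auto
  moreover have "mass m \<omega> (real (Suc n)) = mass m \<omega> (real n + 1)" by (simp add: add.commute)
  ultimately show ?case unfolding lower_bound.simps by linarith
qed

end

section \<open>Explosion\<close>

context truncated_solutions
begin

text \<open>For regular outcomes this says that the explosion time exceeds \<open>n\<close>.
  Quantifying over levels, instead of using the limit, makes the event measurable at time
  \<open>n\<close> without reference to monotonicity.\<close>

definition alive :: "nat \<Rightarrow> 'w set" where
  "alive n = {\<omega> \<in> space M. \<exists>m. ereal (real n) < hitting_time m \<omega>}"

lemma alive_measurable: "alive n \<in> sets (F (real n))"
proof -
  have "alive n = (\<Union>m. {\<omega> \<in> space M. ereal (real n) < hitting_time m \<omega>})"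
    by (auto simp: alive_def)
  then show ?thesis
    using less_reach_time_measurable[OF adapted, of "real n"] by auto
qed

lemma alive_event: "alive n \<in> events"
  by (rule F_events[OF _ alive_measurable]) simp

lemma alive_Suc_subset: "alive (Suc n) \<subseteq> alive n"
proof
  fix \<omega> assume "\<omega> \<in> alive (Suc n)"
  then obtain m where "\<omega> \<in> space M" "ereal (real (Suc n)) < hitting_time m \<omega>"
    by (auto simp: alive_def)
  moreover have "ereal (real n) < ereal (real (Suc n))" by simp
  ultimately show "\<omega> \<in> alive n"
    unfolding alive_def by (blast intro: less_trans)
qed

text \<open>A gain of \<open>2 * \<sigma> * a\<close> in the first half unit, of which at most
  \<open>\<sigma> * a\<close> is lost, leaves the increment since \<open>n\<close> above
  \<open>h = \<sigma> * a\<close> at most times of the second half. The choice of \<open>a\<close>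
  makes \<open>h\<close> large enough to compensate a starting mass as low as \<open>- R\<close>.
  Survival past \<open>n + 1\<close> supplies a level whose truncation is inactive on the whole
  interval, so blow-up of the scalar inequality contradicts it.\<close>

lemma favourable_noise_kills:
  assumes \<omega>: "regular \<omega>" and alive: "\<omega> \<in> alive (Suc n)"
    and K: "0 \<le> K" "\<And>s. - K \<le> f s - pi\<^sup>2 * s"
    and pos: "\<And>s. w0 \<le> s \<Longrightarrow> 0 < f s" and half: "\<And>s. w0 \<le> s \<Longrightarrow> f s / 2 \<le> f s - pi\<^sup>2 * s"
    and mono: "\<And>s t. w0 \<le> s \<Longrightarrow> s \<le> t \<Longrightarrow> f s \<le> f t"
    and small: "\<And>t. w0 \<le> t \<Longrightarrow> integral {w0..t} (\<lambda>s. 1 / f s) < 1/8"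
    and R: "- R \<le> lower_bound n \<omega>" and a: "w0 + K + R \<le> \<sigma> * a"
    and jump: "\<sigma> * (2 * a) \<le> increment \<omega> (real n) (real n + 1/2)"
    and bad: "measure lborel {t \<in> {real n + 1/2..real n + 1/2 + 1/2}.
      increment \<omega> (real n + 1/2) t < - (\<sigma> * a)} \<le> 1/4"
  shows False
proof -
  have sp: "\<omega> \<in> space M" using \<omega> by (simp add: regular_def)
  obtain m where m: "ereal (real n + 1) < hitting_time m \<omega>"
    using alive by (auto simp: alive_def add.commute)
  note cont = increment_continuous[OF sp, of "real n"]
  show False
  proof (rule superlinear_drift_explodes[where a = "real n" and h = "\<sigma> * a" and Z = "mass m \<omega>"
        and k = "reaction m \<omega>" and N = "\<lambda>t. increment \<omega> (real n) t" and f = f])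
    show "f (mass m \<omega> s) \<le> reaction m \<omega> s" if "s \<in> {real n..real n + 1}" for s
      using that by (intro reaction_ge[OF sp _ _ m]) auto
    show "mass m \<omega> t = mass m \<omega> (real n) + integral {real n..t} (\<lambda>s. reaction m \<omega> s - pi\<^sup>2 * mass m \<omega> s)
        + (increment \<omega> (real n) t)" if "t \<in> {real n..real n + 1}" for t
      using that by (intro mass_equation \<omega>) auto
    show "continuous_on UNIV f" by (rule convex_on_continuous[OF open_UNIV f_convex])
    show "w0 + K - \<sigma> * a \<le> mass m \<omega> (real n)"
      using a R mass_ge_lower_bound[OF \<omega>, of n m] by linarith
    let ?B = "{t \<in> {real n + 1/2..real n + 1}. increment \<omega> (real n) t < \<sigma> * a}"
    have "measure lborel ?B \<le> measure lborel {t \<in> {real n + 1/2..real n + 1/2 + 1/2}.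
        increment \<omega> (real n + 1/2) t < - (\<sigma> * a)}"
    proof (rule measure_mono_fmeasurable)
      show "?B \<in> sets lborel"
        by (intro fmeasurableD strict_sublevel_fmeasurable continuous_on_subset[OF cont[of "real n + 1"]]) auto
      show "{t \<in> {real n + 1/2..real n + 1/2 + 1/2}.
          increment \<omega> (real n + 1/2) t < - (\<sigma> * a)} \<in> fmeasurable lborel"
        by (intro strict_sublevel_fmeasurable increment_continuous sp) auto
    qed (use jump in auto)
    with bad show "measure lborel ?B \<le> 1/4" by simp
  qed (use K pos half mono small cont in \<open>auto intro: continuous_on_subset[OF mass_continuous[OF sp]]
      continuous_on_subset[OF reaction_continuous[OF sp]]\<close>)
qed

lemma lower_bound_far_prob:
  assumes "0 < R" "0 \<le> C" and mean: "(\<integral>\<^sup>+\<omega>. ennreal \<bar>lower_bound n \<omega>\<bar> \<partial>M) \<le> ennreal C"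
  shows "prob {\<omega> \<in> space M. R \<le> \<bar>lower_bound n \<omega>\<bar>} \<le> C / R"
proof -
  have eq: "R \<le> \<bar>y\<bar> \<longleftrightarrow> 1 \<le> ennreal (1 / R) * ennreal \<bar>y\<bar>" for y
  proof -
    have "R \<le> \<bar>y\<bar> \<longleftrightarrow> 1 \<le> 1 / R * \<bar>y\<bar>" using assms(1) by (simp add: field_simps)
    also have "\<dots> \<longleftrightarrow> 1 \<le> ennreal (1 / R) * ennreal \<bar>y\<bar>"
      using assms(1) by (simp add: ennreal_mult[symmetric] ennreal_1[symmetric] del: ennreal_1)
    finally show ?thesis .
  qed
  have "ennreal (prob {\<omega> \<in> space M. R \<le> \<bar>lower_bound n \<omega>\<bar>}) =
      emeasure M {\<omega> \<in> space M. 1 \<le> ennreal (1 / R) * ennreal \<bar>lower_bound n \<omega>\<bar>}"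
    unfolding eq by (simp add: emeasure_eq_measure)
  also have "\<dots> \<le> ennreal (1 / R) * (\<integral>\<^sup>+\<omega>. ennreal \<bar>lower_bound n \<omega>\<bar> * indicator (space M) \<omega> \<partial>M)"
    by (rule nn_integral_Markov_inequality) auto
  also have "(\<integral>\<^sup>+\<omega>. ennreal \<bar>lower_bound n \<omega>\<bar> * indicator (space M) \<omega> \<partial>M) = (\<integral>\<^sup>+\<omega>. ennreal \<bar>lower_bound n \<omega>\<bar> \<partial>M)"
    by (rule nn_integral_cong) simp
  also have "ennreal (1 / R) * \<dots> \<le> ennreal (1 / R) * ennreal C"
    by (intro mult_left_mono mean) auto
  also have "\<dots> = ennreal (C / R)" using assms(1,2) by (simp add: ennreal_mult[symmetric])
  finally show ?thesis using assms(1,2) by (subst (asm) ennreal_le_iff) auto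
qed

lemma prob_alive_limit_le:
  assumes \<epsilon>: "0 < \<epsilon>"
  shows "prob (\<Inter>n. alive n) \<le> \<epsilon>"
proof -
  obtain C where C: "0 \<le> C" "\<And>n. (\<integral>\<^sup>+\<omega>. ennreal \<bar>lower_bound n \<omega>\<bar> \<partial>M) \<le> ennreal C"
    using lower_bound_tight by blast
  \<comment> \<open>By Markov's inequality the lower bound leaves \<open>[-R, R]\<close> with
    probability at most \<open>\<epsilon>\<close>, for every \<open>n\<close>; the summand 1 keeps
    \<open>R\<close> positive also when \<open>C = 0\<close>.\<close>
  define R where "R = C / \<epsilon> + 1"
  have R: "0 < R" "C / R \<le> \<epsilon>" using C \<epsilon> by (auto simp: R_def field_simps)
  obtain K w0 where K: "0 \<le> K" "\<And>s. - K \<le> f s - pi\<^sup>2 * s"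
    and pos: "\<And>s. w0 \<le> s \<Longrightarrow> 0 < f s" and half: "\<And>s. w0 \<le> s \<Longrightarrow> f s / 2 \<le> f s - pi\<^sup>2 * s"
    and mono: "\<And>s t. w0 \<le> s \<Longrightarrow> s \<le> t \<Longrightarrow> f s \<le> f t"
    and small: "\<And>t. w0 \<le> t \<Longrightarrow> integral {w0..t} (\<lambda>s. 1 / f s) < 1/8"
    using convex_reciprocal_integrable_growth[OF f_convex f_nonneg f_reciprocal, of "pi\<^sup>2" "1/8"] by auto
  \<comment> \<open>Since 15 squared is 225, the first entry ensures \<open>208 <= a^2\<close>; the
    second makes the jump outweigh a starting mass of \<open>- R\<close>.\<close>
  define a where "a = max 15 ((w0 + K + R) / \<sigma>)"
  have "(w0 + K + R) / \<sigma> \<le> a" by (simp add: a_def)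
  then have a_ge: "w0 + K + R \<le> \<sigma> * a" using \<sigma>_pos by (simp add: divide_le_eq mult.commute)
  have a15: "15 \<le> a" by (simp add: a_def)
  have a_pos: "0 < a" "0 \<le> 2 * a" using a15 by auto
  have a_sq: "208 \<le> a\<^sup>2" using power_mono[OF a15, of 2] by simp
  define q where "q = jump_weight (2 * a)"
  have q: "0 < q" by (simp add: q_def)
  \<comment> \<open>Three nested events: \<open>D1\<close> alive with a controlled lower bound,
    \<open>D2\<close> also with a large jump (factor \<open>q\<close>), \<open>D3\<close> also with
    the jump mostly kept (factor 1/2). Each factor is applied to an event of the matching past, at
    times \<open>n\<close> and \<open>n + 1/2\<close>. Almost all of \<open>D3\<close> dies before
    \<open>n + 1\<close>.\<close>
  have step: "q / 2 * (prob (alive n) - \<epsilon>) \<le> prob (alive n) - prob (alive (Suc n))" for n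
  proof -
    let ?s = "real n + 1/2"
    have s: "0 \<le> ?s" by simp
    define D1 where "D1 = alive n \<inter> {\<omega> \<in> space M. - R \<le> lower_bound n \<omega>}"
    define D2 where "D2 = D1 \<inter> {\<omega> \<in> space M. \<sigma> * (2 * a) \<le> increment \<omega> (real n) ?s}"
    define D3 where "D3 = D2 \<inter> {\<omega> \<in> space M. measure lborel
      {t \<in> {?s..?s + 1/2}. increment \<omega> ?s t < - (\<sigma> * a)} \<le> 1/4}"
    have "{\<omega> \<in> space (F (real n)). - R \<le> lower_bound n \<omega>} \<in> sets (F (real n))"
      using lower_bound_measurable[of n] by measurable
    then have D1: "D1 \<in> sets (F (real n))"
      unfolding D1_def by (intro sets.Int alive_measurable) (simp add: space_F)
    have [measurable]: "(\<lambda>\<omega>. noise_path \<omega> ?s) \<in> borel_measurable (F ?s)"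
      "(\<lambda>\<omega>. noise_path \<omega> (real n)) \<in> borel_measurable (F ?s)"
      by (auto intro!: noise_path_measurable)
    have "{\<omega> \<in> space (F ?s). \<sigma> * (2 * a) \<le> increment \<omega> (real n) ?s} \<in> sets (F ?s)"
      by measurable
    moreover have "D1 \<in> sets (F ?s)" using D1 F_mono[of "real n" ?s] by auto
    ultimately have D2: "D2 \<in> sets (F ?s)"
      unfolding D2_def by (intro sets.Int) (simp_all add: space_F)
    note mostly = noise_path_mostly_above[OF s a_pos(1) a_sq D2]
    have D1_ev: "D1 \<in> events" by (rule F_events[OF _ D1]) simp
    have D3: "D3 \<in> events"
      unfolding D3_def by (intro sets.Int mostly(1) F_events[OF s D2])
    have "prob (alive n) \<le> prob (D1 \<union> {\<omega> \<in> space M. R \<le> \<bar>lower_bound n \<omega>\<bar>})"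
    proof (rule finite_measure_mono)
      show "D1 \<union> {\<omega> \<in> space M. R \<le> \<bar>lower_bound n \<omega>\<bar>} \<in> events" using D1_ev by measurable
    qed (auto simp: D1_def alive_def)
    also have "\<dots> \<le> prob D1 + prob {\<omega> \<in> space M. R \<le> \<bar>lower_bound n \<omega>\<bar>}"
    proof (rule measure_Un_le)
      show "{\<omega> \<in> space M. R \<le> \<bar>lower_bound n \<omega>\<bar>} \<in> events" by measurable
    qed (rule D1_ev)
    also have "\<dots> \<le> prob D1 + \<epsilon>"
      using lower_bound_far_prob[OF R(1) C(1) C(2), of n] R(2) by simp
    finally have "q * (prob (alive n) - \<epsilon>) \<le> q * prob D1" using q by (intro mult_left_mono) auto
    also have "\<dots> \<le> prob D2"
      unfolding q_def D2_def by (intro noise_path_large_prob D1 a_pos) simp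
    finally have "q / 2 * (prob (alive n) - \<epsilon>) \<le> prob D2 / 2" by simp
    also have "\<dots> \<le> prob D3" unfolding D3_def by (rule mostly(2))
    also have "prob D3 = prob (D3 - alive (Suc n))"
    proof (rule finite_measure_eq_AE)
      show "AE \<omega> in M. (\<omega> \<in> D3) = (\<omega> \<in> D3 - alive (Suc n))"
        using AE_regular
      proof eventually_elim
        case (elim \<omega>)
        have "\<omega> \<notin> alive (Suc n)" if "\<omega> \<in> D3"
        proof
          assume "\<omega> \<in> alive (Suc n)"
          then show False
            by (rule favourable_noise_kills[OF elim _ K pos half mono small _ a_ge])
               (use that in \<open>auto simp: D3_def D2_def D1_def\<close>)
        qed
        then show ?case by blast
      qed
    qed (use D3 alive_event in auto)
    also have "\<dots> \<le> prob (alive n - alive (Suc n))"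
      using D3 alive_event by (intro finite_measure_mono) (auto simp: D3_def D2_def D1_def)
    also have "\<dots> = prob (alive n) - prob (alive (Suc n))"
      by (intro finite_measure_Diff alive_event alive_Suc_subset)
    finally show ?thesis .
  qed
  have "decseq alive" using alive_Suc_subset by (rule decseq_SucI)
  then have lim: "(\<lambda>n. prob (alive n)) \<longlonglongrightarrow> prob (\<Inter>n. alive n)"
    using alive_event by (intro finite_Lim_measure_decseq) auto
  \<comment> \<open>The decrements of a convergent sequence tend to 0, whereas \<open>q\<close> does
    not depend on \<open>n\<close>; so the limit cannot exceed \<open>\<epsilon>\<close>.\<close>
  have "q / 2 * (prob (\<Inter>n. alive n) - \<epsilon>) \<le> prob (\<Inter>n. alive n) - prob (\<Inter>n. alive n)"
  proof (rule LIMSEQ_le)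
    show "(\<lambda>n. q / 2 * (prob (alive n) - \<epsilon>)) \<longlonglongrightarrow> q / 2 * (prob (\<Inter>n. alive n) - \<epsilon>)"
      by (intro tendsto_intros lim)
    show "(\<lambda>n. prob (alive n) - prob (alive (Suc n))) \<longlonglongrightarrow> prob (\<Inter>n. alive n) - prob (\<Inter>n. alive n)"
      by (intro tendsto_diff lim LIMSEQ_Suc[OF lim])
  qed (use step in blast)
  then show ?thesis using q by (simp add: mult_le_0_iff)
qed

lemma AE_hitting_times_bounded: "AE \<omega> in M. \<exists>n. \<forall>m. hitting_time m \<omega> \<le> ereal (real n)"
proof -
  have "prob (\<Inter>n. alive n) \<le> 0"
    by (rule field_le_epsilon) (use prob_alive_limit_le in simp)
  then have "prob (\<Inter>n. alive n) = 0" using measure_nonneg[of M "\<Inter>n. alive n"] by linarith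
  then have "(\<Inter>n. alive n) \<in> null_sets M"
    using alive_event by (auto simp: null_sets_def emeasure_eq_measure intro!: sets.countable_INT)
  then have "AE \<omega> in M. \<omega> \<notin> (\<Inter>n. alive n)" by (rule AE_not_in)
  then show ?thesis
    using AE_space by eventually_elim (auto simp: alive_def not_less)
qed

text \<open>A uniform bound on the hitting times is not enough: \<open>lim\<close> is informative
  only for a convergent sequence, and monotonicity in the level identifies it with the
  supremum.\<close>

lemma AE_explosion: "AE \<omega> in M. lim (\<lambda>m. hitting_time m \<omega>) < \<infinity>"
  using AE_hitting_times_bounded AE_regular
proof eventually_elim
  case (elim \<omega>)
  then obtain n where n: "\<And>m. hitting_time m \<omega> \<le> ereal (real n)" by blast
  have "lim (\<lambda>m. hitting_time m \<omega>) = (SUP m. hitting_time m \<omega>)"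
    by (intro limI LIMSEQ_SUP hitting_time_mono elim)
  also have "\<dots> \<le> ereal (real n)" by (intro SUP_least n)
  also have "\<dots> < \<infinity>" by simp
  finally show ?case .
qed

end

theorem theorem3p2:
  fixes M :: "'w measure" and F :: "real \<Rightarrow> 'w measure"
    and W :: "(real \<times> real) set \<Rightarrow> 'w \<Rightarrow> real"
    and \<sigma> :: real and f u0 :: "real \<Rightarrow> real"
    and u :: "'w \<Rightarrow> real \<Rightarrow> real \<Rightarrow> real" and T :: "'w \<Rightarrow> ereal"
  assumes "space_time_white_noise M F W"
    and "\<sigma> > 0"
    and "\<forall>s. 0 \<le> f s"
    and "convex_on UNIV f"
    and "reciprocal_integrable_at_top f"
    and "u0 \<in> C0"
    and "\<forall>x\<in>{0..1}. 0 \<le> u0 x"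
    and "maximal_solution M F W \<sigma> f u0 u T"
  shows "measure M {\<omega> \<in> space M. T \<omega> < \<infinity>} = 1"
proof -
  obtain U where U: "\<And>m. spde_solution M F W \<sigma> (truncation f m) u0 (U m)"
    and T: "\<And>\<omega>. \<omega> \<in> space M \<Longrightarrow> T \<omega> = lim (\<lambda>m. reach_time m (U m \<omega>))"
    using assms(8) unfolding maximal_solution_def by blast
  interpret truncated_solutions M F W \<sigma> f u0 U
    using assms U by (intro truncated_solutions.intro truncated_solutions_axioms.intro) auto
  \<comment> \<open>\<open>measure\<close> returns 0 on a set that is not measurable, so the
    explosion event has to be shown measurable before its probability can be read off from the
    almost sure statement.\<close>
  have [measurable]: "(\<lambda>\<omega>. lim (\<lambda>m. reach_time m (U m \<omega>))) \<in> borel_measurable M"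
    by (intro borel_measurable_lim reach_time_measurable adapted)
  have "{\<omega> \<in> space M. T \<omega> < \<infinity>} = {\<omega> \<in> space M. lim (\<lambda>m. reach_time m (U m \<omega>)) < \<infinity>}"
    using T by auto
  also have "prob \<dots> = 1"
    using AE_explosion by (subst prob_Collect_eq_1) auto
  finally show ?thesis .
qed

end
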